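(* Let $Z_1,Z_2,\dots$ be i.i.d. copies of $Z\sim P$, let $\Xi$ be an open subset of a Euclidean space, let $m_\xi:\mathcal Z\to\mathbb R$ ($\xi\in\Xi$) be known functions, and let $\xi_0$ be the unique maximizer over $\Xi$ of $M(\xi)=Pm_\xi$. Assume Conditions (C1), (C2), (C3) and the regularity Conditions (A), (B), (C) of the context. Let $\{\widehat\xi_n^{\mathrm{res}}\}$ be any strong M-estimator sequence for $M_n(\xi)=\frac1n\sum_{i=1}^nm_\xi(Z_i)$ over $\Xi^{\mathrm{res}}=g(\Theta)$ that converges in probability to $\xi_0$. Then $$\sqrt n(\widehat\xi_n^{\mathrm{res}}-\xi_0)=\frac1{\sqrt n}\sum_{i=1}^n\Pi_{\xi_0(-V_{\xi_0})}\,IF_{\xi_0}(Z_i)+o_p(1),$$ where $IF_{\xi_0}(z)=-V_{\xi_0}^{-1}\dot m_{\xi_0}(z)$, $V_{\xi_0}$ is the nonsingular symmetric second derivative matrix of $M$ at $\xi_0$, and $\Pi_{\xi_0(-V_{\xi_0})}$ is the projection $\Pi_{\xi_0(\Sigma)}$ of the context with $\Sigma=-V_{\xi_0}$. Moreover, $\sqrt n(\widehat\xi_n^{\mathrm{res}}-\xi_0)$ is asymptotically normal with mean zero and asymptotic variance $$\Pi_{\xi_0(-V_{\xi_0})}\,V_{\xi_0}^{-1}\,P\{\dot m_{\xi_0}\dot m_{\xi_0}^T\}\,V_{\xi_0}^{-1}\,\Pi_{\xi_0(-V_{\xi_0})}^T.$$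
   Context: $Pf=\mathrm E[f(Z)]$. $\dot m_{\xi_0}(z)$ is the column vector of derivatives of $\xi\mapsto m_\xi(z)$ at $\xi_0$; $\nabla f$ denotes the Jacobian matrix of $f$; $\mathrm{span}\,A$ is the column space of $A$. A strong M-estimator for $M_n$ over $\Xi^{\mathrm{res}}$ is an estimator $\widehat\xi_n^{\mathrm{res}}=\widehat\xi_n^{\mathrm{res}}(Z_1,\dots,Z_n)\in\Xi^{\mathrm{res}}$ with $M_n(\widehat\xi_n^{\mathrm{res}})\ge\sup_{\xi\in\Xi^{\mathrm{res}}}M_n(\xi)-A_n$, $A_n=o_p(n^{-1})$. (C1) There exist an open set $\Theta\subset\mathbb R^q$ and a map $g:\Theta\to\Xi$ such that $\xi_0\in g(\Theta)=\Xi^{\mathrm{res}}$. (C2) There exist a set $\mathcal M$, open in $\Xi^{\mathrm{res}}$ (relative topology), with $\xi_0\in\mathcal M\subset g(\Theta)$, an open set $\mathcal S\subset\mathbb R^{q_s}$, $q_s\le q$, and a map $h:\mathcal S\to\mathcal M$ that is a bijection, bi-continuous ($h$ and $h^{-1}$ continuous), twice continuously differentiable, with $\xi_0=h(s_0)$ for some $s_0\in\mathcal S$; the Jacobian $\nabla h(s_0)$ has full column rank. (C3) For each $\theta_0\in g^{-1}(\xi_0)$, $g$ is differentiable at $\theta_0$ and $\mathrm{span}\,\nabla g(\theta_0)=\mathrm{span}\,\nabla h(s_0)$. Projection: for a positive definite matrix $\Sigma$, $\Pi_{\xi_0(\Sigma)}$ is the orthogonal projection onto $T_{\xi_0}=\mathrm{span}\,\nabla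 g(\theta_0)=\mathrm{span}\,\nabla h(s_0)$ with respect to the inner product defined by $\Sigma$: $$\Pi_{\xi_0(\Sigma)}=\nabla g(\theta_0)(\nabla g(\theta_0)^T\Sigma\nabla g(\theta_0))^{\dagger}\nabla g(\theta_0)^T\Sigma=\nabla h(s_0)(\nabla h(s_0)^T\Sigma\nabla h(s_0))^{-1}\nabla h(s_0)^T\Sigma,$$ where $A^\dagger$ is a generalised inverse of $A$. (A) For each $\xi\in\Xi$, $m_\xi(z)$ is a measurable function of $z$, and $\xi\mapsto m_\xi(z)$ is differentiable at $\xi_0$ for almost every $z$, with derivative $\dot m_{\xi_0}(z)$. (B) There is a measurable function $\phi$ with $P\phi^2<\infty$ such that, for any $\xi_1,\xi_2$ in a neighborhood of $\xi_0$, $|m_{\xi_1}(z)-m_{\xi_2}(z)|\le\phi(z)\|\xi_1-\xi_2\|$. (C) The map $\xi\mapsto Pm_\xi$ admits a second order Taylor expansion at the point of maximum $\xi_0$ with nonsingular symmetric second derivative matrix $V_{\xi_0}$. *)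

theory Defs
  imports "HOL-Probability.Probability"
begin

section \<open>Stochastic convergence\<close>

text \<open>Convergence in probability to a constant. Measurability is part of the notion because
  \<^const>\<open>measure\<close> is 0 on non-measurable sets.\<close>

definition converges_in_probability ::
    "'w measure \<Rightarrow> (nat \<Rightarrow> 'w \<Rightarrow> 'b::metric_space) \<Rightarrow> 'b \<Rightarrow> bool" where
  "converges_in_probability \<Omega> X l \<longleftrightarrow>
     (\<forall>n. X n \<in> borel_measurable \<Omega>) \<and>
     (\<forall>\<epsilon>>0. (\<lambda>n. measure \<Omega> {\<omega> \<in> space \<Omega>. dist (X n \<omega>) l > \<epsilon>}) \<longlonglongrightarrow> 0)"

text \<open>\<open>small_o_p \<Omega> r X\<close>: \<open>X\<^sub>n = o\<^sub>p(r\<^sub>n)\<close>, i.e. \<open>X\<^sub>n / r\<^sub>n\<close> tends to 0 in probability.\<close>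

definition small_o_p ::
    "'w measure \<Rightarrow> (nat \<Rightarrow> real) \<Rightarrow> (nat \<Rightarrow> 'w \<Rightarrow> 'b::real_normed_vector) \<Rightarrow> bool" where
  "small_o_p \<Omega> r X \<longleftrightarrow> converges_in_probability \<Omega> (\<lambda>n \<omega>. X n \<omega> /\<^sub>R r n) 0"

definition converges_in_distribution ::
    "'w measure \<Rightarrow> (nat \<Rightarrow> 'w \<Rightarrow> 'b::metric_space) \<Rightarrow> 'b measure \<Rightarrow> bool" where
  "converges_in_distribution \<Omega> X \<mu> \<longleftrightarrow>
     (\<forall>n. X n \<in> borel_measurable \<Omega>) \<and>
     (\<forall>f :: 'b \<Rightarrow> real. continuous_on UNIV f \<longrightarrow> bounded (range f) \<longrightarrow>
        (\<lambda>n. \<integral>\<omega>. f (X n \<omega>) \<partial>\<Omega>) \<longlonglongrightarrow> (\<integral>x. f x \<partial>\<mu>))"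

text \<open>The possibly degenerate normal law \<open>N(a, \<Gamma>)\<close>: every linear functional \<open>x \<mapsto> t \<bullet> x\<close> has the
  univariate law \<open>N(t \<bullet> a, t \<bullet> \<Gamma> t)\<close>, read as a point mass when the variance vanishes.\<close>

definition multivariate_normal ::
    "real^'p \<Rightarrow> real^'p^'p \<Rightarrow> (real^'p) measure \<Rightarrow> bool" where
  "multivariate_normal a \<Gamma> \<mu> \<longleftrightarrow>
     prob_space \<mu> \<and> sets \<mu> = sets borel \<and> transpose \<Gamma> = \<Gamma> \<and>
     (\<forall>t. t \<bullet> (\<Gamma> *v t) \<ge> 0 \<and>
        distr \<mu> borel (\<lambda>x. t \<bullet> x) =
          (if t \<bullet> (\<Gamma> *v t) = 0 then return borel (t \<bullet> a)
           else density lborel (normal_density (t \<bullet> a) (sqrt (t \<bullet> (\<Gamma> *v t))))))"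

definition asymptotically_normal ::
    "'w measure \<Rightarrow> (nat \<Rightarrow> 'w \<Rightarrow> real^'p) \<Rightarrow> real^'p \<Rightarrow> real^'p^'p \<Rightarrow> bool" where
  "asymptotically_normal \<Omega> X a \<Gamma> \<longleftrightarrow>
     (\<exists>\<mu>. multivariate_normal a \<Gamma> \<mu> \<and> converges_in_distribution \<Omega> X \<mu>)"


section \<open>Smoothness\<close>

definition twice_continuously_differentiable_on ::
    "('a::real_normed_vector \<Rightarrow> 'b::real_normed_vector) \<Rightarrow> 'a set \<Rightarrow> bool" where
  "twice_continuously_differentiable_on f S \<longleftrightarrow>
     (\<exists>(f' :: 'a \<Rightarrow> 'a \<Rightarrow>\<^sub>L 'b) (f'' :: 'a \<Rightarrow> 'a \<Rightarrow>\<^sub>L ('a \<Rightarrow>\<^sub>L 'b)).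
        (\<forall>x\<in>S. (f has_derivative blinfun_apply (f' x)) (at x)) \<and>
        (\<forall>x\<in>S. (f' has_derivative blinfun_apply (f'' x)) (at x)) \<and>
        continuous_on S f'')"

definition second_order_taylor ::
    "(real^'p \<Rightarrow> real) \<Rightarrow> real^'p \<Rightarrow> real^'p \<Rightarrow> real^'p^'p \<Rightarrow> bool" where
  "second_order_taylor F x0 b V \<longleftrightarrow>
     ((\<lambda>x. (F x - F x0 - b \<bullet> (x - x0) - (1/2) * ((x - x0) \<bullet> (V *v (x - x0)))) / (norm (x - x0))\<^sup>2)
        \<longlongrightarrow> 0) (at x0)"


section \<open>M-estimation\<close>

definition empirical_criterion ::
    "('x \<Rightarrow> 'z \<Rightarrow> real) \<Rightarrow> (nat \<Rightarrow> 'w \<Rightarrow> 'z) \<Rightarrow> nat \<Rightarrow> 'w \<Rightarrow> 'x \<Rightarrow> real" where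
  "empirical_criterion m Z n \<omega> \<xi> = (1 / real n) * (\<Sum>i<n. m \<xi> (Z i \<omega>))"

text \<open>The sample is \<open>Z 0, \<dots>, Z (n - 1)\<close>; an estimator is a measurable function \<open>est n\<close> of it.\<close>

definition estimate ::
    "(nat \<Rightarrow> (nat \<Rightarrow> 'z) \<Rightarrow> 'x) \<Rightarrow> (nat \<Rightarrow> 'w \<Rightarrow> 'z) \<Rightarrow> nat \<Rightarrow> 'w \<Rightarrow> 'x" where
  "estimate est Z n \<omega> = est n (\<lambda>i\<in>{..<n}. Z i \<omega>)"

text \<open>The supremum is taken in \<^typ>\<open>ereal\<close>, so that it is meaningful (and rules out the
  inequality) when the criterion is unbounded above.\<close>

definition strong_M_estimator ::
    "'w measure \<Rightarrow> 'z measure \<Rightarrow> (nat \<Rightarrow> 'w \<Rightarrow> 'z) \<Rightarrow> ('x::real_normed_vector \<Rightarrow> 'z \<Rightarrow> real) \<Rightarrow>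
     'x set \<Rightarrow> (nat \<Rightarrow> (nat \<Rightarrow> 'z) \<Rightarrow> 'x) \<Rightarrow> bool" where
  "strong_M_estimator \<Omega> P Z m X est \<longleftrightarrow>
     (\<forall>n\<ge>1. est n \<in> borel_measurable (Pi\<^sub>M {..<n} (\<lambda>_. P)) \<and>
             est n ` space (Pi\<^sub>M {..<n} (\<lambda>_. P)) \<subseteq> X) \<and>
     (\<exists>A :: nat \<Rightarrow> 'w \<Rightarrow> real.
        small_o_p \<Omega> (\<lambda>n. 1 / real n) A \<and>
        (\<forall>n\<ge>1. AE \<omega> in \<Omega>.
           ereal (empirical_criterion m Z n \<omega> (estimate est Z n \<omega>))
             \<ge> (SUP \<xi>\<in>X. ereal (empirical_criterion m Z n \<omega> \<xi>)) - ereal (A n \<omega>)))"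

definition influence_function ::
    "real^'p^'p \<Rightarrow> ('z \<Rightarrow> real^'p) \<Rightarrow> 'z \<Rightarrow> real^'p" where
  "influence_function V mdot z = - (matrix_inv V *v mdot z)"

definition outer_square :: "real^'p \<Rightarrow> real^'p^'p" where
  "outer_square x = (\<chi> i j. x $ i * x $ j)"


section \<open>Projection with respect to the inner product of a positive definite matrix\<close>

definition column_space :: "real^'n^'m \<Rightarrow> (real^'m) set" where
  "column_space A = span (columns A)"

definition positive_definite :: "real^'p^'p \<Rightarrow> bool" where
  "positive_definite \<Sigma> \<longleftrightarrow> transpose \<Sigma> = \<Sigma> \<and> (\<forall>x. x \<noteq> 0 \<longrightarrow> x \<bullet> (\<Sigma> *v x) > 0)"

definition is_projection_wrt :: "real^'p^'p \<Rightarrow> (real^'p) set \<Rightarrow> real^'p^'p \<Rightarrow> bool" where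
  "is_projection_wrt \<Sigma> T Q \<longleftrightarrow>
     (\<forall>x. Q *v x \<in> T \<and> (\<forall>y\<in>T. y \<bullet> (\<Sigma> *v (x - Q *v x)) = 0))"

definition projection_wrt :: "real^'p^'p \<Rightarrow> (real^'p) set \<Rightarrow> real^'p^'p" where
  "projection_wrt \<Sigma> T = (THE Q. is_projection_wrt \<Sigma> T Q)"

lemma column_space_eq_range: "column_space A = range ((*v) A)"
proof
  show "column_space A \<subseteq> range ((*v) A)"
    unfolding column_space_def columns_image_basis
    by (intro span_minimal) (auto intro: linear_subspace_image matrix_vector_mul_linear subspace_UNIV)
  show "range ((*v) A) \<subseteq> column_space A"
    unfolding column_space_def by (auto intro: matrix_vector_mult_in_columnspace)
qed

lemma positive_definite_eq_0:
  assumes "positive_definite \<Sigma>" "x \<bullet> (\<Sigma> *v x) = 0"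
  shows "x = 0"
  using assms unfolding positive_definite_def by force

lemma is_projection_wrt_unique:
  assumes S: "positive_definite \<Sigma>" and T: "subspace T"
    and 1: "is_projection_wrt \<Sigma> T Q" and 2: "is_projection_wrt \<Sigma> T R"
  shows "Q = R"
proof -
  have "Q *v x = R *v x" for x
  proof -
    define d where "d = Q *v x - R *v x"
    have d: "d \<in> T" using 1 2 T by (simp add: is_projection_wrt_def subspace_diff d_def)
    have "d \<bullet> (\<Sigma> *v (x - R *v x)) - d \<bullet> (\<Sigma> *v (x - Q *v x)) = 0"
      using 1 2 d by (simp add: is_projection_wrt_def)
    then have "d \<bullet> (\<Sigma> *v d) = 0"
      by (simp add: d_def matrix_vector_mult_diff_distrib inner_diff_right)
    then show ?thesis using positive_definite_eq_0[OF S] d_def by force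
  qed
  then show ?thesis by (simp add: matrix_eq)
qed

lemma inner_matrix_vector_transpose: "(N *v x) \<bullet> y = x \<bullet> (transpose N *v y)"
  for N :: "real^'k^'l"
  by (metis dot_lmul_matrix inner_commute transpose_matrix_vector transpose_transpose)

text \<open>The closed form with an arbitrary generalised inverse \<open>G\<close> of \<open>A\<^sup>T \<Sigma> A\<close>.\<close>

lemma projection_wrt_generalised_inverse:
  fixes A :: "real^'n^'p" and G :: "real^'n^'n"
  assumes S: "positive_definite \<Sigma>"
    and G: "(transpose A ** \<Sigma> ** A) ** G ** (transpose A ** \<Sigma> ** A) = transpose A ** \<Sigma> ** A"
  shows "is_projection_wrt \<Sigma> (column_space A) (A ** G ** transpose A ** \<Sigma>)"
    and "projection_wrt \<Sigma> (column_space A) = A ** G ** transpose A ** \<Sigma>"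
proof -
  let ?Q = "A ** G ** transpose A ** \<Sigma>"
  define B where "B = transpose A ** \<Sigma> ** A"
  have symS: "transpose \<Sigma> = \<Sigma>" using S by (simp add: positive_definite_def)
  have symB: "transpose B = B"
    by (simp add: B_def matrix_transpose_mul symS matrix_mul_assoc)
  have "transpose (B ** G ** B) = transpose B"
    using G by (simp add: B_def)
  then have B: "B ** transpose G ** B = B"
    by (simp add: matrix_transpose_mul symB matrix_mul_assoc)
  have key: "A *v (transpose G *v (B *v v)) = A *v v" for v
  proof -
    define u where "u = v - transpose G *v (B *v v)"
    have "B *v u = B *v v - (B ** transpose G ** B) *v v"
      by (simp add: u_def matrix_vector_mult_diff_distrib matrix_vector_mul_assoc matrix_mul_assoc)
    then have "u \<bullet> (B *v u) = 0" by (simp add: B)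
    then have "(A *v u) \<bullet> (\<Sigma> *v (A *v u)) = 0"
      by (simp add: B_def inner_matrix_vector_transpose matrix_vector_mul_assoc matrix_mul_assoc)
    then have "A *v u = 0" by (rule positive_definite_eq_0[OF S])
    then show ?thesis by (simp add: u_def matrix_vector_mult_diff_distrib)
  qed
  have orth: "(A *v v) \<bullet> (\<Sigma> *v (x - ?Q *v x)) = 0" for v x
  proof -
    have "(A *v v) \<bullet> (\<Sigma> *v (?Q *v x)) = (A *v (transpose G *v (B *v v))) \<bullet> (\<Sigma> *v x)"
      by (simp add: inner_matrix_vector_transpose matrix_vector_mul_assoc matrix_transpose_mul symB matrix_mul_assoc B_def symS)
    then have "(A *v v) \<bullet> (\<Sigma> *v (?Q *v x)) = (A *v v) \<bullet> (\<Sigma> *v x)"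
      unfolding key .
    then show ?thesis
      by (simp add: matrix_vector_mult_diff_distrib inner_diff_right)
  qed
  have 1: "is_projection_wrt \<Sigma> (column_space A) ?Q"
    unfolding is_projection_wrt_def column_space_eq_range
    using orth by (auto simp flip: matrix_mul_assoc matrix_vector_mul_assoc)
  show "is_projection_wrt \<Sigma> (column_space A) ?Q" by (rule 1)
  show "projection_wrt \<Sigma> (column_space A) = ?Q"
    unfolding projection_wrt_def
    using 1 is_projection_wrt_unique[OF S] by (intro the_equality) (auto simp: column_space_def)
qed

lemma projection_wrt_full_column_rank:
  fixes H :: "real^'s^'p"
  assumes S: "positive_definite \<Sigma>" and H: "rank H = CARD('s)"
  shows "projection_wrt \<Sigma> (column_space H) =
           H ** matrix_inv (transpose H ** \<Sigma> ** H) ** transpose H ** \<Sigma>"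
proof -
  let ?B = "transpose H ** \<Sigma> ** H"
  have "x = 0" if "?B *v x = 0" for x
  proof -
    have "(H *v x) \<bullet> (\<Sigma> *v (H *v x)) = x \<bullet> (?B *v x)"
      by (simp add: inner_matrix_vector_transpose matrix_vector_mul_assoc matrix_mul_assoc)
    then have "H *v x = 0" using that positive_definite_eq_0[OF S] by simp
    then show ?thesis using H matrix_nonfull_linear_equations_eq by blast
  qed
  then have "invertible ?B"
    using invertible_left_inverse matrix_left_invertible_ker by blast
  then have "?B ** matrix_inv ?B = mat 1"
    unfolding matrix_inv_def invertible_def by (rule someI2_ex) simp
  then have "?B ** matrix_inv ?B ** ?B = ?B" by simp
  then show ?thesis using projection_wrt_generalised_inverse(2)[OF S] by blast
qed

end

theory Submission
  imports Defs
begin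

text \<open>Write \<open>r\<^sub>\<xi> = m\<^sub>\<xi> - m\<^sub>\<xi>\<^sub>0 - mdot \<bullet> (\<xi> - \<xi>0)\<close>. Symmetrization and chaining along dyadic grids, with sub-Gaussian
  Rademacher sums, give \<open>E sup |\<Sum>\<^sub>i (r\<^sub>\<xi> (Z\<^sub>i) - P r\<^sub>\<xi>)| \<le> \<eta> \<delta> \<surd>n\<close> over \<open>|\<xi> - \<xi>0| \<le> \<delta>\<close>, where \<open>\<eta> \<rightarrow> 0\<close> as \<open>\<delta> \<rightarrow> 0\<close>:
  the first grids of the chain are controlled by the envelope \<open>sup |r\<^sub>\<xi>| / |\<xi> - \<xi>0|\<close>, which tends to 0 in \<open>L\<^sup>2\<close>, the
  later ones by the Lipschitz slope. Hence \<open>n (M\<^sub>n \<xi> - M\<^sub>n \<xi>0)\<close> is the quadratic \<open>x \<bullet> V x / 2 + u\<^sub>n \<bullet> x\<close> in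
  \<open>x = \<surd>n (\<xi> - \<xi>0)\<close>, up to a uniformly small error, with \<open>u\<^sub>n = n\<^sup>-\<^sup>1\<^sup>/\<^sup>2 \<Sum>\<^sub>i mdot (Z\<^sub>i)\<close>. Peeling gives the rate \<open>\<surd>n\<close>, and
  since \<open>g ` \<Theta>\<close> is approximated at \<open>\<xi>0\<close> by its tangent space, the estimator tracks the maximiser of this
  quadratic over the tangent space, which is the projection of \<open>- V\<^sup>-\<^sup>1 u\<^sub>n\<close>. The law of \<open>u\<^sub>n\<close> is treated by the
  one-dimensional central limit theorem and by trigonometric approximation of bounded continuous functions.\<close>


section \<open>Rademacher chaining\<close>

text \<open>The Lipschitz slope alone gives fluctuations of order \<open>\<delta> \<surd>n\<close>,
  enough for the rate but not for the linearization, where the constant must become arbitrarily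
  small. A small envelope alone does not help either, since it says nothing about the infinitely
  many fine links of a chain. This dictates the order of choices: fix the level \<open>K\<close>
  beyond which the links, weighted by the slope, are cheap; only then shrink \<delta> until the
  envelope pays for the grid of level \<open>K\<close>, whose entropy is by then a constant. Suprema
  over a ball need not be visibly measurable. Moments are therefore taken over countably many dyadic
  points and carried to the ball by continuity; afterwards the argument runs on
  \<open>holds_up_to\<close>, which speaks of measurable exceptional sets instead of events. The
  restricted set is compared with its tangent space in both directions: the estimator must be close
  to a tangent vector, and the tangent maximiser must be close to an admissible competitor. Nothing
  converges in the coordinates \<theta>, so \<open>g\<close> may be far from injective.\<close>

definition rsign :: "'i set \<Rightarrow> 'i \<Rightarrow> real" where
  "rsign A i = (if i \<in> A then 1 else -1)"

text \<open>The sub-Gaussian bound for a single sign. For x \<ge> 0 the derivative of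
  \<open>x\<^sup>2 / 2 - ln (cosh x)\<close> is x - tanh x, which is nonnegative because x cosh x -
  sinh x has derivative x sinh x.\<close>

lemma cosh_le_exp_square: "cosh x \<le> exp (x\<^sup>2 / 2)" for x :: real
proof -
  have *: "cosh x \<le> exp (x\<^sup>2 / 2)" if "x \<ge> 0" for x :: real
  proof -
    define f where "f = (\<lambda>x::real. x\<^sup>2 / 2 - ln (cosh x))"
    have "f 0 \<le> f x"
    proof (rule DERIV_nonneg_imp_nondecreasing[OF that])
      fix y :: real assume y: "0 \<le> y" "y \<le> x"
      have "(f has_real_derivative (y - sinh y / cosh y)) (at y)"
        unfolding f_def by (auto intro!: derivative_eq_intros simp: field_simps)
      moreover have "sinh y / cosh y \<le> y"
      proof -
        define k where "k = (\<lambda>x::real. x * cosh x - sinh x)"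
        have "k 0 \<le> k y"
        proof (rule DERIV_nonneg_imp_nondecreasing[OF y(1)])
          fix w :: real assume "0 \<le> w"
          then show "\<exists>d. (k has_real_derivative d) (at w) \<and> 0 \<le> d"
            unfolding k_def by (intro exI[of _ "w * sinh w"]) (auto intro!: derivative_eq_intros)
        qed
        then show ?thesis by (simp add: k_def field_simps)
      qed
      ultimately show "\<exists>d. (f has_real_derivative d) (at y) \<and> 0 \<le> d" by force
    qed
    then have "ln (cosh x) \<le> x\<^sup>2 / 2" by (simp add: f_def)
    then show ?thesis by (metis cosh_real_pos exp_le_cancel_iff exp_ln)
  qed
  show ?thesis using *[of x] *[of "-x"] by (cases "x \<ge> 0") auto
qed

text \<open>A sign vector is coded by the set \<open>A\<close> of its positive coordinates, so
  expectation over the signs is the sum over \<open>Pow I\<close> divided by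
  \<open>2 ^ card I\<close>. Expanding the product of the factors
  \<open>exp (a i) + exp (- a i)\<close> yields exactly this sum, which takes the place of
  independence.\<close>

lemma rademacher_exp_moment:
  assumes "finite I"
  shows "(\<Sum>A\<in>Pow I. exp (\<Sum>i\<in>I. rsign A i * a i)) \<le> 2 ^ card I * exp ((\<Sum>i\<in>I. (a i)\<^sup>2) / 2)"
proof -
  have "(\<Sum>A\<in>Pow I. exp (\<Sum>i\<in>I. rsign A i * a i)) =
        (\<Sum>A\<in>Pow I. (\<Prod>i\<in>A. exp (a i)) * (\<Prod>i\<in>I - A. exp (- a i)))"
  proof (intro sum.cong refl)
    fix A assume A: "A \<in> Pow I"
    then have "finite A" using assms finite_subset by blast
    have "(\<Sum>i\<in>I. rsign A i * a i) = (\<Sum>i\<in>A. rsign A i * a i) + (\<Sum>i\<in>I - A. rsign A i * a i)"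
      using A assms by (simp add: sum.subset_diff[of A I])
    also have "\<dots> = (\<Sum>i\<in>A. a i) + (\<Sum>i\<in>I - A. - a i)"
      by (intro arg_cong2[where f = "(+)"] sum.cong) (auto simp: rsign_def)
    finally show "exp (\<Sum>i\<in>I. rsign A i * a i) = (\<Prod>i\<in>A. exp (a i)) * (\<Prod>i\<in>I - A. exp (- a i))"
      using \<open>finite A\<close> assms by (simp only: exp_add exp_sum finite_Diff)
  qed
  also have "\<dots> = (\<Prod>i\<in>I. exp (a i) + exp (- a i))" using assms by (simp add: prod_add)
  also have "\<dots> \<le> (\<Prod>i\<in>I. 2 * exp ((a i)\<^sup>2 / 2))"
    using cosh_le_exp_square by (intro prod_mono) (auto simp: cosh_def field_simps)
  also have "\<dots> = 2 ^ card I * exp ((\<Sum>i\<in>I. (a i)\<^sup>2) / 2)"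
    using assms by (simp add: prod.distrib exp_sum sum_divide_distrib)
  finally show ?thesis .
qed

text \<open>The maximal inequality for sub-Gaussian variables, with \<open>2 * card F\<close>
  because both signs of every sum compete. Jensen's inequality for the logarithm is replaced by the
  tangent line of ln at one well chosen point \<open>c\<close>.\<close>

lemma rademacher_max:
  fixes a :: "'x \<Rightarrow> 'i \<Rightarrow> real"
  assumes I: "finite I" and F: "finite F" "F \<noteq> {}" and s: "s \<ge> 0"
    and a: "\<And>t. t \<in> F \<Longrightarrow> (\<Sum>i\<in>I. (a t i)\<^sup>2) \<le> s\<^sup>2"
  shows "(\<Sum>A\<in>Pow I. Max ((\<lambda>t. \<bar>\<Sum>i\<in>I. rsign A i * a t i\<bar>) ` F))
           \<le> 2 ^ card I * (s * sqrt (2 * ln (2 * card F)))"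
proof (cases "s = 0")
  case True
  then have "(\<Sum>i\<in>I. (a t i)\<^sup>2) = 0" if "t \<in> F" for t
    using a[OF that] by (simp add: sum_nonneg order.antisym)
  then have "a t i = 0" if "t \<in> F" "i \<in> I" for t i
    using that I by (simp add: sum_nonneg_eq_0_iff)
  then have "Max ((\<lambda>t. \<bar>\<Sum>i\<in>I. rsign A i * a t i\<bar>) ` F) = 0" for A
  proof -
    have "(\<lambda>t. \<bar>\<Sum>i\<in>I. rsign A i * a t i\<bar>) ` F = {0}"
      using \<open>\<And>t i. t \<in> F \<Longrightarrow> i \<in> I \<Longrightarrow> a t i = 0\<close> F by (auto simp: image_iff)
    then show ?thesis by simp
  qed
  then show ?thesis using True by simp
next
  case False
  with s have s: "s > 0" by simp
  define N where "N = real (card F)"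
  have N: "N \<ge> 1" using F by (simp add: N_def Suc_leI card_gt_0_iff)
  define L where "L = ln (2 * N)"
  have L: "L > 0" using N by (simp add: L_def)
  \<comment> \<open>The bound will be \<open>L / l + l * s\<^sup>2 / 2\<close>; this
    \<open>l\<close> minimises it by making both terms equal, whence
    \<open>ln c = 2 * L\<close>.\<close>
  define l where "l = sqrt (2 * L) / s"
  have l: "l > 0" using L s by (simp add: l_def)
  have ls: "l\<^sup>2 * s\<^sup>2 = 2 * L" using L s by (simp add: l_def power_divide)
  \<comment> \<open>An upper bound for the average of all the exponentials together, so that - 1 and
    + 1 from the tangent line cancel after averaging.\<close>
  define c where "c = 2 * N * exp (l\<^sup>2 * s\<^sup>2 / 2)"
  have c: "c > 0" using N by (simp add: c_def)
  define X where "X A t = (\<Sum>i\<in>I. rsign A i * a t i)" for A t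
  define Y where "Y A = Max ((\<lambda>t. \<bar>X A t\<bar>) ` F)" for A
  have lc: "ln c = 2 * L" using N ls by (simp add: c_def L_def ln_mult)
  have Y: "Y A \<le> (ln c - 1 + (\<Sum>t\<in>F. exp (l * X A t) + exp (- (l * X A t))) / c) / l" for A
  proof -
    have "Y A \<in> (\<lambda>t. \<bar>X A t\<bar>) ` F" unfolding Y_def using F by (intro Max_in) auto
    then obtain t where t: "t \<in> F" "Y A = \<bar>X A t\<bar>" by auto
    have "l * Y A - ln c = ln (exp (l * Y A) / c)" using c by (simp add: ln_div)
    also have "\<dots> \<le> exp (l * Y A) / c - 1" using c by (intro ln_le_minus_one) simp
    finally have 1: "l * Y A \<le> ln c - 1 + exp (l * Y A) / c" by simp
    have "exp (l * Y A) \<le> exp (l * X A t) + exp (- (l * X A t))"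
      using t by (auto simp: abs_real_def)
    also have "\<dots> \<le> (\<Sum>t\<in>F. exp (l * X A t) + exp (- (l * X A t)))"
      using F t by (intro member_le_sum) (auto intro: add_nonneg_nonneg)
    finally have "exp (l * Y A) / c \<le> (\<Sum>t\<in>F. exp (l * X A t) + exp (- (l * X A t))) / c"
      using c by (simp add: divide_right_mono)
    then show ?thesis using 1 l by (simp add: field_simps)
  qed
  have mom: "(\<Sum>A\<in>Pow I. exp (k * X A t)) \<le> 2 ^ card I * exp (l\<^sup>2 * s\<^sup>2 / 2)"
    if "t \<in> F" "k\<^sup>2 = l\<^sup>2" for t k
  proof -
    have "(\<Sum>A\<in>Pow I. exp (k * X A t)) = (\<Sum>A\<in>Pow I. exp (\<Sum>i\<in>I. rsign A i * (k * a t i)))"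
      by (simp add: X_def sum_distrib_left algebra_simps)
    also have "\<dots> \<le> 2 ^ card I * exp ((\<Sum>i\<in>I. (k * a t i)\<^sup>2) / 2)"
      by (rule rademacher_exp_moment[OF I])
    also have "(\<Sum>i\<in>I. (k * a t i)\<^sup>2) = l\<^sup>2 * (\<Sum>i\<in>I. (a t i)\<^sup>2)"
      by (simp add: power_mult_distrib sum_distrib_left that)
    finally have 1: "(\<Sum>A\<in>Pow I. exp (k * X A t)) \<le> 2 ^ card I * exp (l\<^sup>2 * (\<Sum>i\<in>I. (a t i)\<^sup>2) / 2)" .
    have "l\<^sup>2 * (\<Sum>i\<in>I. (a t i)\<^sup>2) \<le> l\<^sup>2 * s\<^sup>2" using a[OF that(1)] by (intro mult_left_mono) auto
    then show ?thesis by (intro order.trans[OF 1] mult_left_mono) auto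
  qed
  have "(\<Sum>A\<in>Pow I. \<Sum>t\<in>F. exp (l * X A t) + exp (- (l * X A t)))
        = (\<Sum>t\<in>F. (\<Sum>A\<in>Pow I. exp (l * X A t)) + (\<Sum>A\<in>Pow I. exp ((- l) * X A t)))"
    by (subst sum.swap) (simp add: sum.distrib)
  also have "\<dots> \<le> (\<Sum>t\<in>F. 2 ^ card I * exp (l\<^sup>2 * s\<^sup>2 / 2) + 2 ^ card I * exp (l\<^sup>2 * s\<^sup>2 / 2))"
    by (intro sum_mono add_mono mom) auto
  also have "\<dots> = 2 ^ card I * c" by (simp add: c_def N_def)
  finally have tot: "(\<Sum>A\<in>Pow I. \<Sum>t\<in>F. exp (l * X A t) + exp (- (l * X A t))) / c \<le> 2 ^ card I"
    using c by (simp add: field_simps)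
  have "(\<Sum>A\<in>Pow I. Y A) \<le> (\<Sum>A\<in>Pow I. (ln c - 1 + (\<Sum>t\<in>F. exp (l * X A t) + exp (- (l * X A t))) / c) / l)"
    by (intro sum_mono Y)
  also have "\<dots> = (2 ^ card I * (ln c - 1) + (\<Sum>A\<in>Pow I. \<Sum>t\<in>F. exp (l * X A t) + exp (- (l * X A t))) / c) / l"
    using I by (simp add: sum_divide_distrib[symmetric] sum.distrib card_Pow)
  also have "\<dots> \<le> (2 ^ card I * (ln c - 1) + 2 ^ card I) / l"
    using tot l by (simp add: divide_right_mono)
  also have "\<dots> = 2 ^ card I * (ln c / l)" by (simp add: algebra_simps)
  also have "ln c / l = s * sqrt (2 * L)"
    using lc l L s real_sqrt_mult_self[of "2 * L"] by (simp add: l_def field_simps flip: real_sqrt_mult)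
  finally show ?thesis by (simp add: Y_def X_def L_def N_def)
qed

definition chain_weight :: "'x set \<Rightarrow> real" where
  "chain_weight F = sqrt (2 * ln (2 * card F))"

text \<open>The chain is entered at level \<open>K\<close>, where the values themselves are bounded
  through \<open>D\<close>; only the links beyond \<open>K\<close> are charged to \<psi>. Replacing
  each point by its parent costs one finite maximum of increments per level.\<close>

lemma rademacher_chain:
  fixes a :: "'x \<Rightarrow> 'i \<Rightarrow> real"
  assumes I: "finite I" and G: "\<And>k. finite (G k)" "\<And>k. G k \<noteq> {}"
    and e: "\<And>k. e k \<ge> 0" and d: "d \<ge> 0"
    and step: "\<And>k t. t \<in> G (Suc k) \<Longrightarrow> \<exists>s\<in>G k. \<forall>i\<in>I. \<bar>a t i - a s i\<bar> \<le> e k * \<psi> i"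
    and base: "\<And>t i. t \<in> G K \<Longrightarrow> i \<in> I \<Longrightarrow> \<bar>a t i\<bar> \<le> d * D i"
  shows "(\<Sum>A\<in>Pow I. Max ((\<lambda>t. \<bar>\<Sum>i\<in>I. rsign A i * a t i\<bar>) ` G (K + m)))
     \<le> 2 ^ card I * (d * sqrt (\<Sum>i\<in>I. (D i)\<^sup>2) * chain_weight (G K)
         + (\<Sum>k<m. e (K + k) * chain_weight (G (K + Suc k))) * sqrt (\<Sum>i\<in>I. (\<psi> i)\<^sup>2))"
proof (induction m)
  case 0
  have "(\<Sum>A\<in>Pow I. Max ((\<lambda>t. \<bar>\<Sum>i\<in>I. rsign A i * a t i\<bar>) ` G K))
     \<le> 2 ^ card I * ((d * sqrt (\<Sum>i\<in>I. (D i)\<^sup>2)) * sqrt (2 * ln (2 * card (G K))))"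
  proof (rule rademacher_max[OF I G])
    show "0 \<le> d * sqrt (\<Sum>i\<in>I. (D i)\<^sup>2)" using d by (simp add: sum_nonneg)
    fix t assume t: "t \<in> G K"
    have "(\<Sum>i\<in>I. (a t i)\<^sup>2) \<le> (\<Sum>i\<in>I. (d * D i)\<^sup>2)"
      using base[OF t] by (intro sum_mono) (meson abs_ge_self abs_le_square_iff order.trans)
    also have "\<dots> = (d * sqrt (\<Sum>i\<in>I. (D i)\<^sup>2))\<^sup>2"
      by (simp add: power_mult_distrib sum_distrib_left sum_nonneg)
    finally show "(\<Sum>i\<in>I. (a t i)\<^sup>2) \<le> (d * sqrt (\<Sum>i\<in>I. (D i)\<^sup>2))\<^sup>2" .
  qed
  then show ?case by (simp add: chain_weight_def)
next
  case (Suc m)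
  let ?k = "K + m"
  have "\<forall>t\<in>G (Suc ?k). \<exists>s. s \<in> G ?k \<and> (\<forall>i\<in>I. \<bar>a t i - a s i\<bar> \<le> e ?k * \<psi> i)"
    using step by blast
  from bchoice[OF this] obtain p where
    p: "p t \<in> G ?k \<and> (\<forall>i\<in>I. \<bar>a t i - a (p t) i\<bar> \<le> e ?k * \<psi> i)" if "t \<in> G (Suc ?k)" for t
    by blast
  define b where "b t i = a t i - a (p t) i" for t i
  let ?Mx = "\<lambda>c A F. Max ((\<lambda>t. \<bar>\<Sum>i\<in>I. rsign A i * c t i\<bar>) ` F)"
  have "?Mx a A (G (Suc ?k)) \<le> ?Mx a A (G ?k) + ?Mx b A (G (Suc ?k))" for A
  proof (rule Max.boundedI)
    fix x assume "x \<in> (\<lambda>t. \<bar>\<Sum>i\<in>I. rsign A i * a t i\<bar>) ` G (Suc ?k)"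
    then obtain t where t: "t \<in> G (Suc ?k)" "x = \<bar>\<Sum>i\<in>I. rsign A i * a t i\<bar>" by auto
    have "(\<Sum>i\<in>I. rsign A i * a t i) = (\<Sum>i\<in>I. rsign A i * a (p t) i) + (\<Sum>i\<in>I. rsign A i * b t i)"
      by (simp add: b_def algebra_simps sum_subtractf)
    then have "x \<le> \<bar>\<Sum>i\<in>I. rsign A i * a (p t) i\<bar> + \<bar>\<Sum>i\<in>I. rsign A i * b t i\<bar>" using t by simp
    moreover have "\<bar>\<Sum>i\<in>I. rsign A i * a (p t) i\<bar> \<le> ?Mx a A (G ?k)" using p[OF t(1)] G by (intro Max_ge) auto
    moreover have "\<bar>\<Sum>i\<in>I. rsign A i * b t i\<bar> \<le> ?Mx b A (G (Suc ?k))" using t G by (intro Max_ge) auto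
    ultimately show "x \<le> ?Mx a A (G ?k) + ?Mx b A (G (Suc ?k))" by linarith
  qed (use G in auto)
  then have "(\<Sum>A\<in>Pow I. ?Mx a A (G (Suc ?k))) \<le> (\<Sum>A\<in>Pow I. ?Mx a A (G ?k)) + (\<Sum>A\<in>Pow I. ?Mx b A (G (Suc ?k)))"
    by (simp add: sum.distrib[symmetric] sum_mono)
  moreover have "(\<Sum>A\<in>Pow I. ?Mx b A (G (Suc ?k)))
     \<le> 2 ^ card I * ((e ?k * sqrt (\<Sum>i\<in>I. (\<psi> i)\<^sup>2)) * sqrt (2 * ln (2 * card (G (Suc ?k)))))"
  proof (rule rademacher_max[OF I G])
    show "0 \<le> e ?k * sqrt (\<Sum>i\<in>I. (\<psi> i)\<^sup>2)" using e by (simp add: sum_nonneg)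
    fix t assume t: "t \<in> G (Suc ?k)"
    have "(\<Sum>i\<in>I. (b t i)\<^sup>2) \<le> (\<Sum>i\<in>I. (e ?k * \<psi> i)\<^sup>2)"
      using p[OF t] unfolding b_def by (intro sum_mono) (meson abs_ge_self abs_le_square_iff order.trans)
    also have "\<dots> = (e ?k * sqrt (\<Sum>i\<in>I. (\<psi> i)\<^sup>2))\<^sup>2"
      by (simp add: power_mult_distrib sum_distrib_left sum_nonneg)
    finally show "(\<Sum>i\<in>I. (b t i)\<^sup>2) \<le> (e ?k * sqrt (\<Sum>i\<in>I. (\<psi> i)\<^sup>2))\<^sup>2" .
  qed
  ultimately show ?case using Suc.IH by (simp add: chain_weight_def algebra_simps)
qed

section \<open>Dyadic grids in the cube [-1, 1]^p\<close>

definition dyadic_grid :: "nat \<Rightarrow> (real^'p) set" where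
  "dyadic_grid k = {v. \<forall>i. \<exists>j::int. \<bar>j\<bar> \<le> 2 ^ k \<and> v $ i = of_int j / 2 ^ k}"

definition dyadic_cube :: "(real^'p) set" where
  "dyadic_cube = (\<Union>k. dyadic_grid k)"

lemma finite_card_dyadic_grid:
  "finite (dyadic_grid k :: (real^'p) set) \<and> card (dyadic_grid k :: (real^'p) set) \<le> (2 ^ (k + 2)) ^ CARD('p)"
proof -
  define J where "J = {- (2 ^ k) .. (2::int) ^ k}"
  define E where "E = PiE (UNIV :: 'p set) (\<lambda>_. J)"
  have sub: "(dyadic_grid k :: (real^'p) set) \<subseteq> (\<lambda>f. \<chi> i. of_int (f i) / 2 ^ k) ` E"
  proof
    fix v :: "real^'p" assume "v \<in> dyadic_grid k"
    then have "\<forall>i. \<exists>j::int. \<bar>j\<bar> \<le> 2 ^ k \<and> v $ i = of_int j / 2 ^ k" by (simp add: dyadic_grid_def)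
    then obtain f where f: "\<And>i. \<bar>f i :: int\<bar> \<le> 2 ^ k" "\<And>i. v $ i = of_int (f i) / 2 ^ k" by metis
    have "- (2 ^ k) \<le> f i \<and> f i \<le> 2 ^ k" for i using f(1)[of i] by linarith
    then have "f \<in> E" by (auto simp: E_def J_def)
    moreover have "v = (\<chi> i. of_int (f i) / 2 ^ k)" using f(2) by (simp add: vec_eq_iff)
    ultimately show "v \<in> (\<lambda>f. \<chi> i. of_int (f i) / 2 ^ k) ` E" by blast
  qed
  have fE: "finite E" by (auto simp: E_def J_def intro!: finite_PiE)
  have "card E = card J ^ CARD('p)" by (simp add: E_def card_PiE)
  also have "int (card J) = int (2 * 2 ^ k + 1)" by (simp add: J_def)
  then have "card J = 2 * 2 ^ k + 1" by (simp only: of_nat_eq_iff)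
  also have "(2 * 2 ^ k + 1) ^ CARD('p) \<le> (2 ^ (k + 2) :: nat) ^ CARD('p)" by (intro power_mono) auto
  finally have "card E \<le> (2 ^ (k + 2)) ^ CARD('p)" .
  then show ?thesis using sub fE by (meson card_image_le card_mono finite_imageI finite_subset le_trans)
qed

lemma zero_in_dyadic_grid: "0 \<in> dyadic_grid k"
  unfolding dyadic_grid_def by (auto intro!: exI[of _ "0::int"])

text \<open>The square root is removed by \<open>sqrt x \<le> x\<close> for x \<ge> 1. The resulting
  linear growth in \<open>k\<close> is harmless against link lengths of order
  \<open>1 / 2 ^ k\<close>.\<close>

lemma chain_weight_dyadic_grid:
  "chain_weight (dyadic_grid k :: (real^'p) set) \<le> 2 * CARD('p) * (k + 3)"
proof -
  let ?G = "dyadic_grid k :: (real^'p) set"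
  let ?p = "real CARD('p)"
  have p: "?p \<ge> 1" by (simp add: Suc_leI)
  have "card ?G \<noteq> 0" using finite_card_dyadic_grid[where ?'p = 'p and k = k] zero_in_dyadic_grid[where ?'a = 'p and k = k] by auto
  then have c1: "real (card ?G) \<ge> 1" by simp
  have "real (card ?G) \<le> real ((2 ^ (k + 2)) ^ CARD('p))"
    using finite_card_dyadic_grid[of k] by (intro of_nat_mono) blast
  then have "real (card ?G) \<le> 2 ^ ((k + 2) * CARD('p))" by (simp only: power_mult of_nat_power of_nat_numeral)
  then have "2 * real (card ?G) \<le> 2 ^ ((k + 2) * CARD('p) + 1)" by simp
  then have "ln (2 * real (card ?G)) \<le> ln (2 ^ ((k + 2) * CARD('p) + 1))"
    using c1 by (intro ln_mono) auto
  also have "\<dots> = ((k + 2) * ?p + 1) * ln 2" by (subst ln_realpow) (simp_all only: of_nat_add of_nat_mult of_nat_1 zero_less_numeral)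
  also have "\<dots> \<le> ((k + 2) * ?p + 1) * 1" by (intro mult_left_mono) (use ln_2_less_1 in auto)
  also have "\<dots> \<le> ?p * (k + 3)" using p by (simp add: algebra_simps)
  finally have 1: "2 * ln (2 * real (card ?G)) \<le> 2 * ?p * (k + 3)" by simp
  have 2: "1 \<le> 2 * ?p * (k + 3)"
    using mult_mono[OF p, of 1 "2 * real (k + 3)"] by (simp add: algebra_simps)
  have "sqrt (2 * ln (2 * real (card ?G))) \<le> sqrt (2 * ?p * (k + 3))" using 1 by simp
  also have "\<dots> \<le> 2 * ?p * (k + 3)"
    using 2 self_le_power[OF 2, of 2] by (intro real_le_lsqrt) auto
  finally show ?thesis by (simp add: chain_weight_def)
qed

text \<open>The parent halves each numerator, rounding down, which stays inside the cube. The
  Euclidean norm is bounded by the sum of the coordinates, whence the factor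
  \<open>CARD('p)\<close>.\<close>

lemma dyadic_grid_refine:
  fixes v :: "real^'p"
  assumes "v \<in> dyadic_grid (Suc k)"
  shows "\<exists>w\<in>dyadic_grid k. norm (v - w) \<le> CARD('p) / 2 ^ k"
proof -
  from assms have "\<forall>i. \<exists>j::int. \<bar>j\<bar> \<le> 2 ^ Suc k \<and> v $ i = of_int j / 2 ^ Suc k" by (simp add: dyadic_grid_def)
  then obtain f where f: "\<And>i. \<bar>f i :: int\<bar> \<le> 2 ^ Suc k" "\<And>i. v $ i = of_int (f i) / 2 ^ Suc k" by metis
  define w :: "real^'p" where "w = (\<chi> i. of_int (f i div 2) / 2 ^ k)"
  have "\<bar>f i div 2\<bar> \<le> 2 ^ k" for i using f(1)[of i] by (auto simp: abs_le_iff)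
  then have "w \<in> dyadic_grid k" unfolding dyadic_grid_def w_def by auto
  moreover have "norm (v - w) \<le> (\<Sum>i\<in>(UNIV::'p set). 1 / 2 ^ k)"
  proof (intro order.trans[OF norm_le_l1_cart] sum_mono)
    fix i :: 'p
    have "real_of_int (f i) = 2 * real_of_int (f i div 2) + real_of_int (f i mod 2)"
      by (metis mult_div_mod_eq of_int_add of_int_mult of_int_numeral)
    then have "(v - w) $ i = real_of_int (f i mod 2) / 2 ^ Suc k"
      using f(2)[of i] by (simp add: w_def diff_divide_distrib add_divide_distrib)
    moreover have "\<bar>real_of_int (f i mod 2)\<bar> \<le> 1"
      by (metis abs_of_nonneg of_int_le_1_iff pos_mod_bound pos_mod_sign zle_add1_eq_le
          zero_less_numeral one_add_one of_int_0_le_iff)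
    ultimately have "\<bar>(v - w) $ i\<bar> \<le> 1 / 2 ^ Suc k" by (simp add: abs_divide divide_right_mono)
    also have "\<dots> \<le> 1 / 2 ^ k" by (intro frac_le) auto
    finally show "\<bar>(v - w) $ i\<bar> \<le> 1 / 2 ^ k" .
  qed
  ultimately show ?thesis by auto
qed

lemma dyadic_grid_mono: "dyadic_grid k \<subseteq> dyadic_grid (Suc k)"
proof
  fix v :: "real^'p" assume v: "v \<in> dyadic_grid k"
  show "v \<in> dyadic_grid (Suc k)" unfolding dyadic_grid_def
  proof safe
    fix i
    from v obtain j :: int where "\<bar>j\<bar> \<le> 2 ^ k" "v $ i = of_int j / 2 ^ k" by (auto simp: dyadic_grid_def)
    then show "\<exists>j::int. \<bar>j\<bar> \<le> 2 ^ Suc k \<and> v $ i = of_int j / 2 ^ Suc k" by (intro exI[of _ "2 * j"]) auto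
  qed
qed

lemma dyadic_grid_norm:
  fixes v :: "real^'p" assumes "v \<in> dyadic_grid k" shows "norm v \<le> CARD('p)"
proof -
  have "norm v \<le> (\<Sum>i\<in>(UNIV::'p set). 1)"
  proof (intro order.trans[OF norm_le_l1_cart] sum_mono)
    fix i :: 'p
    obtain j :: int where j: "\<bar>j\<bar> \<le> 2 ^ k" "v $ i = of_int j / 2 ^ k" using assms by (auto simp: dyadic_grid_def)
    have "\<bar>real_of_int j\<bar> \<le> 2 ^ k" using j(1) by (metis of_int_abs of_int_le_iff of_int_numeral of_int_power)
    then show "\<bar>v $ i\<bar> \<le> 1" using j(2) by simp
  qed
  then show ?thesis by simp
qed

lemma countable_dyadic_cube: "countable (dyadic_cube :: (real^'p) set)"
  unfolding dyadic_cube_def using finite_card_dyadic_grid by (intro countable_UN) (auto intro: countable_finite)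

text \<open>Coordinates are rounded down at level \<open>k\<close>. Reaching the unit ball suffices,
  because the cube is rescaled by \<delta> to cover a ball of radius \<delta>.\<close>

lemma dyadic_cube_dense:
  fixes v :: "real^'p"
  assumes "norm v \<le> 1"
  shows "\<exists>w. (\<forall>k. w k \<in> dyadic_cube) \<and> w \<longlonglongrightarrow> v"
proof (intro exI conjI allI)
  let ?w = "\<lambda>k. (\<chi> i. of_int \<lfloor>2 ^ k * v $ i\<rfloor> / 2 ^ k) :: real^'p"
  fix k
  have "\<bar>\<lfloor>2 ^ k * v $ i\<rfloor>\<bar> \<le> 2 ^ k" for i
  proof -
    have "\<bar>v $ i\<bar> \<le> 1" using assms component_le_norm_cart[of v i] by linarith
    then have "\<bar>2 ^ k * v $ i\<bar> \<le> 2 ^ k" by (simp add: abs_mult)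
    then have a: "2 ^ k * v $ i \<le> real_of_int (2 ^ k)" "real_of_int (- (2 ^ k)) \<le> 2 ^ k * v $ i"
      by (auto simp: abs_le_iff)
    have "\<lfloor>2 ^ k * v $ i\<rfloor> \<le> 2 ^ k" using a(1) by linarith
    moreover have "- (2 ^ k) \<le> \<lfloor>2 ^ k * v $ i\<rfloor>" using a(2) by (simp only: le_floor_iff)
    ultimately show ?thesis by (simp add: abs_le_iff)
  qed
  then show "?w k \<in> dyadic_cube" unfolding dyadic_cube_def dyadic_grid_def by auto
next
  let ?w = "\<lambda>k. (\<chi> i. of_int \<lfloor>2 ^ k * v $ i\<rfloor> / 2 ^ k) :: real^'p"
  show "?w \<longlonglongrightarrow> v"
  proof (rule vec_tendstoI)
    fix i
    have "(\<lambda>k. v $ i - (?w k) $ i) \<longlonglongrightarrow> 0"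
    proof (rule Lim_null_comparison)
      show "(\<lambda>k. (1/2::real) ^ k) \<longlonglongrightarrow> 0" by (rule LIMSEQ_power_zero) simp
      show "\<forall>\<^sub>F k in sequentially. norm (v $ i - (?w k) $ i) \<le> (1/2) ^ k"
      proof (intro always_eventually allI)
        fix k
        have "\<bar>2 ^ k * v $ i - of_int \<lfloor>2 ^ k * v $ i\<rfloor>\<bar> \<le> 1" by linarith
        moreover have "v $ i - (?w k) $ i = (2 ^ k * v $ i - of_int \<lfloor>2 ^ k * v $ i\<rfloor>) / 2 ^ k"
          by (simp add: field_simps)
        ultimately show "norm (v $ i - (?w k) $ i) \<le> (1/2) ^ k"
          by (simp add: power_one_over divide_right_mono)
      qed
    qed
    then show "(\<lambda>k. (?w k) $ i) \<longlonglongrightarrow> v $ i"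
      using tendsto_diff[OF tendsto_const[of "v $ i"], of "\<lambda>k. v $ i - (?w k) $ i" 0] by simp
  qed
qed

section \<open>Symmetrization\<close>

text \<open>One observation is symmetrized in the presence of an arbitrary shift \<open>v\<close>.
  The mean is an integral over an independent copy z', and the two-sample difference is the midpoint
  of \<open>v t + 2 * f t z\<close> and \<open>v t - 2 * f t z'\<close>, so the supremum splits into
  two terms with one observation each. They are the two values of a Rademacher sign, each with
  weight 1/2.\<close>

lemma (in prob_space) symmetrization_step:
  fixes f :: "'t \<Rightarrow> 'a \<Rightarrow> real" and v :: "'t \<Rightarrow> real"
  assumes T: "countable T"
    and f[measurable]: "\<And>t. t \<in> T \<Longrightarrow> integrable M (f t)"
  shows "(\<integral>\<^sup>+z. (SUP t\<in>T. ennreal \<bar>v t + (f t z - expectation (f t))\<bar>) \<partial>M)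
     \<le> (1/2) * (\<integral>\<^sup>+z. (SUP t\<in>T. ennreal \<bar>v t + 2 * f t z\<bar>) \<partial>M)
       + (1/2) * (\<integral>\<^sup>+z. (SUP t\<in>T. ennreal \<bar>v t - 2 * f t z\<bar>) \<partial>M)"
proof -
  have fm[measurable]: "f t \<in> borel_measurable M" if "t \<in> T" for t using f[OF that] by auto
  define F where "F z = (SUP t\<in>T. ennreal \<bar>v t + 2 * f t z\<bar>)" for z
  define G where "G z = (SUP t\<in>T. ennreal \<bar>v t - 2 * f t z\<bar>)" for z
  have [measurable]: "F \<in> borel_measurable M" "G \<in> borel_measurable M"
    unfolding F_def G_def using T by (auto intro!: borel_measurable_SUP)
  have half: "(1/2 :: ennreal) = ennreal (1/2)"
    using divide_ennreal[of 1 2] by simp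
  have "(SUP t\<in>T. ennreal \<bar>v t + (f t z - expectation (f t))\<bar>) \<le> (1/2) * F z + (1/2) * (\<integral>\<^sup>+z'. G z' \<partial>M)" for z
  proof (rule SUP_least)
    fix t assume t: "t \<in> T"
    have i: "integrable M (\<lambda>z'. v t + f t z - f t z')" using f[OF t] by auto
    have "v t + (f t z - expectation (f t)) = expectation (\<lambda>z'. v t + f t z - f t z')"
      using f[OF t] by (simp add: prob_space)
    then have "ennreal \<bar>v t + (f t z - expectation (f t))\<bar> \<le> ennreal (expectation (\<lambda>z'. \<bar>v t + f t z - f t z'\<bar>))"
      by (simp add: ennreal_leI integral_abs_bound)
    also have "\<dots> = (\<integral>\<^sup>+z'. ennreal \<bar>v t + f t z - f t z'\<bar> \<partial>M)"
      using i by (intro nn_integral_eq_integral[symmetric]) auto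
    also have "\<dots> \<le> (\<integral>\<^sup>+z'. (1/2) * F z + (1/2) * G z' \<partial>M)"
    proof (intro nn_integral_mono)
      fix z'
      have "\<bar>v t + f t z - f t z'\<bar> = (1/2) * \<bar>(v t + 2 * f t z) + (v t - 2 * f t z')\<bar>"
        by (simp add: abs_if)
      also have "\<dots> \<le> (1/2) * \<bar>v t + 2 * f t z\<bar> + (1/2) * \<bar>v t - 2 * f t z'\<bar>"
        using abs_triangle_ineq[of "v t + 2 * f t z" "v t - 2 * f t z'"] by simp
      finally have "ennreal \<bar>v t + f t z - f t z'\<bar> \<le> (1/2) * ennreal \<bar>v t + 2 * f t z\<bar> + (1/2) * ennreal \<bar>v t - 2 * f t z'\<bar>"
        unfolding half by (simp only: ennreal_mult[symmetric] ennreal_plus[symmetric] abs_ge_zero zero_le_divide_1_iff zero_le_numeral mult_nonneg_nonneg ennreal_leI)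
      also have "\<dots> \<le> (1/2) * F z + (1/2) * G z'"
        unfolding F_def G_def using t by (intro add_mono mult_left_mono SUP_upper) auto
      finally show "ennreal \<bar>v t + f t z - f t z'\<bar> \<le> (1/2) * F z + (1/2) * G z'" .
    qed
    also have "\<dots> = (1/2) * F z + (1/2) * (\<integral>\<^sup>+z'. G z' \<partial>M)"
      by (subst nn_integral_add) (auto simp: nn_integral_cmult emeasure_space_1)
    finally show "ennreal \<bar>v t + (f t z - expectation (f t))\<bar> \<le> (1/2) * F z + (1/2) * (\<integral>\<^sup>+z'. G z' \<partial>M)" .
  qed
  then have "(\<integral>\<^sup>+z. (SUP t\<in>T. ennreal \<bar>v t + (f t z - expectation (f t))\<bar>) \<partial>M)
     \<le> (\<integral>\<^sup>+z. (1/2) * F z + (1/2) * (\<integral>\<^sup>+z'. G z' \<partial>M) \<partial>M)"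
    by (intro nn_integral_mono)
  also have "\<dots> = (1/2) * (\<integral>\<^sup>+z. F z \<partial>M) + (1/2) * (\<integral>\<^sup>+z. G z \<partial>M)"
    by (subst nn_integral_add) (auto simp: nn_integral_cmult emeasure_space_1)
  finally show ?thesis by (simp add: F_def G_def)
qed

lemma ennreal_half_sum: "(\<Sum>A\<in>Pow (insert i I). ((1/2 :: ennreal) ^ card (insert i I)) * c A)
    = (\<Sum>A\<in>Pow I. (1/2) ^ card I * ((1/2) * c (insert i A) + (1/2) * c A))"
  if "finite I" "i \<notin> I"
proof -
  have d: "Pow I \<inter> insert i ` Pow I = {}" using that by auto
  have inj: "inj_on (insert i) (Pow I)" using that by (auto simp: inj_on_def)
  show ?thesis unfolding Pow_insert
    using that d inj
    by (subst sum.union_disjoint)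
       (auto simp: sum.reindex sum.distrib distrib_left mult.assoc mult.commute[of "1/2"] mult.left_commute add.commute)
qed

lemma nn_integral_weighted_sum:
  assumes "\<And>A. g A \<in> borel_measurable M"
  shows "(\<integral>\<^sup>+x. (\<Sum>A\<in>S. a A * g A x) \<partial>M) = (\<Sum>A\<in>S. a A * (\<integral>\<^sup>+x. g A x \<partial>M))"
  using assms by (subst nn_integral_sum) (auto simp: nn_integral_cmult)

text \<open>Observations are symmetrized one at a time, and the free shift \<open>c\<close> is what
  makes the induction close: with the new observation fixed, its centred value joins the shift while
  the others are symmetrized; after exchanging the integrals, the signed sum of the others is the
  shift under which the new one is symmetrized.\<close>

theorem symmetrization:
  fixes f :: "'t \<Rightarrow> 'a \<Rightarrow> real" and c :: "'t \<Rightarrow> real"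
  assumes P: "prob_space P" and T: "countable T"
    and f: "\<And>t. t \<in> T \<Longrightarrow> integrable P (f t)" and I: "finite I"
  shows "(\<integral>\<^sup>+x. (SUP t\<in>T. ennreal \<bar>c t + (\<Sum>i\<in>I. f t (x i) - (\<integral>z. f t z \<partial>P))\<bar>) \<partial>(Pi\<^sub>M I (\<lambda>_. P)))
    \<le> (\<integral>\<^sup>+x. (\<Sum>A\<in>Pow I. (1/2) ^ card I * (SUP t\<in>T. ennreal \<bar>c t + 2 * (\<Sum>i\<in>I. rsign A i * f t (x i))\<bar>)) \<partial>(Pi\<^sub>M I (\<lambda>_. P)))"
  using I
proof (induction I arbitrary: c rule: finite_induct)
  case empty
  show ?case by simp
next
  case (insert i I)
  interpret P: prob_space P by (rule P)
  interpret product_sigma_finite "\<lambda>_. P" by standard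
  interpret PI: prob_space "Pi\<^sub>M I (\<lambda>_. P)" by (intro prob_space_PiM P)
  have fm[measurable]: "f t \<in> borel_measurable P" if "t \<in> T" for t using f[OF that] by auto
  let ?Q = "Pi\<^sub>M I (\<lambda>_. P)" let ?Qi = "Pi\<^sub>M (insert i I) (\<lambda>_. P)"
  let ?e = "\<lambda>t. \<integral>z. f t z \<partial>P"
  define H where "H A c x = (SUP t\<in>T. ennreal \<bar>c t + 2 * (\<Sum>j\<in>I. rsign A j * f t (x j))\<bar>)" for A c x
  have m0: "(\<lambda>x. SUP t\<in>T. ennreal \<bar>c t + (\<Sum>j\<in>insert i I. f t (x j) - ?e t)\<bar>) \<in> borel_measurable ?Qi"
    by (rule borel_measurable_SUP[OF T]) measurable
  have m1: "(\<lambda>x. SUP t\<in>T. ennreal \<bar>c t + 2 * (\<Sum>j\<in>insert i I. rsign A j * f t (x j))\<bar>) \<in> borel_measurable ?Qi" for A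
    by (rule borel_measurable_SUP[OF T]) measurable
  have m2: "(\<lambda>(z, x). H A (\<lambda>t. c t + (f t z - ?e t)) x) \<in> borel_measurable (P \<Otimes>\<^sub>M ?Q)" for A
    unfolding H_def split_def
    by (rule borel_measurable_SUP[OF T]) measurable
  have m3: "(\<lambda>(x, z). H A (\<lambda>t. c t + s * f t z) x) \<in> borel_measurable (?Q \<Otimes>\<^sub>M P)" for A s
    unfolding H_def split_def
    by (rule borel_measurable_SUP[OF T]) measurable
  have m4: "(\<lambda>x. \<integral>\<^sup>+z. H A (\<lambda>t. c t + s * f t z) x \<partial>P) \<in> borel_measurable ?Q" for A s
    using sigma_finite_measure.borel_measurable_nn_integral[OF P.sigma_finite_measure_axioms m3] by simp
  have m5: "(\<lambda>x. H A (\<lambda>t. c t + (f t z - ?e t)) x) \<in> borel_measurable ?Q" if "z \<in> space P" for A z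
    using measurable_compose_Pair1[OF that m2] by simp
  have m6: "(\<lambda>z. \<integral>\<^sup>+x. H A (\<lambda>t. c t + (f t z - ?e t)) x \<partial>?Q) \<in> borel_measurable P" for A
    using sigma_finite_measure.borel_measurable_nn_integral[OF PI.sigma_finite_measure_axioms m2] by simp
  have upd: "(\<Sum>j\<in>I. rsign A j * f t ((x(i := y)) j)) = (\<Sum>j\<in>I. rsign A j * f t (x j))"
    "(\<Sum>j\<in>I. f t ((x(i := y)) j) - ?e t) = (\<Sum>j\<in>I. f t (x j) - ?e t)" for A t x y
    using insert.hyps by (auto intro!: sum.cong)
  have H_add: "H A (\<lambda>t. c t + g t) x = (SUP t\<in>T. ennreal \<bar>c t + 2 * (\<Sum>j\<in>I. rsign A j * f t (x j)) + g t\<bar>)"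
    for A g x by (simp add: H_def add_ac)
  have "(\<integral>\<^sup>+x. (SUP t\<in>T. ennreal \<bar>c t + (\<Sum>j\<in>insert i I. f t (x j) - ?e t)\<bar>) \<partial>?Qi)
      = (\<integral>\<^sup>+z. (\<integral>\<^sup>+x. (SUP t\<in>T. ennreal \<bar>(c t + (f t z - ?e t)) + (\<Sum>j\<in>I. f t (x j) - ?e t)\<bar>) \<partial>?Q) \<partial>P)"
    unfolding product_nn_integral_insert_rev[OF insert.hyps(1,2) m0]
    unfolding sum.insert[OF insert.hyps(1,2)] upd fun_upd_same by (simp only: add.assoc)
  also have "\<dots> \<le> (\<integral>\<^sup>+z. (\<integral>\<^sup>+x. (\<Sum>A\<in>Pow I. (1/2) ^ card I * H A (\<lambda>t. c t + (f t z - ?e t)) x) \<partial>?Q) \<partial>P)"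
    unfolding H_def by (intro nn_integral_mono insert.IH)
  also have "\<dots> = (\<integral>\<^sup>+z. (\<Sum>A\<in>Pow I. (1/2) ^ card I * (\<integral>\<^sup>+x. H A (\<lambda>t. c t + (f t z - ?e t)) x \<partial>?Q)) \<partial>P)"
    by (intro nn_integral_cong nn_integral_weighted_sum m5)
  also have "\<dots> = (\<Sum>A\<in>Pow I. (1/2) ^ card I * (\<integral>\<^sup>+z. (\<integral>\<^sup>+x. H A (\<lambda>t. c t + (f t z - ?e t)) x \<partial>?Q) \<partial>P))"
    by (intro nn_integral_weighted_sum m6)
  also have "\<dots> = (\<Sum>A\<in>Pow I. (1/2) ^ card I * (\<integral>\<^sup>+x. (\<integral>\<^sup>+z. H A (\<lambda>t. c t + (f t z - ?e t)) x \<partial>P) \<partial>?Q))"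
    using pair_sigma_finite.Fubini'[OF pair_sigma_finite.intro m2]
      P.sigma_finite_measure_axioms PI.sigma_finite_measure_axioms by simp
  also have "\<dots> \<le> (\<Sum>A\<in>Pow I. (1/2) ^ card I * (\<integral>\<^sup>+x. ((1/2) * (\<integral>\<^sup>+z. H A (\<lambda>t. c t + 2 * f t z) x \<partial>P)
        + (1/2) * (\<integral>\<^sup>+z. H A (\<lambda>t. c t + (-2) * f t z) x \<partial>P)) \<partial>?Q))"
  proof (intro sum_mono mult_left_mono nn_integral_mono)
    fix A x
    show "(\<integral>\<^sup>+z. H A (\<lambda>t. c t + (f t z - ?e t)) x \<partial>P) \<le> (1/2) * (\<integral>\<^sup>+z. H A (\<lambda>t. c t + 2 * f t z) x \<partial>P)
        + (1/2) * (\<integral>\<^sup>+z. H A (\<lambda>t. c t + (-2) * f t z) x \<partial>P)"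
      unfolding H_add
      using P.symmetrization_step[OF T f, where v = "\<lambda>t. c t + 2 * (\<Sum>j\<in>I. rsign A j * f t (x j))"]
      by simp
  qed simp
  also have "\<dots> = (\<Sum>A\<in>Pow I. (1/2) ^ card I * ((1/2) * (\<integral>\<^sup>+x. (\<integral>\<^sup>+z. H A (\<lambda>t. c t + 2 * f t z) x \<partial>P) \<partial>?Q)
        + (1/2) * (\<integral>\<^sup>+x. (\<integral>\<^sup>+z. H A (\<lambda>t. c t + (-2) * f t z) x \<partial>P) \<partial>?Q)))"
    proof -
    have "(\<integral>\<^sup>+x. (1/2) * F x + (1/2) * G x \<partial>?Q) = (1/2) * (\<integral>\<^sup>+x. F x \<partial>?Q) + (1/2) * (\<integral>\<^sup>+x. G x \<partial>?Q)"
      if "F \<in> borel_measurable ?Q" "G \<in> borel_measurable ?Q" for F G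
      using that by (subst nn_integral_add) (auto simp: nn_integral_cmult)
    from this[OF m4 m4] show ?thesis by (simp only:)
  qed
  also have "\<dots> = (\<Sum>A\<in>Pow (insert i I). (1/2) ^ card (insert i I) *
        (\<integral>\<^sup>+x. (SUP t\<in>T. ennreal \<bar>c t + 2 * (\<Sum>j\<in>insert i I. rsign A j * f t (x j))\<bar>) \<partial>?Qi))"
    unfolding ennreal_half_sum[OF insert.hyps(1,2)]
  proof (intro sum.cong refl)
    fix A assume A: "A \<in> Pow I"
    then have iA: "i \<notin> A" using insert.hyps by auto
    have r: "(\<Sum>j\<in>I. rsign (insert i A) j * w j) = (\<Sum>j\<in>I. rsign A j * w j)" for w
      using insert.hyps by (intro sum.cong) (auto simp: rsign_def)
    have 1: "(\<integral>\<^sup>+x. (SUP t\<in>T. ennreal \<bar>c t + 2 * (\<Sum>j\<in>insert i I. rsign (insert i A) j * f t (x j))\<bar>) \<partial>?Qi)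
       = (\<integral>\<^sup>+x. (\<integral>\<^sup>+z. H A (\<lambda>t. c t + 2 * f t z) x \<partial>P) \<partial>?Q)"
      unfolding product_nn_integral_insert[OF insert.hyps(1,2) m1] H_add
      unfolding sum.insert[OF insert.hyps(1,2)] r upd fun_upd_same
      by (simp add: rsign_def distrib_left add_ac)
    have 2: "(\<integral>\<^sup>+x. (SUP t\<in>T. ennreal \<bar>c t + 2 * (\<Sum>j\<in>insert i I. rsign A j * f t (x j))\<bar>) \<partial>?Qi)
       = (\<integral>\<^sup>+x. (\<integral>\<^sup>+z. H A (\<lambda>t. c t + (-2) * f t z) x \<partial>P) \<partial>?Q)"
      unfolding product_nn_integral_insert[OF insert.hyps(1,2) m1] H_add
      unfolding sum.insert[OF insert.hyps(1,2)] upd fun_upd_same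
      using iA by (simp add: rsign_def right_diff_distrib diff_add_eq add_ac)
    show "(1/2) ^ card I * ((1/2) * (\<integral>\<^sup>+x. (\<integral>\<^sup>+z. H A (\<lambda>t. c t + 2 * f t z) x \<partial>P) \<partial>?Q)
        + (1/2) * (\<integral>\<^sup>+x. (\<integral>\<^sup>+z. H A (\<lambda>t. c t + (-2) * f t z) x \<partial>P) \<partial>?Q))
      = (1/2) ^ card I * ((1/2) * (\<integral>\<^sup>+x. (SUP t\<in>T. ennreal \<bar>c t + 2 * (\<Sum>j\<in>insert i I. rsign (insert i A) j * f t (x j))\<bar>) \<partial>?Qi)
        + (1/2) * (\<integral>\<^sup>+x. (SUP t\<in>T. ennreal \<bar>c t + 2 * (\<Sum>j\<in>insert i I. rsign A j * f t (x j))\<bar>) \<partial>?Qi))"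
      unfolding 1 2 ..
  qed
  also have "\<dots> = (\<integral>\<^sup>+x. (\<Sum>A\<in>Pow (insert i I). (1/2) ^ card (insert i I) *
        (SUP t\<in>T. ennreal \<bar>c t + 2 * (\<Sum>j\<in>insert i I. rsign A j * f t (x j))\<bar>)) \<partial>?Qi)"
    using m1 by (subst nn_integral_sum) (auto simp: nn_integral_cmult)
  finally show ?case .
qed

section \<open>Expected supremum over the dyadic cube\<close>

lemma nn_integral_sqrt_sum_squares_le:
  fixes g :: "'a \<Rightarrow> real" and n :: nat and a :: real
  assumes P: "prob_space P" and g[measurable]: "g \<in> borel_measurable P" and sq: "integrable P (\<lambda>z. (g z)\<^sup>2)"
    and a: "a > 0" "(\<integral>z. (g z)\<^sup>2 \<partial>P) \<le> a\<^sup>2"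
  shows "(\<integral>\<^sup>+x. ennreal (sqrt (\<Sum>i<n. (g (x (i::nat)))\<^sup>2)) \<partial>(Pi\<^sub>M {..<n} (\<lambda>_. P))) \<le> ennreal (sqrt n * a)"
proof (cases "n = 0")
  case True
  then show ?thesis by simp
next
  case False
  let ?Q = "Pi\<^sub>M {..<n} (\<lambda>_. P)"
  define c where "c = sqrt n * a"
  have c: "c > 0" using False a by (simp add: c_def)
  interpret Q: prob_space ?Q by (intro prob_space_PiM P)
  have "(\<integral>\<^sup>+x. ennreal (\<Sum>i<n. (g (x i))\<^sup>2) \<partial>?Q) = (\<integral>\<^sup>+x. (\<Sum>i<n. ennreal ((g (x i))\<^sup>2)) \<partial>?Q)"
    by (intro nn_integral_cong) (simp add: sum_ennreal)
  also have "\<dots> = (\<Sum>i<n. \<integral>\<^sup>+x. ennreal ((g (x i))\<^sup>2) \<partial>?Q)"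
    by (intro nn_integral_sum) measurable
  also have "\<dots> = (\<Sum>i<n. ennreal (\<integral>z. (g z)\<^sup>2 \<partial>P))"
  proof (intro sum.cong refl)
    fix i assume i: "i \<in> {..<n}"
    have "(\<integral>\<^sup>+x. ennreal ((g (x i))\<^sup>2) \<partial>?Q) = (\<integral>\<^sup>+z. ennreal ((g z)\<^sup>2) \<partial>(distr ?Q P (\<lambda>x. x i)))"
      using i by (intro nn_integral_distr[symmetric]) measurable
    also have "distr ?Q P (\<lambda>x. x i) = P"
      using distr_PiM_component[of "{..<n}" "\<lambda>_. P" i] P i by simp
    also have "(\<integral>\<^sup>+z. ennreal ((g z)\<^sup>2) \<partial>P) = ennreal (\<integral>z. (g z)\<^sup>2 \<partial>P)"
      using sq by (intro nn_integral_eq_integral) auto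
    finally show "(\<integral>\<^sup>+x. ennreal ((g (x i))\<^sup>2) \<partial>?Q) = ennreal (\<integral>z. (g z)\<^sup>2 \<partial>P)" .
  qed
  also have "\<dots> \<le> (\<Sum>i<n. ennreal (a\<^sup>2))" using a by (intro sum_mono ennreal_leI)
  also have "\<dots> = ennreal (c\<^sup>2)"
    by (simp add: c_def power_mult_distrib ennreal_of_nat_eq_real_of_nat ennreal_mult)
  finally have S: "(\<integral>\<^sup>+x. ennreal (\<Sum>i<n. (g (x i))\<^sup>2) \<partial>?Q) \<le> ennreal (c\<^sup>2)" .
  \<comment> \<open>The tangent line of the square root at \<open>c\<^sup>2\<close>. After
    integration each half is at most \<open>c / 2\<close>, which does the work of Jensen's
    inequality.\<close>
  have "sqrt s \<le> c / 2 + 1 / (2 * c) * s" if "s \<ge> 0" for s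
  proof -
    have "2 * c * sqrt s \<le> c\<^sup>2 + s"
      using sum_squares_bound[of c "sqrt s"] that by simp
    then show ?thesis using c by (simp add: field_simps power2_eq_square)
  qed
  then have "(\<integral>\<^sup>+x. ennreal (sqrt (\<Sum>i<n. (g (x i))\<^sup>2)) \<partial>?Q)
     \<le> (\<integral>\<^sup>+x. ennreal (c / 2 + 1 / (2 * c) * (\<Sum>i<n. (g (x i))\<^sup>2)) \<partial>?Q)"
    by (intro nn_integral_mono ennreal_leI) (simp add: sum_nonneg)
  also have "\<dots> = (\<integral>\<^sup>+x. ennreal (c / 2) + ennreal (1 / (2 * c)) * ennreal (\<Sum>i<n. (g (x i))\<^sup>2) \<partial>?Q)"
    using c by (intro nn_integral_cong) (simp only: sum_nonneg ennreal_plus[symmetric] ennreal_mult[symmetric] zero_le_power2 divide_nonneg_nonneg mult_nonneg_nonneg less_imp_le zero_le_numeral zero_le_one)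
  also have "\<dots> = ennreal (c / 2) + ennreal (1 / (2 * c)) * (\<integral>\<^sup>+x. ennreal (\<Sum>i<n. (g (x i))\<^sup>2) \<partial>?Q)"
    by (subst nn_integral_add) (auto simp: nn_integral_cmult Q.emeasure_space_1)
  also have "\<dots> \<le> ennreal (c / 2) + ennreal (1 / (2 * c)) * ennreal (c\<^sup>2)"
    by (intro add_left_mono mult_left_mono S) auto
  also have "\<dots> = ennreal (c / 2 + 1 / (2 * c) * c\<^sup>2)" using c by (simp only: ennreal_plus[symmetric] ennreal_mult[symmetric] zero_le_power2 divide_nonneg_nonneg mult_nonneg_nonneg less_imp_le zero_le_numeral zero_le_one)
  also have "c / 2 + 1 / (2 * c) * c\<^sup>2 = c" using c by (simp add: power2_eq_square)
  finally show ?thesis by (simp add: c_def)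
qed

text \<open>The links beyond level \<open>K\<close>: length \<open>p / 2 ^ (k + K)\<close> times the
  weight bound of the finer grid. That grid has level \<open>k + K + 1\<close>, which is why 4
  stands where the weight bound has 3.\<close>

definition chain_tail :: "nat \<Rightarrow> nat \<Rightarrow> real" where
  "chain_tail p K = (\<Sum>k. p / 2 ^ (k + K) * (2 * p * (k + K + 4)))"

lemma summable_chain_tail: "summable (\<lambda>k. real p / 2 ^ k * (2 * p * (k + 4)))"
proof -
  have "summable (\<lambda>k. real (Suc k) * (1/2) ^ k + 3 * (1/2::real) ^ k)"
    using geometric_deriv_sums[of "1/2::real"]
    by (intro summable_add summable_mult summable_geometric) (auto dest: sums_summable)
  from summable_mult[OF this, of "2 * (real p)\<^sup>2"] show ?thesis
    by (rule summable_cong[THEN iffD1, rotated])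
       (simp add: power_one_over power2_eq_square field_simps)
qed

lemma chain_tail_tendsto_0: "chain_tail p \<longlonglongrightarrow> 0"
  using summable_chain_tail[of p] unfolding chain_tail_def
  by (intro suminf_exist_split2) simp

lemma chain_tail_bound: "(\<Sum>k<m. real p / 2 ^ (k + K) * (2 * p * (k + K + 4))) \<le> chain_tail p K"
  unfolding chain_tail_def
  using summable_ignore_initial_segment[OF summable_chain_tail[of p], of K]
  by (intro sum_le_suminf) (auto simp: add_ac)

text \<open>The level \<open>K\<close> stays free: a larger \<open>K\<close> makes the slope term
  small and the envelope term expensive. The overall factor 2 is that of symmetrization.\<close>

theorem expected_supremum_dyadic_cube:
  fixes f :: "real^'p \<Rightarrow> 'z \<Rightarrow> real" and n K :: nat and a b d :: real
  assumes P: "prob_space P" and f: "\<And>v. v \<in> dyadic_cube \<Longrightarrow> integrable P (f v)"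
    and \<psi>: "\<psi> \<in> borel_measurable P" "integrable P (\<lambda>z. (\<psi> z)\<^sup>2)" "b > 0" "(\<integral>z. (\<psi> z)\<^sup>2 \<partial>P) \<le> b\<^sup>2"
    and D: "D \<in> borel_measurable P" "integrable P (\<lambda>z. (D z)\<^sup>2)" "a > 0" "(\<integral>z. (D z)\<^sup>2 \<partial>P) \<le> a\<^sup>2"
    and d: "d \<ge> 0" and \<psi>0: "\<And>z. z \<in> space P \<Longrightarrow> \<psi> z \<ge> 0"
    and lip: "\<And>v w z. v \<in> dyadic_cube \<Longrightarrow> w \<in> dyadic_cube \<Longrightarrow> z \<in> space P \<Longrightarrow>
               \<bar>f v z - f w z\<bar> \<le> d * \<psi> z * norm (v - w)"
    and env: "\<And>v z. v \<in> dyadic_cube \<Longrightarrow> z \<in> space P \<Longrightarrow> \<bar>f v z\<bar> \<le> d * D z"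
  shows "(\<integral>\<^sup>+x. (SUP v\<in>dyadic_cube. ennreal \<bar>\<Sum>i<n. f v (x (i::nat)) - (\<integral>z. f v z \<partial>P)\<bar>) \<partial>(Pi\<^sub>M {..<n} (\<lambda>_. P)))
    \<le> ennreal (2 * d * sqrt n * (2 * CARD('p) * (K + 3) * a + chain_tail CARD('p) K * b))"
proof -
  let ?Q = "Pi\<^sub>M {..<n} (\<lambda>_. P)"
  let ?T = "dyadic_cube :: (real^'p) set"
  let ?G = "dyadic_grid :: nat \<Rightarrow> (real^'p) set"
  define w where "w = real (2 * CARD('p) * (K + 3))"
  define r where "r = chain_tail CARD('p) K"
  have r: "r \<ge> 0" using chain_tail_bound[where m = 0 and p = "CARD('p)" and K = K] by (simp add: r_def)
  have fin: "finite (?G k)" for k using finite_card_dyadic_grid[where ?'p = 'p] by blast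
  have ne: "?G k \<noteq> {}" for k using zero_in_dyadic_grid[where ?'a = 'p] by blast
  have GT: "?G k \<subseteq> ?T" for k by (auto simp: dyadic_cube_def)
  have mono: "?G j \<subseteq> ?G k" if "j \<le> k" for j k using lift_Suc_mono_le[of ?G, OF dyadic_grid_mono that] .
  \<comment> \<open>The sample \<open>x\<close> is frozen here, so that only the signs are averaged
    and the chain bound applies.\<close>
  have pt: "(\<Sum>A\<in>Pow {..<n}. (1/2) ^ card {..<n} * (SUP v\<in>?T. ennreal \<bar>0 + 2 * (\<Sum>i<n. rsign A i * f v (x i))\<bar>))
     \<le> ennreal (2 * d * w) * ennreal (sqrt (\<Sum>i<n. (D (x i))\<^sup>2)) + ennreal (2 * d * r) * ennreal (sqrt (\<Sum>i<n. (\<psi> (x i))\<^sup>2))"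
    if x: "x \<in> space ?Q" for x
  proof -
    have xi: "x i \<in> space P" if "i \<in> {..<n}" for i using x that by (auto simp: space_PiM PiE_def)
    define Mx where "Mx A m = Max ((\<lambda>v. \<bar>\<Sum>i<n. rsign A i * f v (x i)\<bar>) ` ?G (K + m))" for A m
    have Mx_ge: "\<bar>\<Sum>i<n. rsign A i * f v (x i)\<bar> \<le> Mx A m" if "v \<in> ?G (K + m)" for v A m
      unfolding Mx_def using that fin by (intro Max_ge) auto
    have Mx0: "Mx A m \<ge> 0" for A m
      using Mx_ge[OF zero_in_dyadic_grid, of A m] abs_ge_zero order.trans by blast
    have Mx_inc: "incseq (\<lambda>m. ennreal (2 * Mx A m))" for A
    proof (intro monoI ennreal_leI mult_left_mono)
      fix m m' :: nat assume "m \<le> m'"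
      then show "Mx A m \<le> Mx A m'" unfolding Mx_def using mono[of "K + m" "K + m'"] ne fin by (intro Max_mono image_mono) auto
    qed simp
    \<comment> \<open>Every dyadic point lies on some grid and the grids are nested, so the supremum
      is an increasing limit of finite maxima, which commutes with the finite sum over
      signs.\<close>
    have 1: "(SUP v\<in>?T. ennreal \<bar>0 + 2 * (\<Sum>i<n. rsign A i * f v (x i))\<bar>) \<le> (SUP m. ennreal (2 * Mx A m))" for A
    proof (rule SUP_least)
      fix v assume "v \<in> ?T"
      then obtain k where "v \<in> ?G k" by (auto simp: dyadic_cube_def)
      then have "v \<in> ?G (K + k)" using mono[of k "K + k"] by auto
      from Mx_ge[OF this, of A] have "ennreal \<bar>0 + 2 * (\<Sum>i<n. rsign A i * f v (x i))\<bar> \<le> ennreal (2 * Mx A k)"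
        by (intro ennreal_leI) (simp add: abs_mult)
      also have "\<dots> \<le> (SUP m. ennreal (2 * Mx A m))" by (rule SUP_upper) simp
      finally show "ennreal \<bar>0 + 2 * (\<Sum>i<n. rsign A i * f v (x i))\<bar> \<le> (SUP m. ennreal (2 * Mx A m))" .
    qed
    define B where "B = 2 * (d * w * sqrt (\<Sum>i<n. (D (x i))\<^sup>2) + d * r * sqrt (\<Sum>i<n. (\<psi> (x i))\<^sup>2))"
    have 2: "(\<Sum>A\<in>Pow {..<n}. 2 * Mx A m) \<le> 2 ^ n * B" for m
    proof -
      have "(\<Sum>A\<in>Pow {..<n}. Mx A m) \<le> 2 ^ card {..<n} * (d * sqrt (\<Sum>i<n. (D (x i))\<^sup>2) * chain_weight (?G K)
         + (\<Sum>k<m. d * (CARD('p) / 2 ^ (K + k)) * chain_weight (?G (K + Suc k))) * sqrt (\<Sum>i<n. (\<psi> (x i))\<^sup>2))"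
        unfolding Mx_def
      proof (rule rademacher_chain[OF _ fin ne, where e = "\<lambda>k. d * (CARD('p) / 2 ^ k)"])
        fix k t assume t: "t \<in> ?G (Suc k)"
        then obtain s where s: "s \<in> ?G k" "norm (t - s) \<le> CARD('p) / 2 ^ k" using dyadic_grid_refine by blast
        show "\<exists>s\<in>?G k. \<forall>i\<in>{..<n}. \<bar>f t (x i) - f s (x i)\<bar> \<le> d * (CARD('p) / 2 ^ k) * \<psi> (x i)"
        proof (intro bexI[OF _ s(1)] ballI)
          fix i assume i: "i \<in> {..<n}"
          have "\<bar>f t (x i) - f s (x i)\<bar> \<le> d * \<psi> (x i) * norm (t - s)"
            using t s GT xi[OF i] by (intro lip) blast+
          also have "\<dots> \<le> d * \<psi> (x i) * (CARD('p) / 2 ^ k)"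
            using d \<psi>0[OF xi[OF i]] s by (intro mult_left_mono) auto
          finally show "\<bar>f t (x i) - f s (x i)\<bar> \<le> d * (CARD('p) / 2 ^ k) * \<psi> (x i)" by (simp add: mult_ac)
        qed
      qed (use d env xi GT in \<open>auto simp: subset_iff\<close>)
      also have "\<dots> \<le> 2 ^ n * (B / 2)"
      proof -
        have a1: "d * sqrt (\<Sum>i<n. (D (x i))\<^sup>2) * chain_weight (?G K) \<le> d * w * sqrt (\<Sum>i<n. (D (x i))\<^sup>2)"
          using mult_left_mono[OF chain_weight_dyadic_grid[where ?'p = 'p and k = K], of "d * sqrt (\<Sum>i<n. (D (x i))\<^sup>2)"] d
          by (simp add: w_def sum_nonneg mult_ac)
        have "(\<Sum>k<m. d * (CARD('p) / 2 ^ (K + k)) * chain_weight (?G (K + Suc k)))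
           \<le> (\<Sum>k<m. d * (CARD('p) / 2 ^ (K + k)) * (2 * CARD('p) * (K + Suc k + 3)))"
        proof (intro sum_mono mult_left_mono)
          fix k show "chain_weight (?G (K + Suc k)) \<le> real (2 * CARD('p) * (K + Suc k + 3))"
            using chain_weight_dyadic_grid[where ?'p = 'p and k = "K + Suc k"] by simp
        qed (use d in auto)
        also have "\<dots> = d * (\<Sum>k<m. real CARD('p) / 2 ^ (k + K) * (2 * CARD('p) * (k + K + 4)))"
          by (simp add: sum_distrib_left algebra_simps)
        also have "\<dots> \<le> d * r" unfolding r_def using d chain_tail_bound by (intro mult_left_mono) auto
        finally have a2: "(\<Sum>k<m. d * (CARD('p) / 2 ^ (K + k)) * chain_weight (?G (K + Suc k))) * sqrt (\<Sum>i<n. (\<psi> (x i))\<^sup>2)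
          \<le> d * r * sqrt (\<Sum>i<n. (\<psi> (x i))\<^sup>2)" by (intro mult_right_mono) (auto simp: sum_nonneg)
        show ?thesis using a1 a2 by (simp add: B_def)
      qed
      finally show ?thesis by (simp add: sum_distrib_left[symmetric])
    qed
    have B0: "B \<ge> 0" using d r by (auto simp: B_def w_def intro!: add_nonneg_nonneg mult_nonneg_nonneg sum_nonneg)
    have "(\<Sum>A\<in>Pow {..<n}. (1/2) ^ card {..<n} * (SUP v\<in>?T. ennreal \<bar>0 + 2 * (\<Sum>i<n. rsign A i * f v (x i))\<bar>))
       \<le> (1/2) ^ n * (\<Sum>A\<in>Pow {..<n}. (SUP m. ennreal (2 * Mx A m)))"
      using 1 by (simp add: sum_distrib_left mult_left_mono sum_mono)
    also have "(\<Sum>A\<in>Pow {..<n}. (SUP m. ennreal (2 * Mx A m))) = (SUP m. \<Sum>A\<in>Pow {..<n}. ennreal (2 * Mx A m))"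
      using Mx_inc by (intro ennreal_SUP_sum[symmetric]) auto
    also have "\<dots> \<le> ennreal (2 ^ n * B)"
      using 2 Mx0 by (intro SUP_least) (simp add: sum_ennreal ennreal_leI)
    also have "(1/2) ^ n * ennreal (2 ^ n * B) = ennreal B"
    proof -
      have "(1/2 :: ennreal) ^ n = ennreal ((1/2) ^ n)"
        using divide_ennreal[of 1 2] by (simp add: ennreal_power flip: ennreal_power)
      then show ?thesis using B0 by (simp add: ennreal_mult[symmetric] power_one_over)
    qed
    also have "B = 2 * d * w * sqrt (\<Sum>i<n. (D (x i))\<^sup>2) + 2 * d * r * sqrt (\<Sum>i<n. (\<psi> (x i))\<^sup>2)"
      by (simp add: B_def algebra_simps)
    also have "ennreal \<dots> = ennreal (2 * d * w) * ennreal (sqrt (\<Sum>i<n. (D (x i))\<^sup>2)) + ennreal (2 * d * r) * ennreal (sqrt (\<Sum>i<n. (\<psi> (x i))\<^sup>2))"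
      using d r by (simp add: ennreal_plus ennreal_mult sum_nonneg w_def)
    finally show ?thesis by (simp add: mult_left_mono)
  qed
  have [measurable]: "\<psi> \<in> borel_measurable P" "D \<in> borel_measurable P" using \<psi> D by auto
  have "(\<integral>\<^sup>+x. (SUP v\<in>?T. ennreal \<bar>\<Sum>i<n. f v (x i) - (\<integral>z. f v z \<partial>P)\<bar>) \<partial>?Q)
    \<le> (\<integral>\<^sup>+x. (\<Sum>A\<in>Pow {..<n}. (1/2) ^ card {..<n} * (SUP v\<in>?T. ennreal \<bar>0 + 2 * (\<Sum>i<n. rsign A i * f v (x i))\<bar>)) \<partial>?Q)"
    using symmetrization[OF P countable_dyadic_cube f finite_lessThan, where c = "\<lambda>_. 0"] by simp
  also have "\<dots> \<le> (\<integral>\<^sup>+x. ennreal (2 * d * w) * ennreal (sqrt (\<Sum>i<n. (D (x i))\<^sup>2)) + ennreal (2 * d * r) * ennreal (sqrt (\<Sum>i<n. (\<psi> (x i))\<^sup>2)) \<partial>?Q)"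
    by (intro nn_integral_mono pt)
  also have "\<dots> = ennreal (2 * d * w) * (\<integral>\<^sup>+x. ennreal (sqrt (\<Sum>i<n. (D (x i))\<^sup>2)) \<partial>?Q) + ennreal (2 * d * r) * (\<integral>\<^sup>+x. ennreal (sqrt (\<Sum>i<n. (\<psi> (x i))\<^sup>2)) \<partial>?Q)"
    by (subst nn_integral_add) (auto simp: nn_integral_cmult)
  also have "\<dots> \<le> ennreal (2 * d * w) * ennreal (sqrt n * a) + ennreal (2 * d * r) * ennreal (sqrt n * b)"
    by (intro add_mono mult_left_mono nn_integral_sqrt_sum_squares_le P \<psi> D) auto
  also have "\<dots> = ennreal (2 * d * sqrt n * (w * a + r * b))"
    using d r D(3) \<psi>(3) by (simp add: w_def algebra_simps flip: ennreal_mult ennreal_plus)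
  finally show ?thesis by (simp add: w_def r_def)
qed

section \<open>Lipschitz criteria\<close>

text \<open>Only the exceptional set has to be measurable, not \<open>Q\<close>. Thus
  \<open>Q\<close> may quantify over uncountably many parameters, and such statements combine by
  union bounds.\<close>

definition holds_up_to :: "'w measure \<Rightarrow> real \<Rightarrow> ('w \<Rightarrow> bool) \<Rightarrow> bool" where
  "holds_up_to M e Q \<longleftrightarrow> (\<exists>B\<in>sets M. measure M B \<le> e \<and> (\<forall>\<omega>\<in>space M - B. Q \<omega>))"

locale lipschitz_criterion = prob_space P
  for P :: "'z measure" +
  fixes m :: "real^'p \<Rightarrow> 'z \<Rightarrow> real" and \<xi>0 :: "real^'p" and mdot :: "'z \<Rightarrow> real^'p"
    and \<phi> :: "'z \<Rightarrow> real" and U :: "(real^'p) set"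
  assumes U: "open U" "\<xi>0 \<in> U"
    and m_integrable: "\<And>\<xi>. \<xi> \<in> U \<Longrightarrow> integrable P (m \<xi>)"
    and mdot_measurable[measurable]: "mdot \<in> borel_measurable P"
    and mdot_deriv: "AE z in P. ((\<lambda>\<xi>. m \<xi> z) has_derivative (\<lambda>v. mdot z \<bullet> v)) (at \<xi>0)"
    and \<phi>_measurable[measurable]: "\<phi> \<in> borel_measurable P"
    and \<phi>_square: "integrable P (\<lambda>z. (\<phi> z)\<^sup>2)"
    and m_lipschitz: "\<And>\<xi>1 \<xi>2 z. \<xi>1 \<in> U \<Longrightarrow> \<xi>2 \<in> U \<Longrightarrow> z \<in> space P \<Longrightarrow> \<bar>m \<xi>1 z - m \<xi>2 z\<bar> \<le> \<phi> z * norm (\<xi>1 - \<xi>2)"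
begin

lemma U_ball: obtains \<rho> :: real where "\<rho> > 0" "cball \<xi>0 \<rho> \<subseteq> U"
  using U open_contains_cball_eq by blast

lemma \<phi>_nonneg: assumes "z \<in> space P" shows "\<phi> z \<ge> 0"
proof -
  obtain \<rho> where \<rho>: "\<rho> > 0" "cball \<xi>0 \<rho> \<subseteq> U" by (rule U_ball)
  obtain b :: "real^'p" where b: "norm b = \<rho>" using vector_choose_size[of \<rho>] \<rho> by auto
  then have "\<xi>0 + b \<in> U" using \<rho> by (auto simp: subset_iff dist_norm)
  from m_lipschitz[OF this U(2) assms] have "0 \<le> \<phi> z * \<rho>" using b by (auto intro: order.trans)
  then show ?thesis using \<rho> by (simp add: zero_le_mult_iff)
qed

section \<open>The remainder of the linear approximation at \<xi>0\<close>

definition rem :: "real^'p \<Rightarrow> 'z \<Rightarrow> real" where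
  "rem \<xi> z = m \<xi> z - m \<xi>0 z - mdot z \<bullet> (\<xi> - \<xi>0)"

lemma rem_small:
  assumes "((\<lambda>\<xi>. m \<xi> z) has_derivative (\<lambda>v. mdot z \<bullet> v)) (at \<xi>0)" "e > 0"
  obtains \<rho> :: real where "\<rho> > 0" "\<And>\<xi>. norm (\<xi> - \<xi>0) < \<rho> \<Longrightarrow> \<bar>rem \<xi> z\<bar> \<le> e * norm (\<xi> - \<xi>0)"
  using assms unfolding has_derivative_at_alt rem_def by (auto simp: algebra_simps)

text \<open>The Lipschitz bound, applied along the gradient itself, dominates the derivative. This
  supplies the square integrable majorant \<phi> for \<open>mdot\<close>.\<close>

lemma norm_mdot_le: "AE z in P. norm (mdot z) \<le> \<phi> z"
  using mdot_deriv AE_space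
proof eventually_elim
  fix z assume d: "((\<lambda>\<xi>. m \<xi> z) has_derivative (\<lambda>v. mdot z \<bullet> v)) (at \<xi>0)" and z: "z \<in> space P"
  obtain \<rho>1 where \<rho>1: "\<rho>1 > 0" "cball \<xi>0 \<rho>1 \<subseteq> U" by (rule U_ball)
  show "norm (mdot z) \<le> \<phi> z"
  proof (cases "mdot z = 0")
    case True then show ?thesis using \<phi>_nonneg[OF z] by simp
  next
    case False
    show ?thesis
    proof (rule field_le_epsilon)
      fix e :: real assume "e > 0"
      from rem_small[OF d this] obtain \<rho>2
        where \<rho>2: "\<rho>2 > 0" "\<And>\<xi>. norm (\<xi> - \<xi>0) < \<rho>2 \<Longrightarrow> \<bar>rem \<xi> z\<bar> \<le> e * norm (\<xi> - \<xi>0)" by blast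
      define s where "s = min \<rho>1 (\<rho>2 / 2)"
      have s: "s > 0" "s \<le> \<rho>1" "s < \<rho>2" using \<rho>1 \<rho>2 by (auto simp: s_def)
      \<comment> \<open>A step of length \<open>s\<close> along the gradient, where the inner
        product with \<open>mdot z\<close> attains \<open>norm (mdot z) * s\<close>.\<close>
      define \<xi> where "\<xi> = \<xi>0 + (s / norm (mdot z)) *\<^sub>R mdot z"
      have n: "norm (\<xi> - \<xi>0) = s" using False s by (simp add: \<xi>_def)
      have "\<xi> \<in> U" using \<rho>1 n s by (auto simp: subset_iff dist_norm norm_minus_commute)
      from m_lipschitz[OF this U(2) z] have 1: "\<bar>m \<xi> z - m \<xi>0 z\<bar> \<le> \<phi> z * s" by (simp add: n)
      have 2: "\<bar>rem \<xi> z\<bar> \<le> e * s" using \<rho>2(2)[of \<xi>] n s by simp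
      have "mdot z \<bullet> (\<xi> - \<xi>0) = norm (mdot z) * s"
        using False by (simp add: \<xi>_def dot_square_norm power2_eq_square)
      then have "norm (mdot z) * s \<le> (\<phi> z + e) * s" using 1 2 by (auto simp: rem_def algebra_simps)
      then show "norm (mdot z) \<le> \<phi> z + e" using s by simp
    qed
  qed
qed

definition \<psi> :: "'z \<Rightarrow> real" where "\<psi> z = \<phi> z + norm (mdot z)"

lemma \<psi>_measurable[measurable]: "\<psi> \<in> borel_measurable P" unfolding \<psi>_def by measurable

lemma \<psi>_nonneg: "z \<in> space P \<Longrightarrow> \<psi> z \<ge> 0" using \<phi>_nonneg[of z] by (simp add: \<psi>_def)

lemma mdot_square: "integrable P (\<lambda>z. (norm (mdot z))\<^sup>2)"
  by (rule Bochner_Integration.integrable_bound[OF \<phi>_square], measurable)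
     (use norm_mdot_le in eventually_elim, simp add: power_mono)

lemma \<psi>_square: "integrable P (\<lambda>z. (\<psi> z)\<^sup>2)"
proof (rule Bochner_Integration.integrable_bound[OF integrable_mult_right[OF \<phi>_square, of 4]])
  show "AE z in P. norm ((\<psi> z)\<^sup>2) \<le> norm (4 * (\<phi> z)\<^sup>2)"
    using norm_mdot_le AE_space
  proof eventually_elim
    fix z assume "norm (mdot z) \<le> \<phi> z" "z \<in> space P"
    then have "(\<psi> z)\<^sup>2 \<le> (2 * \<phi> z)\<^sup>2" using \<psi>_nonneg[of z] by (intro power_mono) (auto simp: \<psi>_def)
    then show "norm ((\<psi> z)\<^sup>2) \<le> norm (4 * (\<phi> z)\<^sup>2)" by (simp add: power_mult_distrib)
  qed
qed measurable

lemma mdot_integrable: "integrable P mdot"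
proof -
  have "integrable P (\<lambda>z. norm (mdot z))"
    by (rule square_integrable_imp_integrable[OF _ mdot_square]) measurable
  then show ?thesis by (simp add: integrable_norm_iff)
qed

lemma rem_measurable[measurable]: "\<xi> \<in> U \<Longrightarrow> rem \<xi> \<in> borel_measurable P"
  and rem_integrable: "\<xi> \<in> U \<Longrightarrow> integrable P (rem \<xi>)"
proof -
  assume "\<xi> \<in> U"
  then show "integrable P (rem \<xi>)" unfolding rem_def
    using m_integrable mdot_integrable U by (auto intro!: Bochner_Integration.integrable_diff)
  then show "rem \<xi> \<in> borel_measurable P" by auto
qed

lemma rem_lipschitz:
  assumes "\<xi>1 \<in> U" "\<xi>2 \<in> U" "z \<in> space P"
  shows "\<bar>rem \<xi>1 z - rem \<xi>2 z\<bar> \<le> \<psi> z * norm (\<xi>1 - \<xi>2)"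
proof -
  have "rem \<xi>1 z - rem \<xi>2 z = (m \<xi>1 z - m \<xi>2 z) - mdot z \<bullet> (\<xi>1 - \<xi>2)"
    by (simp add: rem_def algebra_simps)
  then have "\<bar>rem \<xi>1 z - rem \<xi>2 z\<bar> \<le> \<bar>m \<xi>1 z - m \<xi>2 z\<bar> + \<bar>mdot z \<bullet> (\<xi>1 - \<xi>2)\<bar>" by simp
  also have "\<dots> \<le> \<phi> z * norm (\<xi>1 - \<xi>2) + norm (mdot z) * norm (\<xi>1 - \<xi>2)"
    using m_lipschitz[OF assms] by (intro add_mono Cauchy_Schwarz_ineq2)
  finally show ?thesis by (simp add: \<psi>_def algebra_simps)
qed

lemma rem_\<xi>0[simp]: "rem \<xi>0 z = 0" by (simp add: rem_def)

lemma rem_bound: "\<xi> \<in> U \<Longrightarrow> z \<in> space P \<Longrightarrow> \<bar>rem \<xi> z\<bar> \<le> \<psi> z * norm (\<xi> - \<xi>0)"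
  using rem_lipschitz[of \<xi> \<xi>0 z] U by simp

lemma rem_continuous: "z \<in> space P \<Longrightarrow> continuous_on U (\<lambda>\<xi>. rem \<xi> z)"
  using rem_lipschitz \<psi>_nonneg
  by (intro lipschitz_on_continuous_on[of "\<psi> z"] lipschitz_onI) (auto simp: dist_norm)

text \<open>The Lipschitz slope \<open>\<psi>\<close> is also an envelope, but only an envelope of arbitrarily small second moment
  makes the fluctuations of the remainder negligible at scale \<open>1 / \<surd>n\<close>.\<close>

lemma rem_envelope:
  assumes "\<epsilon> > 0"
  obtains \<rho> D where "\<rho> > 0" "cball \<xi>0 \<rho> \<subseteq> U" "D \<in> borel_measurable P" "integrable P (\<lambda>z. (D z)\<^sup>2)"
    "(\<integral>z. (D z)\<^sup>2 \<partial>P) \<le> \<epsilon>\<^sup>2"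
    "\<And>\<xi> z. \<xi> \<in> cball \<xi>0 \<rho> \<Longrightarrow> z \<in> space P \<Longrightarrow> \<bar>rem \<xi> z\<bar> \<le> D z * norm (\<xi> - \<xi>0)"
proof -
  obtain \<rho>0 where \<rho>0: "\<rho>0 > 0" "cball \<xi>0 \<rho>0 \<subseteq> U" by (rule U_ball)
  \<comment> \<open>A supremum over countably many points is measurable; continuity of the remainder
    later carries the bound to the other points.\<close>
  obtain C :: "(real^'p) set" where C: "countable C" "\<And>X. open X \<Longrightarrow> X \<noteq> {} \<Longrightarrow> \<exists>d\<in>C. d \<in> X"
    by (rule countable_dense_setE) blast
  define R where "R j = \<rho>0 / real (Suc j)" for j
  have R: "R j > 0" "R j \<le> \<rho>0" for j using \<rho>0 by (auto simp: R_def field_simps)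
  define B where "B j = ball \<xi>0 (R j) - {\<xi>0}" for j
  have Bo: "open (B j)" for j by (simp add: B_def open_delete)
  have BU: "B j \<subseteq> U" for j using \<rho>0 R(2)[of j] by (auto simp: B_def subset_iff)
  have Bne: "B j \<noteq> {}" for j
  proof -
    obtain b :: "real^'p" where b: "norm b = R j / 2" using vector_choose_size[of "R j / 2"] R[of j] by auto
    then have "b \<noteq> 0" using R[of j] by auto
    then have "\<xi>0 + b \<in> B j" using b R[of j] by (auto simp: B_def dist_norm)
    then show ?thesis by blast
  qed
  define q where "q \<xi> z = \<bar>rem \<xi> z\<bar> / norm (\<xi> - \<xi>0)" for \<xi> z
  define D where "D j z = (SUP \<xi>\<in>C \<inter> B j. q \<xi> z)" for j z
  have ne: "C \<inter> B j \<noteq> {}" for j using C(2)[OF Bo Bne] by blast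
  have q: "q \<xi> z \<le> \<psi> z" if "\<xi> \<in> B j" "z \<in> space P" for \<xi> z j
  proof -
    have "norm (\<xi> - \<xi>0) > 0" using that by (auto simp: B_def)
    then show ?thesis using rem_bound[of \<xi> z] that BU[of j] by (auto simp: q_def field_simps)
  qed
  have q0: "q \<xi> z \<ge> 0" for \<xi> z by (simp add: q_def)
  have bdd: "bdd_above ((\<lambda>\<xi>. q \<xi> z) ` (C \<inter> B j))" if "z \<in> space P" for j z
    using q that by (intro bdd_aboveI2[of _ _ "\<psi> z"]) auto
  have qm: "q \<xi> \<in> borel_measurable P" if "\<xi> \<in> B j" for j \<xi>
    using rem_measurable[of \<xi>] that BU[of j] unfolding q_def by (auto intro!: borel_measurable_divide borel_measurable_abs)
  have Dm[measurable]: "D j \<in> borel_measurable P" for j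
    unfolding D_def[abs_def] by (intro borel_measurable_cSUP bdd) (use C qm in auto)
  have D_le: "D j z \<le> \<psi> z" if "z \<in> space P" for j z
    unfolding D_def using q that ne by (intro cSUP_least) auto
  have D_ge: "q \<xi> z \<le> D j z" if "z \<in> space P" "\<xi> \<in> C \<inter> B j" for j \<xi> z
    unfolding D_def using bdd that by (intro cSUP_upper)
  have D0: "D j z \<ge> 0" if "z \<in> space P" for j z
    using D_ge[OF that] ne[of j] q0 order.trans by blast
  \<comment> \<open>A violation at one point of the punctured ball is by continuity a violation on a
    nonempty open set, and this meets \<open>C\<close>.\<close>
  have D_bound: "\<bar>rem \<xi> z\<bar> \<le> D j z * norm (\<xi> - \<xi>0)" if z: "z \<in> space P" and \<xi>: "\<xi> \<in> ball \<xi>0 (R j)" for j z \<xi>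
  proof (rule ccontr)
    assume neg: "\<not> ?thesis"
    then have "\<xi> \<in> B j" using \<xi> by (auto simp: B_def)
    define h where "h \<xi> = \<bar>rem \<xi> z\<bar> - D j z * norm (\<xi> - \<xi>0)" for \<xi>
    have "continuous_on (B j) h" unfolding h_def
      by (intro continuous_intros continuous_on_subset[OF rem_continuous[OF z] BU])
    then have "open (h -` {0<..} \<inter> B j)" by (simp add: continuous_on_open_vimage Bo)
    moreover have "\<xi> \<in> h -` {0<..} \<inter> B j" using \<open>\<xi> \<in> B j\<close> neg by (auto simp: h_def)
    ultimately obtain \<xi>' where \<xi>': "\<xi>' \<in> C" "\<xi>' \<in> B j" "h \<xi>' > 0" using C(2)[of "h -` {0<..} \<inter> B j"] by blast
    have "norm (\<xi>' - \<xi>0) > 0" using \<xi>' by (auto simp: B_def)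
    then show False using D_ge[OF z, of \<xi>' j] \<xi>' by (auto simp: q_def h_def field_simps)
  qed
  \<comment> \<open>Differentiability at \<xi>0 says precisely that the quotients \<open>q\<close>
    vanish as the balls shrink. With \<open>(\<psi> z)\<^sup>2\<close> as integrable majorant the
    second moments then tend to 0.\<close>
  have lim: "AE z in P. (\<lambda>j. D j z) \<longlonglongrightarrow> 0"
    using mdot_deriv AE_space
  proof eventually_elim
    fix z assume d: "((\<lambda>\<xi>. m \<xi> z) has_derivative (\<lambda>v. mdot z \<bullet> v)) (at \<xi>0)" and z: "z \<in> space P"
    show "(\<lambda>j. D j z) \<longlonglongrightarrow> 0"
    proof (rule LIMSEQ_I)
      fix e :: real assume e: "e > 0"
      from rem_small[OF d, of "e / 2"] e obtain \<rho>
        where \<rho>: "\<rho> > 0" "\<And>\<xi>. norm (\<xi> - \<xi>0) < \<rho> \<Longrightarrow> \<bar>rem \<xi> z\<bar> \<le> e / 2 * norm (\<xi> - \<xi>0)" by auto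
      have "R \<longlonglongrightarrow> 0" unfolding R_def by (rule LIMSEQ_Suc[OF lim_const_over_n])
      then obtain N where N: "\<And>j. j \<ge> N \<Longrightarrow> R j < \<rho>"
        using \<rho> order_tendstoD(2)[of R 0 sequentially \<rho>] by (auto simp: eventually_sequentially)
      have "D j z \<le> e / 2" if "j \<ge> N" for j
        unfolding D_def
      proof (rule cSUP_least[OF ne])
        fix \<xi> assume \<xi>: "\<xi> \<in> C \<inter> B j"
        then have "norm (\<xi> - \<xi>0) < \<rho>" "norm (\<xi> - \<xi>0) > 0"
          using N[OF that] by (auto simp: B_def dist_norm norm_minus_commute)
        then show "q \<xi> z \<le> e / 2" using \<rho>(2)[of \<xi>] by (simp add: q_def field_simps)
      qed
      then have "norm (D j z - 0) < e" if "j \<ge> N" for j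
        using that D0[OF z, of j] e by (auto intro: le_less_trans[of _ "e / 2"])
      then show "\<exists>N. \<forall>j\<ge>N. norm (D j z - 0) < e" by blast
    qed
  qed
  have "(\<lambda>j. \<integral>z. (D j z)\<^sup>2 \<partial>P) \<longlonglongrightarrow> (\<integral>z. 0 \<partial>P)"
  proof (rule integral_dominated_convergence[where w = "\<lambda>z. (\<psi> z)\<^sup>2"])
    show "AE z in P. (\<lambda>j. (D j z)\<^sup>2) \<longlonglongrightarrow> 0"
      using lim by eventually_elim (use tendsto_power[of _ 0 sequentially 2] in auto)
    show "AE z in P. norm ((D j z)\<^sup>2) \<le> (\<psi> z)\<^sup>2" for j
      using AE_space by eventually_elim (use D0 D_le in \<open>auto intro: power_mono\<close>)
  qed (use \<psi>_square in auto)
  then obtain j where j: "(\<integral>z. (D j z)\<^sup>2 \<partial>P) < \<epsilon>\<^sup>2"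
    using order_tendstoD(2)[of "\<lambda>j. \<integral>z. (D j z)\<^sup>2 \<partial>P" 0 sequentially "\<epsilon>\<^sup>2"] assms
    by (auto dest: eventually_happens)
  show ?thesis
  proof
    show "R j / 2 > 0" using R[of j] by simp
    show "cball \<xi>0 (R j / 2) \<subseteq> U" using \<rho>0 R[of j] by (auto simp: subset_iff)
    show "D j \<in> borel_measurable P" by measurable
    show "integrable P (\<lambda>z. (D j z)\<^sup>2)"
      by (rule Bochner_Integration.integrable_bound[OF \<psi>_square], measurable)
         (use AE_space in eventually_elim, use D0 D_le in \<open>auto intro: power_mono\<close>)
    show "(\<integral>z. (D j z)\<^sup>2 \<partial>P) \<le> \<epsilon>\<^sup>2" using j by simp
    show "\<bar>rem \<xi> z\<bar> \<le> D j z * norm (\<xi> - \<xi>0)" if "\<xi> \<in> cball \<xi>0 (R j / 2)" "z \<in> space P" for \<xi> z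
      using that R[of j] by (intro D_bound) auto
  qed
qed

text \<open>The first moment of the envelope is controlled by the second through
  \<open>D z \<le> \<epsilon> / 2 + (D z)\<^sup>2 / (2 * \<epsilon>)\<close>. This is what permits
  exchanging derivative and expectation in \<open>criterion_has_derivative\<close>.\<close>

lemma rem_mean_small:
  assumes "\<epsilon> > 0"
  obtains \<rho> :: real where "\<rho> > 0" "cball \<xi>0 \<rho> \<subseteq> U"
    "\<And>\<xi>. \<xi> \<in> cball \<xi>0 \<rho> \<Longrightarrow> \<bar>expectation (rem \<xi>)\<bar> \<le> \<epsilon> * norm (\<xi> - \<xi>0)"
proof -
  from rem_envelope[OF assms] obtain \<rho> D where *: "\<rho> > 0" "cball \<xi>0 \<rho> \<subseteq> U" "D \<in> borel_measurable P"
    "integrable P (\<lambda>z. (D z)\<^sup>2)" "(\<integral>z. (D z)\<^sup>2 \<partial>P) \<le> \<epsilon>\<^sup>2"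
    "\<And>\<xi> z. \<xi> \<in> cball \<xi>0 \<rho> \<Longrightarrow> z \<in> space P \<Longrightarrow> \<bar>rem \<xi> z\<bar> \<le> D z * norm (\<xi> - \<xi>0)" by metis
  have Di: "integrable P D" by (rule square_integrable_imp_integrable[OF *(3,4)])
  have "D z \<le> \<epsilon> / 2 + (D z)\<^sup>2 / (2 * \<epsilon>)" for z
    using sum_squares_bound[of \<epsilon> "D z"] assms by (simp add: field_simps power2_eq_square)
  then have "(\<integral>z. D z \<partial>P) \<le> (\<integral>z. \<epsilon> / 2 + (D z)\<^sup>2 / (2 * \<epsilon>) \<partial>P)"
    using Di * by (intro integral_mono) auto
  also have "\<dots> = \<epsilon> / 2 + (\<integral>z. (D z)\<^sup>2 \<partial>P) / (2 * \<epsilon>)" using * by (simp add: prob_space)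
  also have "\<dots> \<le> \<epsilon> / 2 + \<epsilon>\<^sup>2 / (2 * \<epsilon>)" using * assms by (intro add_left_mono divide_right_mono) auto
  also have "\<dots> = \<epsilon>" using assms by (simp add: power2_eq_square)
  finally have ED: "(\<integral>z. D z \<partial>P) \<le> \<epsilon>" .
  have "\<bar>expectation (rem \<xi>)\<bar> \<le> \<epsilon> * norm (\<xi> - \<xi>0)" if "\<xi> \<in> cball \<xi>0 \<rho>" for \<xi>
  proof -
    have "\<bar>expectation (rem \<xi>)\<bar> \<le> (\<integral>z. \<bar>rem \<xi> z\<bar> \<partial>P)" by (rule integral_abs_bound)
    also have "\<dots> \<le> (\<integral>z. D z * norm (\<xi> - \<xi>0) \<partial>P)"
      using rem_integrable[of \<xi>] that *(2,6) Di by (intro integral_mono) auto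
    also have "\<dots> \<le> \<epsilon> * norm (\<xi> - \<xi>0)" using ED by (simp add: mult_right_mono)
    finally show ?thesis .
  qed
  with *(1,2) show ?thesis by (rule that)
qed

section \<open>Uniform bounds for the fluctuations of the remainder\<close>

definition rem_sup :: "nat \<Rightarrow> real \<Rightarrow> (nat \<Rightarrow> 'z) \<Rightarrow> ennreal" where
  "rem_sup n \<delta> x = (SUP v\<in>dyadic_cube.
     ennreal \<bar>\<Sum>i<n. rem (\<xi>0 + \<delta> *\<^sub>R v) (x i) - expectation (rem (\<xi>0 + \<delta> *\<^sub>R v))\<bar>)"

lemma expected_supremum_rem:
  assumes "\<eta> > 0"
  obtains \<delta>0 :: real where "\<delta>0 > 0" "cball \<xi>0 (\<delta>0 * CARD('p)) \<subseteq> U"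
    "\<And>\<delta> (n::nat). 0 < \<delta> \<Longrightarrow> \<delta> \<le> \<delta>0 \<Longrightarrow>
      (\<integral>\<^sup>+x. rem_sup n \<delta> x \<partial>(Pi\<^sub>M {..<n} (\<lambda>_. P)))
      \<le> ennreal (\<eta> * \<delta> * sqrt n)"
proof -
  let ?p = "real CARD('p)"
  have p: "?p \<ge> 1" by (simp add: Suc_leI)
  define b where "b = sqrt (\<integral>z. (\<psi> z)\<^sup>2 \<partial>P) + 1"
  have b: "b > 0" by (simp add: b_def add_nonneg_pos)
  have b2: "(\<integral>z. (\<psi> z)\<^sup>2 \<partial>P) \<le> b\<^sup>2" by (simp add: b_def power2_eq_square algebra_simps add_increasing2)
  have "eventually (\<lambda>K. chain_tail CARD('p) K < \<eta> / (4 * b)) sequentially"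
    using chain_tail_tendsto_0 assms b by (intro order_tendstoD(2)) auto
  then obtain K where K: "chain_tail CARD('p) K < \<eta> / (4 * b)" by (auto dest: eventually_happens)
  \<comment> \<open>Since \<open>K\<close> depends on the slope only, the envelope may be chosen in
    terms of it. With this \<open>a\<close>, envelope and slope contribute at most \<eta> / 4 each,
    and the common factor \<open>2 * \<delta> * sqrt n\<close> turns their sum into the claimed
    bound.\<close>
  define a where "a = \<eta> / (8 * ?p * (K + 3))"
  have a: "a > 0" using assms p by (simp add: a_def)
  have "a / ?p > 0" using a p by simp
  from rem_envelope[OF this] obtain \<rho> D where *: "\<rho> > 0" "cball \<xi>0 \<rho> \<subseteq> U" "D \<in> borel_measurable P"
    "integrable P (\<lambda>z. (D z)\<^sup>2)" "(\<integral>z. (D z)\<^sup>2 \<partial>P) \<le> (a / ?p)\<^sup>2"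
    "\<And>\<xi> z. \<xi> \<in> cball \<xi>0 \<rho> \<Longrightarrow> z \<in> space P \<Longrightarrow> \<bar>rem \<xi> z\<bar> \<le> D z * norm (\<xi> - \<xi>0)" by metis
  have D0: "D z \<ge> 0" if "z \<in> space P" for z
  proof -
    obtain b :: "real^'p" where b: "norm b = \<rho>" using vector_choose_size[of \<rho>] * by auto
    have "\<bar>rem (\<xi>0 + b) z\<bar> \<le> D z * \<rho>" using *(6)[of "\<xi>0 + b" z] that b by (simp add: dist_norm)
    then have "0 \<le> D z * \<rho>" by linarith
    then show ?thesis using *(1) by (simp add: zero_le_mult_iff)
  qed
  show ?thesis
  proof (rule that)
    \<comment> \<open>Dyadic points have norm up to \<open>CARD('p)\<close>. Hence the radius is
      divided by it, and the envelope in rescaled coordinates is \<open>?p * D z\<close>.\<close>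
    show "\<rho> / ?p > 0" using * p by simp
    show "cball \<xi>0 (\<rho> / ?p * CARD('p)) \<subseteq> U" using * p by simp
    fix \<delta> :: real and n :: nat assume \<delta>: "0 < \<delta>" "\<delta> \<le> \<rho> / ?p"
    have in_ball: "\<xi>0 + \<delta> *\<^sub>R v \<in> cball \<xi>0 \<rho>" if v: "v \<in> dyadic_cube" for v :: "real^'p"
    proof -
      have "norm v \<le> ?p" using v dyadic_grid_norm by (auto simp: dyadic_cube_def)
      then have "\<delta> * norm v \<le> \<rho> / ?p * ?p" using \<delta> * by (intro mult_mono) auto
      then show ?thesis using \<delta> p by (simp add: dist_norm)
    qed
    have "(\<integral>\<^sup>+x. rem_sup n \<delta> x \<partial>(Pi\<^sub>M {..<n} (\<lambda>_. P)))
      \<le> ennreal (2 * \<delta> * sqrt n * (2 * CARD('p) * (K + 3) * a + chain_tail CARD('p) K * b))"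
      unfolding rem_sup_def
    proof (rule expected_supremum_dyadic_cube[where \<psi> = \<psi> and D = "\<lambda>z. ?p * D z"])
      show "prob_space P" by (rule prob_space_axioms)
      show "(\<integral>z. (?p * D z)\<^sup>2 \<partial>P) \<le> a\<^sup>2"
        using *(5) p by (simp add: power_mult_distrib power_divide field_simps)
      show "integrable P (\<lambda>z. (?p * D z)\<^sup>2)" using *(4) by (simp add: power_mult_distrib)
      fix v w :: "real^'p" and z assume v: "v \<in> dyadic_cube" and z: "z \<in> space P"
      show "\<bar>rem (\<xi>0 + \<delta> *\<^sub>R v) z\<bar> \<le> \<delta> * (?p * D z)"
      proof -
        have "norm v \<le> ?p" using v dyadic_grid_norm by (auto simp: dyadic_cube_def)
        then have "D z * norm (\<delta> *\<^sub>R v) \<le> D z * (\<delta> * ?p)" using D0[OF z] \<delta> by (intro mult_left_mono) auto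
        then show ?thesis using *(6)[OF in_ball[OF v] z] by (simp add: mult_ac)
      qed
      assume w: "w \<in> dyadic_cube"
      have "(\<xi>0 + \<delta> *\<^sub>R v) - (\<xi>0 + \<delta> *\<^sub>R w) = \<delta> *\<^sub>R (v - w)" by (simp add: algebra_simps)
      then show "\<bar>rem (\<xi>0 + \<delta> *\<^sub>R v) z - rem (\<xi>0 + \<delta> *\<^sub>R w) z\<bar> \<le> \<delta> * \<psi> z * norm (v - w)"
        using rem_lipschitz[of "\<xi>0 + \<delta> *\<^sub>R v" "\<xi>0 + \<delta> *\<^sub>R w" z] subsetD[OF *(2) in_ball[OF v]] subsetD[OF *(2) in_ball[OF w]] z \<delta>
        by (simp add: mult_ac)
    next
      fix v :: "real^'p" assume "v \<in> dyadic_cube"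
      then show "integrable P (rem (\<xi>0 + \<delta> *\<^sub>R v))" using in_ball *(2) by (intro rem_integrable) blast
    next
      show "(\<lambda>z. ?p * D z) \<in> borel_measurable P" using *(3) by measurable
    qed (use \<psi>_nonneg \<psi>_square b b2 a \<delta> in auto)
    also have "\<dots> \<le> ennreal (\<eta> * \<delta> * sqrt n)"
    proof (rule ennreal_leI)
      have "2 * ?p * (K + 3) * a = \<eta> / 4" using p by (simp add: a_def divide_simps)
      moreover have "chain_tail CARD('p) K * b \<le> \<eta> / 4" using K b by (simp add: field_simps)
      ultimately have "2 * ?p * (K + 3) * a + chain_tail CARD('p) K * b \<le> \<eta> / 2" by simp
      then have "2 * \<delta> * sqrt n * (2 * ?p * (K + 3) * a + chain_tail CARD('p) K * b) \<le> 2 * \<delta> * sqrt n * (\<eta> / 2)"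
        using \<delta> by (intro mult_left_mono) auto
      then show "2 * \<delta> * sqrt n * (real (2 * CARD('p) * (K + 3)) * a + chain_tail CARD('p) K * b) \<le> \<eta> * \<delta> * sqrt n"
        by (simp add: mult_ac)
    qed
    finally show "(\<integral>\<^sup>+x. rem_sup n \<delta> x \<partial>(Pi\<^sub>M {..<n} (\<lambda>_. P)))
      \<le> ennreal (\<eta> * \<delta> * sqrt n)" .
  qed
qed

text \<open>Makes the centred sums continuous in the parameter, so that a bound on dyadic points
  extends to the whole ball.\<close>

lemma rem_mean_lipschitz:
  assumes "\<xi>1 \<in> U" "\<xi>2 \<in> U"
  shows "\<bar>(\<integral>z. rem \<xi>1 z \<partial>P) - (\<integral>z. rem \<xi>2 z \<partial>P)\<bar> \<le> (\<integral>z. \<psi> z \<partial>P) * norm (\<xi>1 - \<xi>2)"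
proof -
  have i: "integrable P \<psi>" by (rule square_integrable_imp_integrable[OF \<psi>_measurable \<psi>_square])
  have "\<bar>(\<integral>z. rem \<xi>1 z \<partial>P) - (\<integral>z. rem \<xi>2 z \<partial>P)\<bar> = \<bar>\<integral>z. rem \<xi>1 z - rem \<xi>2 z \<partial>P\<bar>"
    using assms rem_integrable by simp
  also have "\<dots> \<le> (\<integral>z. \<bar>rem \<xi>1 z - rem \<xi>2 z\<bar> \<partial>P)" by (rule integral_abs_bound)
  also have "\<dots> \<le> (\<integral>z. \<psi> z * norm (\<xi>1 - \<xi>2) \<partial>P)"
    using assms rem_integrable rem_lipschitz i by (intro integral_mono) auto
  finally show ?thesis by simp
qed

end

locale iid_lipschitz_criterion = lipschitz_criterion P m \<xi>0 mdot \<phi> U + Om: prob_space \<Omega>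
  for P :: "'z measure" and m :: "real^'p \<Rightarrow> 'z \<Rightarrow> real" and \<xi>0 mdot \<phi> U and \<Omega> :: "'w measure" +
  fixes Z :: "nat \<Rightarrow> 'w \<Rightarrow> 'z"
  assumes Z_measurable[measurable]: "\<And>i. Z i \<in> measurable \<Omega> P"
    and Z_distr: "\<And>i. distr \<Omega> P (Z i) = P"
    and Z_indep: "Om.indep_vars (\<lambda>_. P) Z UNIV"
begin

lemma Z_space: "\<omega> \<in> space \<Omega> \<Longrightarrow> Z i \<omega> \<in> space P"
  using measurable_space[OF Z_measurable] by blast

lemma sample_distr: "distr \<Omega> (Pi\<^sub>M {..<n} (\<lambda>_. P)) (\<lambda>\<omega>. \<lambda>i\<in>{..<n}. Z i \<omega>) = Pi\<^sub>M {..<n} (\<lambda>_. P)" if "n > 0"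
proof -
  have "Om.indep_vars (\<lambda>_. P) Z {..<n}" by (rule Om.indep_vars_subset[OF Z_indep]) auto
  moreover have "{..<n} \<noteq> {}" using that by auto
  ultimately show ?thesis using Om.indep_vars_iff_distr_eq_PiM[where I = "{..<n}" and M' = "\<lambda>_. P" and X = Z] Z_distr by simp
qed

definition fluct :: "nat \<Rightarrow> 'w \<Rightarrow> real^'p \<Rightarrow> real" where
  "fluct n \<omega> \<xi> = \<bar>\<Sum>i<n. rem \<xi> (Z i \<omega>) - expectation (rem \<xi>)\<bar>"

text \<open>Markov's inequality for the supremum over dyadic points. The threshold \<open>t\<close>
  is free because it is used in two ways: growing with the shell for the rate, and fixed on a
  shrinking ball for the linearization.\<close>

lemma uniform_fluct:
  assumes "\<eta> > 0"
  shows "\<exists>\<delta>0>0. \<forall>\<delta> n t. 0 < \<delta> \<longrightarrow> \<delta> \<le> \<delta>0 \<longrightarrow> t > 0 \<longrightarrow>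
    holds_up_to \<Omega> (\<eta> * \<delta> * sqrt n / t) (\<lambda>\<omega>. \<forall>\<xi>\<in>cball \<xi>0 \<delta>. fluct n \<omega> \<xi> \<le> t)"
proof (rule expected_supremum_rem[OF assms], goal_cases)
  case (1 \<delta>0)
  note \<delta>0 = 1(1,2) and sup = 1(3)
  have p: "real CARD('p) \<ge> 1" by (simp add: Suc_leI)
  have "\<delta>0 \<le> \<delta>0 * CARD('p)" using \<delta>0 p mult_left_mono[OF p, of \<delta>0] by simp
  from subset_cball[OF this, of \<xi>0] \<delta>0(2) have sub: "cball \<xi>0 \<delta>0 \<subseteq> U" by (rule order.trans)
  show ?case
  proof (intro exI[of _ \<delta>0] conjI allI impI \<delta>0(1))
    fix \<delta> t :: real and n :: nat assume \<delta>: "0 < \<delta>" "\<delta> \<le> \<delta>0" and t: "t > 0"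
    have in_U: "\<xi>0 + \<delta> *\<^sub>R v \<in> U" if "v \<in> dyadic_cube" for v :: "real^'p"
    proof -
      have "norm v \<le> CARD('p)" using that dyadic_grid_norm by (auto simp: dyadic_cube_def)
      then have "\<delta> * norm v \<le> \<delta>0 * CARD('p)" using \<delta> \<delta>0 by (intro mult_mono) auto
      then have "\<xi>0 + \<delta> *\<^sub>R v \<in> cball \<xi>0 (\<delta>0 * CARD('p))" using \<delta> by (simp add: dist_norm)
      then show ?thesis using \<delta>0 by blast
    qed
    define F where "F = rem_sup n \<delta>"
    have Fm: "F \<in> borel_measurable (Pi\<^sub>M {..<n} (\<lambda>_. P))" unfolding F_def rem_sup_def[abs_def]
    proof (rule borel_measurable_SUP[OF countable_dyadic_cube])
      fix v :: "real^'p" assume "v \<in> dyadic_cube"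
      note [measurable] = rem_measurable[OF in_U[OF this]]
      show "(\<lambda>x. ennreal \<bar>\<Sum>i<n. rem (\<xi>0 + \<delta> *\<^sub>R v) (x (i::nat)) - expectation (rem (\<xi>0 + \<delta> *\<^sub>R v))\<bar>) \<in> borel_measurable (Pi\<^sub>M {..<n} (\<lambda>_. P))"
        by measurable
    qed
    define S where "S \<omega> = F (\<lambda>i\<in>{..<n}. Z i \<omega>)" for \<omega>
    have sm: "(\<lambda>\<omega>. \<lambda>i\<in>{..<n}. Z i \<omega>) \<in> measurable \<Omega> (Pi\<^sub>M {..<n} (\<lambda>_. P))" by measurable
    have Sm[measurable]: "S \<in> borel_measurable \<Omega>" unfolding S_def[abs_def] by (rule measurable_compose[OF sm Fm])
    have S_eq: "S \<omega> = (SUP v\<in>dyadic_cube. ennreal \<bar>\<Sum>i<n. rem (\<xi>0 + \<delta> *\<^sub>R v) (Z i \<omega>) - expectation (rem (\<xi>0 + \<delta> *\<^sub>R v))\<bar>)" for \<omega>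
      unfolding S_def F_def rem_sup_def by simp
    have ES: "(\<integral>\<^sup>+\<omega>. S \<omega> \<partial>\<Omega>) \<le> ennreal (\<eta> * \<delta> * sqrt n)"
    proof (cases "n = 0")
      case True
      moreover have "(dyadic_cube :: (real^'p) set) \<noteq> {}"
        using zero_in_dyadic_grid by (auto simp: dyadic_cube_def)
      ultimately show ?thesis by (simp add: S_eq)
    next
      case False
      have "(\<integral>\<^sup>+\<omega>. S \<omega> \<partial>\<Omega>) = (\<integral>\<^sup>+x. F x \<partial>(distr \<Omega> (Pi\<^sub>M {..<n} (\<lambda>_. P)) (\<lambda>\<omega>. \<lambda>i\<in>{..<n}. Z i \<omega>)))"
        unfolding S_def using Fm by (intro nn_integral_distr[symmetric] sm) simp
      also have "\<dots> \<le> ennreal (\<eta> * \<delta> * sqrt n)"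
        using sup[OF \<delta>, of n] sample_distr[of n] False by (simp add: F_def)
      finally show ?thesis .
    qed
    \<comment> \<open>Defined through the countable supremum, hence measurable; it will serve as
      exceptional set for the whole ball.\<close>
    define B where "B = {\<omega>\<in>space \<Omega>. ennreal t \<le> S \<omega>}"
    have B: "B \<in> sets \<Omega>" unfolding B_def by measurable
    have "ennreal t * emeasure \<Omega> B \<le> (\<integral>\<^sup>+\<omega>. S \<omega> \<partial>\<Omega>)"
    proof -
      have "ennreal t * emeasure \<Omega> B = (\<integral>\<^sup>+\<omega>. ennreal t * indicator B \<omega> \<partial>\<Omega>)" using B by (simp add: nn_integral_cmult)
      also have "\<dots> \<le> (\<integral>\<^sup>+\<omega>. S \<omega> \<partial>\<Omega>)" by (intro nn_integral_mono) (auto simp: B_def indicator_def)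
      finally show ?thesis .
    qed
    also note ES
    finally have "ennreal (t * measure \<Omega> B) \<le> ennreal (\<eta> * \<delta> * sqrt n)"
      using t by (simp add: Om.emeasure_eq_measure ennreal_mult)
    then have mB: "measure \<Omega> B \<le> \<eta> * \<delta> * sqrt n / t"
      using t \<delta> assms by (subst (asm) ennreal_le_iff) (auto simp: field_simps)
    have "fluct n \<omega> \<xi> \<le> t" if \<omega>: "\<omega> \<in> space \<Omega> - B" and \<xi>: "\<xi> \<in> cball \<xi>0 \<delta>" for \<omega> \<xi>
    proof -
      define X where "X \<xi> = (\<Sum>i<n. rem \<xi> (Z i \<omega>) - expectation (rem \<xi>))" for \<xi>
      have cont: "continuous_on U X" unfolding X_def
      proof (intro continuous_intros rem_continuous Z_space)
        show "continuous_on U (\<lambda>\<xi>. expectation (rem \<xi>))"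
          using rem_mean_lipschitz \<psi>_nonneg
          by (intro lipschitz_on_continuous_on[of "\<integral>z. \<psi> z \<partial>P"] lipschitz_onI) (auto simp: dist_norm intro!: integral_nonneg_AE AE_I2)
      qed (use \<omega> in auto)
      \<comment> \<open>In rescaled coordinates a point of the ball has norm at most 1, so it is a
        limit of points of the dyadic cube, at which the supremum bounds the centred sum.\<close>
      define v where "v = (\<xi> - \<xi>0) /\<^sub>R \<delta>"
      have v: "norm v \<le> 1" "\<xi>0 + \<delta> *\<^sub>R v = \<xi>"
        using \<xi> \<delta> by (auto simp: v_def dist_norm norm_minus_commute divide_simps)
      obtain w where w: "\<And>k. w k \<in> dyadic_cube" "w \<longlonglongrightarrow> v" using dyadic_cube_dense[OF v(1)] by blast
      have "(\<lambda>k. \<xi>0 + \<delta> *\<^sub>R w k) \<longlonglongrightarrow> \<xi>" using w(2) v(2) by (auto intro!: tendsto_eq_intros)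
      moreover have "\<xi> \<in> U" using \<xi> subset_cball[OF \<delta>(2), of \<xi>0] sub by blast
      ultimately have "(\<lambda>k. X (\<xi>0 + \<delta> *\<^sub>R w k)) \<longlonglongrightarrow> X \<xi>"
        using cont U(1) in_U[OF w(1)] by (intro continuous_on_tendsto_compose[OF cont]) auto
      then have lim: "(\<lambda>k. ennreal \<bar>X (\<xi>0 + \<delta> *\<^sub>R w k)\<bar>) \<longlonglongrightarrow> ennreal \<bar>X \<xi>\<bar>"
        by (intro tendsto_intros)
      have "ennreal \<bar>X \<xi>\<bar> \<le> S \<omega>"
        by (rule LIMSEQ_le_const2[OF lim]) (auto simp: S_eq X_def intro!: SUP_upper2[OF w(1)])
      also have "S \<omega> < ennreal t" using \<omega> by (auto simp: B_def)
      finally show ?thesis using t by (simp add: X_def fluct_def ennreal_less_iff)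
    qed
    then show "holds_up_to \<Omega> (\<eta> * \<delta> * sqrt n / t) (\<lambda>\<omega>. \<forall>\<xi>\<in>cball \<xi>0 \<delta>. fluct n \<omega> \<xi> \<le> t)"
      unfolding holds_up_to_def using B mB by blast
  qed
qed

end

section \<open>Tangent approximation and quadratic expansion\<close>

text \<open>The first claim rests on the inverse chart: a point of \<open>X\<close> close to \<xi>0
  falls into the relatively open set \<open>M\<close>, hence equals \<open>h s\<close>, and
  continuity of the inverse puts \<open>s\<close> close to \<open>s0\<close>. Full column rank
  bounds \<open>s - s0\<close> by \<open>\<xi> - \<xi>0\<close>, which makes the differentiation
  error relative. The second claim follows \<open>h\<close> from \<open>s0\<close> in the direction
  given by \<tau>.\<close>

lemma tangent_space_approximation:
  fixes h :: "real^'s \<Rightarrow> real^'p" and H :: "real^'s^'p" and X :: "(real^'p) set"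
  assumes S: "open S" "s0 \<in> S" and M: "openin (top_of_set X) M" and h: "bij_betw h S M" "h s0 = \<xi>0"
    and inv: "continuous_on M (inv_into S h)"
    and deriv: "(h has_derivative (*v) H) (at s0)" and rank: "rank H = CARD('s)" and \<kappa>: "\<kappa> > 0"
  shows "\<exists>\<delta>>0. \<forall>\<xi>\<in>X. norm (\<xi> - \<xi>0) < \<delta> \<longrightarrow> (\<exists>\<tau>\<in>column_space H. norm (\<xi> - \<xi>0 - \<tau>) \<le> \<kappa> * norm (\<xi> - \<xi>0))"
    and "\<exists>\<delta>>0. \<forall>\<tau>\<in>column_space H. norm \<tau> < \<delta> \<longrightarrow> (\<exists>\<xi>\<in>X. norm (\<xi> - \<xi>0 - \<tau>) \<le> \<kappa> * norm \<tau>)"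
proof -
  have "inj ((*v) H)" using rank by (simp add: full_rank_injective)
  then obtain B where B: "B > 0" "\<And>x. B * norm x \<le> norm (H *v x)"
    using linear_inj_bounded_below_pos[OF matrix_vector_mul_linear[of H]] by blast
  \<comment> \<open>\<open>B / 2\<close> allows the error to be absorbed when \<open>s - s0\<close>
    is bounded by \<open>\<xi> - \<xi>0\<close>; \<open>\<kappa> * B / 2\<close> then gives the
    relative error \<kappa>.\<close>
  define e where "e = min (B / 2) (\<kappa> * B / 2)"
  have e: "e > 0" "e \<le> B / 2" "e \<le> \<kappa> * B / 2" using B \<kappa> by (auto simp: e_def)
  obtain \<delta>1 where \<delta>1: "\<delta>1 > 0" "\<And>s. norm (s - s0) < \<delta>1 \<Longrightarrow> norm (h s - h s0 - H *v (s - s0)) \<le> e * norm (s - s0)"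
    using deriv e unfolding has_derivative_at_alt by blast
  obtain \<delta>2 where \<delta>2: "\<delta>2 > 0" "ball s0 \<delta>2 \<subseteq> S" using S openE by blast
  have MX: "M \<subseteq> X" using M by (rule openin_subset[of "top_of_set X", simplified topspace_euclidean_subtopology])
  have \<xi>0M: "\<xi>0 \<in> M" using h S bij_betwE by blast
  show "\<exists>\<delta>>0. \<forall>\<tau>\<in>column_space H. norm \<tau> < \<delta> \<longrightarrow> (\<exists>\<xi>\<in>X. norm (\<xi> - \<xi>0 - \<tau>) \<le> \<kappa> * norm \<tau>)"
  proof (intro exI[of _ "B * min \<delta>1 \<delta>2"] conjI ballI impI)
    show "B * min \<delta>1 \<delta>2 > 0" using B \<delta>1 \<delta>2 by simp
    fix \<tau> assume "\<tau> \<in> column_space H" and n: "norm \<tau> < B * min \<delta>1 \<delta>2"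
    then obtain y where y: "\<tau> = H *v y" by (auto simp: column_space_eq_range)
    have By: "B * norm y \<le> norm \<tau>" using B y by simp
    then have "B * norm y < B * min \<delta>1 \<delta>2" using n by linarith
    then have ny: "norm y < \<delta>1" "norm y < \<delta>2" using B by auto
    have "s0 + y \<in> S" using \<delta>2 ny by (auto simp: subset_iff dist_norm)
    then have "h (s0 + y) \<in> X" using h MX bij_betwE by blast
    moreover have "norm (h (s0 + y) - \<xi>0 - \<tau>) \<le> e * norm y" using \<delta>1(2)[of "s0 + y"] ny y h by simp
    moreover have "e * norm y \<le> (\<kappa> / 2) * (B * norm y)" using e mult_right_mono[OF e(3), of "norm y"] by simp
    moreover have "(\<kappa> / 2) * (B * norm y) \<le> \<kappa> * norm \<tau>" using \<kappa> By mult_mono[of "\<kappa>/2" \<kappa> "B * norm y" "norm \<tau>"] B by simp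
    ultimately show "\<exists>\<xi>\<in>X. norm (\<xi> - \<xi>0 - \<tau>) \<le> \<kappa> * norm \<tau>" by (intro bexI[of _ "h (s0 + y)"]) linarith+
  qed
  obtain W where W: "open W" "M = X \<inter> W" using M by (auto simp: openin_open)
  then have "\<xi>0 \<in> W" using \<xi>0M by auto
  then obtain \<delta>3 where \<delta>3: "\<delta>3 > 0" "ball \<xi>0 \<delta>3 \<subseteq> W" using W openE by blast
  have inv0: "inv_into S h \<xi>0 = s0" using h S by (metis bij_betw_inv_into_left)
  obtain \<delta>4 where \<delta>4: "\<delta>4 > 0" "\<And>\<xi>. \<xi> \<in> M \<Longrightarrow> dist \<xi> \<xi>0 < \<delta>4 \<Longrightarrow> dist (inv_into S h \<xi>) (inv_into S h \<xi>0) < \<delta>1"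
    using inv \<xi>0M \<delta>1(1) unfolding continuous_on_iff by meson
  show "\<exists>\<delta>>0. \<forall>\<xi>\<in>X. norm (\<xi> - \<xi>0) < \<delta> \<longrightarrow> (\<exists>\<tau>\<in>column_space H. norm (\<xi> - \<xi>0 - \<tau>) \<le> \<kappa> * norm (\<xi> - \<xi>0))"
  proof (intro exI[of _ "min \<delta>3 \<delta>4"] conjI ballI impI)
    show "min \<delta>3 \<delta>4 > 0" using \<delta>3 \<delta>4 by simp
    fix \<xi> assume \<xi>: "\<xi> \<in> X" and n: "norm (\<xi> - \<xi>0) < min \<delta>3 \<delta>4"
    then have "\<xi> \<in> M" using W \<delta>3 by (auto simp: dist_norm norm_minus_commute subset_iff)
    define s where "s = inv_into S h \<xi>"
    have hs: "h s = \<xi>" using h \<open>\<xi> \<in> M\<close> by (simp add: s_def bij_betw_inv_into_right)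
    have s: "norm (s - s0) < \<delta>1" using \<delta>4(2)[OF \<open>\<xi> \<in> M\<close>] n inv0 by (simp add: s_def dist_norm)
    have 1: "norm (\<xi> - \<xi>0 - H *v (s - s0)) \<le> e * norm (s - s0)" using \<delta>1(2)[OF s] hs h by simp
    have "B * norm (s - s0) \<le> norm (H *v (s - s0))" by (rule B)
    also have "\<dots> \<le> norm (\<xi> - \<xi>0) + norm (\<xi> - \<xi>0 - H *v (s - s0))"
      using norm_triangle_ineq4[of "\<xi> - \<xi>0" "\<xi> - \<xi>0 - H *v (s - s0)"] by simp
    also have "\<dots> \<le> norm (\<xi> - \<xi>0) + B / 2 * norm (s - s0)"
      using 1 mult_right_mono[OF e(2), of "norm (s - s0)"] by simp
    finally have 2: "B / 2 * norm (s - s0) \<le> norm (\<xi> - \<xi>0)" by simp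
    have "e * norm (s - s0) \<le> \<kappa> * (B / 2 * norm (s - s0))" using mult_right_mono[OF e(3), of "norm (s - s0)"] by simp
    also have "\<dots> \<le> \<kappa> * norm (\<xi> - \<xi>0)" using 2 \<kappa> by (intro mult_left_mono) auto
    finally have "norm (\<xi> - \<xi>0 - H *v (s - s0)) \<le> \<kappa> * norm (\<xi> - \<xi>0)" using 1 by linarith
    then show "\<exists>\<tau>\<in>column_space H. norm (\<xi> - \<xi>0 - \<tau>) \<le> \<kappa> * norm (\<xi> - \<xi>0)"
      by (intro bexI[of _ "H *v (s - s0)"]) (auto simp: column_space_eq_range)
  qed
qed

section \<open>Second order expansions and quadratic forms\<close>

lemma second_order_taylor_bound:
  assumes "second_order_taylor F x0 b V" "e > 0"
  obtains \<delta> where "\<delta> > 0" "\<And>x. norm (x - x0) < \<delta> \<Longrightarrow>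
    \<bar>F x - F x0 - b \<bullet> (x - x0) - (1/2) * ((x - x0) \<bullet> (V *v (x - x0)))\<bar> \<le> e * (norm (x - x0))\<^sup>2"
proof -
  from assms obtain \<delta> where \<delta>: "\<delta> > 0" "\<And>x. x \<noteq> x0 \<Longrightarrow> dist x x0 < \<delta> \<Longrightarrow>
    \<bar>F x - F x0 - b \<bullet> (x - x0) - (1/2) * ((x - x0) \<bullet> (V *v (x - x0)))\<bar> / (norm (x - x0))\<^sup>2 < e"
    unfolding second_order_taylor_def tendsto_iff eventually_at by (auto simp: dist_norm)
  show ?thesis
  proof (rule that[OF \<delta>(1)])
    fix x assume x: "norm (x - x0) < \<delta>"
    show "\<bar>F x - F x0 - b \<bullet> (x - x0) - (1/2) * ((x - x0) \<bullet> (V *v (x - x0)))\<bar> \<le> e * (norm (x - x0))\<^sup>2"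
    proof (cases "x = x0")
      case False
      then have "(norm (x - x0))\<^sup>2 > 0" by simp
      then show ?thesis using \<delta>(2)[OF False] x by (simp add: dist_norm divide_less_eq)
    qed simp
  qed
qed

text \<open>The form at \<open>x + s y\<close> is a nonnegative quadratic polynomial in
  \<open>s\<close>. For a form that is only semidefinite the null vectors need their own clause,
  where the polynomial is linear and so its slope must vanish.\<close>

lemma psd_cauchy_schwarz:
  fixes \<Gamma> :: "real^'p^'p"
  assumes sym: "transpose \<Gamma> = \<Gamma>" and psd: "\<And>t. t \<bullet> (\<Gamma> *v t) \<ge> 0"
  shows "y \<bullet> (\<Gamma> *v y) > 0 \<Longrightarrow> (x \<bullet> (\<Gamma> *v y))\<^sup>2 / (y \<bullet> (\<Gamma> *v y)) \<le> x \<bullet> (\<Gamma> *v x)"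
    and "x \<bullet> (\<Gamma> *v x) = 0 \<Longrightarrow> y \<bullet> (\<Gamma> *v y) = 0 \<Longrightarrow> x \<bullet> (\<Gamma> *v y) = 0"
proof -
  have "y \<bullet> (\<Gamma> *v x) = x \<bullet> (\<Gamma> *v y)"
    using inner_matrix_vector_transpose[of \<Gamma> x y] sym by (simp add: inner_commute)
  then have q: "0 \<le> x \<bullet> (\<Gamma> *v x) + 2 * s * (x \<bullet> (\<Gamma> *v y)) + s\<^sup>2 * (y \<bullet> (\<Gamma> *v y))" for s
    using psd[of "x + s *\<^sub>R y"]
    by (simp add: matrix_vector_mult_scaleR matrix_vector_right_distrib inner_add_left inner_add_right power2_eq_square algebra_simps)
  show "(x \<bullet> (\<Gamma> *v y))\<^sup>2 / (y \<bullet> (\<Gamma> *v y)) \<le> x \<bullet> (\<Gamma> *v x)" if "y \<bullet> (\<Gamma> *v y) > 0"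
    using q[of "- (x \<bullet> (\<Gamma> *v y)) / (y \<bullet> (\<Gamma> *v y))"] that by (simp add: power2_eq_square field_simps)
  show "x \<bullet> (\<Gamma> *v y) = 0" if "x \<bullet> (\<Gamma> *v x) = 0" "y \<bullet> (\<Gamma> *v y) = 0"
    using q[of 1] q[of "-1"] that by simp
qed

lemma second_order_taylor_has_derivative:
  assumes "second_order_taylor F x0 b V"
  shows "(F has_derivative (\<lambda>v. b \<bullet> v)) (at x0)"
  unfolding has_derivative_at_alt
proof (intro conjI allI impI bounded_linear_inner_right)
  fix e :: real assume e: "e > 0"
  obtain \<delta> where \<delta>: "\<delta> > 0" "\<And>x. norm (x - x0) < \<delta> \<Longrightarrow>
    \<bar>F x - F x0 - b \<bullet> (x - x0) - (1/2) * ((x - x0) \<bullet> (V *v (x - x0)))\<bar> \<le> 1 * (norm (x - x0))\<^sup>2"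
    using second_order_taylor_bound[OF assms zero_less_one] by metis
  obtain N where N: "N > 0" "\<And>x. norm (V *v x) \<le> N * norm x"
    using linear_bounded_pos[OF matrix_vector_mul_linear[of V]] by (metis mult.commute)
  show "\<exists>d>0. \<forall>y. norm (y - x0) < d \<longrightarrow> norm (F y - F x0 - b \<bullet> (y - x0)) \<le> e * norm (y - x0)"
  proof (intro exI[of _ "min \<delta> (e / (1 + N))"] conjI allI impI)
    show "min \<delta> (e / (1 + N)) > 0" using \<delta> e N by simp
    fix y assume y: "norm (y - x0) < min \<delta> (e / (1 + N))"
    let ?d = "y - x0"
    have "\<bar>?d \<bullet> (V *v ?d)\<bar> \<le> norm ?d * (N * norm ?d)"
      by (rule order.trans[OF Cauchy_Schwarz_ineq2 mult_left_mono[OF N(2)]]) simp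
    then have "\<bar>F y - F x0 - b \<bullet> ?d\<bar> \<le> (norm ?d)\<^sup>2 + norm ?d * (N * norm ?d)" using \<delta>(2)[of y] y by linarith
    also have "\<dots> = ((1 + N) * norm ?d) * norm ?d" by (simp add: power2_eq_square algebra_simps)
    also have "\<dots> \<le> e * norm ?d" using y N by (intro mult_right_mono) (auto simp: field_simps)
    finally show "norm (F y - F x0 - b \<bullet> ?d) \<le> e * norm ?d" by simp
  qed
qed

lemma matrix_uminus_vector_mult: "(- A) *v x = - (A *v x)" for A :: "real^'n^'m"
  by (simp add: vec_eq_iff matrix_vector_mult_def sum_negf)

text \<open>Maximality yields only negative semidefiniteness. Invertibility improves it to
  definiteness, and compactness of the unit sphere makes the constant uniform.\<close>

lemma second_order_taylor_max:
  fixes V :: "real^'p^'p"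
  assumes taylor: "second_order_taylor F x0 b V" and U: "open U" "x0 \<in> U" and max: "\<And>x. x \<in> U \<Longrightarrow> F x \<le> F x0"
    and V: "transpose V = V" "invertible V"
  shows "b = 0" and "\<exists>c>0. \<forall>x. x \<bullet> (V *v x) \<le> - c * (norm x)\<^sup>2"
proof -
  have "(\<lambda>v. b \<bullet> v) = (\<lambda>v. 0)"
    using max by (intro differential_zero_maxmin[OF U(2,1) second_order_taylor_has_derivative[OF taylor]]) blast
  then show b0: "b = 0" by (metis inner_eq_zero_iff)
  obtain \<rho> where \<rho>: "\<rho> > 0" "ball x0 \<rho> \<subseteq> U" using U openE by blast
  have nsd: "d \<bullet> (V *v d) \<le> 0" for d
  proof (rule field_le_epsilon)
    fix e :: real assume e: "e > 0"
    define k where "k = norm d + 1"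
    have k: "k > 0" "norm d \<le> k" by (auto simp: k_def add_nonneg_pos)
    have "e / (2 * k\<^sup>2) > 0" using e k by simp
    then obtain \<delta> where \<delta>: "\<delta> > 0" "\<And>x. norm (x - x0) < \<delta> \<Longrightarrow>
      \<bar>F x - F x0 - b \<bullet> (x - x0) - (1/2) * ((x - x0) \<bullet> (V *v (x - x0)))\<bar> \<le> e / (2 * k\<^sup>2) * (norm (x - x0))\<^sup>2"
      using second_order_taylor_bound[OF taylor] by metis
    \<comment> \<open>Small enough to stay in \<open>U\<close> and in the range of the expansion.
      The tolerance was scaled by \<open>k\<^sup>2\<close> so that the error is at most
      \<open>t\<^sup>2 * e / 2\<close>, and \<open>k\<close> exceeds the norm of \<open>d\<close> to
      be positive even when \<open>d\<close> is 0.\<close>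
    define t where "t = min \<rho> \<delta> / (2 * k)"
    have t: "t > 0" using \<rho> \<delta> k by (simp add: t_def)
    have "t * norm d \<le> t * k" using t k by simp
    also have "t * k = min \<rho> \<delta> / 2" using k by (simp add: t_def)
    also have "\<dots> < min \<rho> \<delta>" using \<rho>(1) \<delta>(1) by (simp add: min_def)
    finally have nt: "t * norm d < min \<rho> \<delta>" .
    have "x0 + t *\<^sub>R d \<in> U" using \<rho> nt t by (auto simp: dist_norm subset_iff)
    note F_le = max[OF this]
    have "norm (x0 + t *\<^sub>R d - x0) = t * norm d" "(x0 + t *\<^sub>R d - x0) \<bullet> (V *v (x0 + t *\<^sub>R d - x0)) = t\<^sup>2 * (d \<bullet> (V *v d))"
      using t by (simp_all add: matrix_vector_mult_scaleR power2_eq_square)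
    with \<delta>(2)[of "x0 + t *\<^sub>R d"] nt b0
    have "\<bar>F (x0 + t *\<^sub>R d) - F x0 - (1/2) * (t\<^sup>2 * (d \<bullet> (V *v d)))\<bar> \<le> e / (2 * k\<^sup>2) * (t * norm d)\<^sup>2"
      by (simp only: inner_zero_left min_less_iff_conj diff_0_right)
    then have "(1/2) * (t\<^sup>2 * (d \<bullet> (V *v d))) \<le> e / (2 * k\<^sup>2) * (t * norm d)\<^sup>2" using F_le by linarith
    also have "\<dots> \<le> e / (2 * k\<^sup>2) * (t * k)\<^sup>2" using e t k by (intro mult_left_mono power_mono) auto
    also have "\<dots> = (1/2) * (t\<^sup>2 * e)" using k by (simp add: power_mult_distrib)
    finally show "d \<bullet> (V *v d) \<le> 0 + e" using t by simp
  qed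
  have nd: "d \<bullet> (V *v d) < 0" if d: "d \<noteq> 0" for d
  proof (rule ccontr)
    assume "\<not> ?thesis"
    then have 0: "d \<bullet> (- V *v d) = 0" using nsd[of d] by (simp add: matrix_uminus_vector_mult)
    have sym: "transpose (- V) = - V" using V(1) by (simp add: transpose_def vec_eq_iff)
    have psd: "t \<bullet> (- V *v t) \<ge> 0" for t using nsd[of t] by (simp add: matrix_uminus_vector_mult)
    \<comment> \<open>By the Cauchy-Schwarz inequality a null vector \<open>d\<close> of the form is
      orthogonal to the image of every vector; for this particular \<open>y\<close> that reads
      \<open>norm (V *v d) = 0\<close>.\<close>
    define y where "y = V *v d"
    have "d \<bullet> (- V *v y) = 0"
    proof (cases "y \<bullet> (- V *v y) = 0")
      case True
      then show ?thesis using psd_cauchy_schwarz(2)[OF sym psd 0] by blast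
    next
      case False
      then have pos: "y \<bullet> (- V *v y) > 0" using psd[of y] by linarith
      from psd_cauchy_schwarz(1)[OF sym psd this, of d] 0 pos show ?thesis
        by (simp add: divide_le_0_iff)
    qed
    then have "y \<bullet> y = 0" using inner_matrix_vector_transpose[of V d y] V(1) by (simp add: matrix_uminus_vector_mult y_def)
    then have "V *v d = 0" by (simp add: y_def)
    then show False using V(2) d invertible_left_inverse[of V] matrix_left_invertible_ker[of V] by blast
  qed
  show "\<exists>c>0. \<forall>x. x \<bullet> (V *v x) \<le> - c * (norm x)\<^sup>2"
  proof -
    have compact: "compact (sphere (0::real^'p) 1)" by simp
    have nonempty: "sphere (0::real^'p) 1 \<noteq> {}" by simp
    have "continuous_on (sphere 0 1) (\<lambda>x. V *v x)"
      by (rule bounded_linear.continuous_on[OF matrix_vector_mul_bounded_linear continuous_on_id])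
    then have "continuous_on (sphere 0 1) (\<lambda>x. x \<bullet> (V *v x))" by (intro continuous_on_inner continuous_on_id)
    from continuous_attains_sup[OF compact nonempty this]
    obtain s where s: "s \<in> sphere 0 1" "\<And>x. x \<in> sphere 0 1 \<Longrightarrow> x \<bullet> (V *v x) \<le> s \<bullet> (V *v s)" by blast
    define c where "c = - (s \<bullet> (V *v s))"
    have "s \<noteq> 0" using s(1) by auto
    then have "c > 0" using nd by (simp add: c_def)
    moreover have "x \<bullet> (V *v x) \<le> - c * (norm x)\<^sup>2" for x
    proof (cases "x = 0")
      case False
      define w where "w = x /\<^sub>R norm x"
      have "w \<in> sphere 0 1" using False by (simp add: w_def)
      then have "w \<bullet> (V *v w) \<le> - c" using s(2) by (simp add: c_def)
      then have "(norm x)\<^sup>2 * (w \<bullet> (V *v w)) \<le> (norm x)\<^sup>2 * - c" by (intro mult_left_mono) auto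
      moreover have xw: "x = norm x *\<^sub>R w" using False by (simp add: w_def)
      have "x \<bullet> (V *v x) = (norm x *\<^sub>R w) \<bullet> (V *v (norm x *\<^sub>R w))" by (simp only: xw[symmetric])
      then have "x \<bullet> (V *v x) = (norm x)\<^sup>2 * (w \<bullet> (V *v w))"
        by (simp add: matrix_vector_mult_scaleR power2_eq_square)
      ultimately show ?thesis by (simp add: mult.commute)
    qed simp
    ultimately show ?thesis by blast
  qed
qed

text \<open>Here \<open>w\<close> maximises the quadratic on \<open>T\<close>, \<open>x\<close> is
  almost optimal but only near \<open>T\<close>, and \<open>y\<close> is a competitor near
  \<open>w\<close>. As \<open>V *v w + u\<close> is orthogonal to \<open>T\<close>, the deficit of
  \<tau> against \<open>w\<close> is exactly the quadratic form of \<open>\<tau> - w\<close>, and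
  strong concavity turns near optimality of the value into closeness of the points.\<close>

lemma quadratic_argmax_perturbation:
  fixes V :: "real^'p^'p"
  defines "q \<equiv> \<lambda>u x. (1/2) * (x \<bullet> (V *v x)) + u \<bullet> x"
  assumes V: "transpose V = V" and c: "\<And>x. x \<bullet> (V *v x) \<le> - c * (norm x)\<^sup>2"
    and N: "\<And>x. norm (V *v x) \<le> N * norm x" "N \<ge> 0"
    and T: "subspace T" "w \<in> T" "\<And>\<tau>. \<tau> \<in> T \<Longrightarrow> \<tau> \<bullet> (V *v w + u) = 0"
    and R: "norm u \<le> R" "norm x \<le> R" "norm w \<le> R" and \<kappa>: "0 < \<kappa>" "\<kappa> \<le> 1"
    and \<tau>: "\<tau> \<in> T" "norm (x - \<tau>) \<le> \<kappa> * R" and y: "norm (y - w) \<le> \<kappa> * R"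
    and max: "q u y \<le> q u x + \<kappa> * K"
  shows "c / 2 * (norm (\<tau> - w))\<^sup>2 \<le> \<kappa> * (K + 2 * R * (2 * N * R + R))"
proof -
  have R0: "R \<ge> 0" using R(1) norm_ge_zero order.trans by blast
  have sym: "a \<bullet> (V *v b) = b \<bullet> (V *v a)" for a b
    using inner_matrix_vector_transpose[of V a b] V by (simp add: inner_commute)
  \<comment> \<open>The radius is doubled because \<tau> and \<open>y\<close> may leave the ball of
    radius \<open>R\<close> by \<open>\<kappa> * R\<close>. The difference of values factors, so
    half of \<open>V *v (a + b)\<close> contributes \<open>2 * N * R\<close> and \<open>u\<close>
    contributes \<open>R\<close>.\<close>
  have lip: "\<bar>q u a - q u b\<bar> \<le> norm (a - b) * (2 * N * R + R)" if "norm a \<le> 2 * R" "norm b \<le> 2 * R" for a b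
  proof -
    have "q u a - q u b = (a - b) \<bullet> ((1/2) *\<^sub>R (V *v (a + b)) + u)"
      using sym[of a b] by (simp add: q_def matrix_vector_right_distrib inner_add_right inner_diff_left inner_commute[of _ u] algebra_simps)
    then have "\<bar>q u a - q u b\<bar> \<le> norm (a - b) * norm ((1/2) *\<^sub>R (V *v (a + b)) + u)" by (simp add: Cauchy_Schwarz_ineq2)
    also have "norm ((1/2) *\<^sub>R (V *v (a + b)) + u) \<le> 2 * N * R + R"
    proof -
      have "norm ((1/2) *\<^sub>R (V *v (a + b)) + u) \<le> (1/2) * norm (V *v (a + b)) + norm u"
        by (rule order.trans[OF norm_triangle_ineq]) simp
      also have "norm (V *v (a + b)) \<le> N * norm (a + b)" by (rule N)
      also have "\<dots> \<le> N * (4 * R)" using that norm_triangle_ineq[of a b] N(2) by (intro mult_left_mono) auto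
      finally show ?thesis using R by simp
    qed
    finally show ?thesis by (simp add: mult_left_mono)
  qed
  have \<kappa>R: "\<kappa> * R \<le> R" using mult_right_mono[OF \<kappa>(2) R0] by simp
  have LR: "2 * N * R + R \<ge> 0" using N R0 by (simp add: add_nonneg_nonneg)
  have nt: "norm \<tau> \<le> 2 * R" using norm_triangle_ineq4[of x "x - \<tau>"] \<tau> R \<kappa>R by simp
  have ny: "norm y \<le> 2 * R" using norm_triangle_ineq[of "y - w" w] y R \<kappa>R by simp
  have "q u x - q u \<tau> \<le> \<kappa> * R * (2 * N * R + R)"
    using lip[of x \<tau>] nt R R0 mult_right_mono[OF \<tau>(2) LR] by simp
  moreover have "q u w - q u y \<le> \<kappa> * R * (2 * N * R + R)"
    using lip[of w y] ny R R0 mult_right_mono[OF y LR] by (simp add: norm_minus_commute)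
  moreover have "q u w - q u \<tau> = - (1/2) * ((\<tau> - w) \<bullet> (V *v (\<tau> - w)))"
  proof -
    have "(\<tau> - w) \<bullet> (V *v w + u) = 0" using T \<tau> by (simp add: subspace_diff)
    then show ?thesis using sym[of w \<tau>]
      by (simp add: q_def matrix_vector_mult_diff_distrib inner_add_right inner_diff_left inner_diff_right inner_commute[of _ u] algebra_simps)
  qed
  ultimately have "- (1/2) * ((\<tau> - w) \<bullet> (V *v (\<tau> - w))) \<le> \<kappa> * K + 2 * (\<kappa> * R * (2 * N * R + R))" using max by linarith
  moreover have "c / 2 * (norm (\<tau> - w))\<^sup>2 \<le> - (1/2) * ((\<tau> - w) \<bullet> (V *v (\<tau> - w)))" using c[of "\<tau> - w"] by simp
  ultimately show ?thesis by (simp add: algebra_simps)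
qed

section \<open>Expansion of the mean criterion\<close>

context lipschitz_criterion begin

lemma criterion_has_derivative: "((\<lambda>\<xi>. \<integral>z. m \<xi> z \<partial>P) has_derivative (\<lambda>v. (\<integral>z. mdot z \<partial>P) \<bullet> v)) (at \<xi>0)"
  unfolding has_derivative_at_alt
proof (intro conjI allI impI bounded_linear_inner_right)
  fix e :: real assume "e > 0"
  from rem_mean_small[OF this] obtain \<rho> where \<rho>: "\<rho> > 0" "cball \<xi>0 \<rho> \<subseteq> U"
    "\<And>\<xi>. \<xi> \<in> cball \<xi>0 \<rho> \<Longrightarrow> \<bar>expectation (rem \<xi>)\<bar> \<le> e * norm (\<xi> - \<xi>0)" by metis
  show "\<exists>d>0. \<forall>\<xi>. norm (\<xi> - \<xi>0) < d \<longrightarrow>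
    norm (expectation (m \<xi>) - expectation (m \<xi>0) - (\<integral>z. mdot z \<partial>P) \<bullet> (\<xi> - \<xi>0)) \<le> e * norm (\<xi> - \<xi>0)"
  proof (intro exI[of _ \<rho>] conjI allI impI \<rho>(1))
    fix \<xi> assume "norm (\<xi> - \<xi>0) < \<rho>"
    then have \<xi>: "\<xi> \<in> cball \<xi>0 \<rho>" by (simp add: dist_norm norm_minus_commute)
    then have "expectation (rem \<xi>) = expectation (m \<xi>) - expectation (m \<xi>0) - (\<integral>z. mdot z \<partial>P) \<bullet> (\<xi> - \<xi>0)"
      unfolding rem_def using m_integrable U mdot_integrable \<rho>(2) by (subst Bochner_Integration.integral_diff; auto)+
    then show "norm (expectation (m \<xi>) - expectation (m \<xi>0) - (\<integral>z. mdot z \<partial>P) \<bullet> (\<xi> - \<xi>0)) \<le> e * norm (\<xi> - \<xi>0)"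
      using \<rho>(3)[OF \<xi>] by simp
  qed
qed

text \<open>Two derivatives of the mean criterion are compared: the integral of \<open>mdot\<close>,
  from exchanging derivative and expectation, and 0, from the expansion. The resulting centring is
  what makes the score a sum to which the central limit theorem applies.\<close>

lemma criterion_gradient:
  assumes "second_order_taylor (\<lambda>\<xi>. \<integral>z. m \<xi> z \<partial>P) \<xi>0 0 V"
  shows "(\<integral>z. mdot z \<partial>P) = 0"
  using has_derivative_unique[OF criterion_has_derivative second_order_taylor_has_derivative[OF assms]]
  by (metis inner_eq_zero_iff inner_zero_left)

text \<open>Because the score is centred, the mean of the remainder is the whole increment of the
  criterion, and its leading term is the quadratic one.\<close>

lemma rem_mean_taylor:
  assumes taylor: "second_order_taylor (\<lambda>\<xi>. \<integral>z. m \<xi> z \<partial>P) \<xi>0 0 V" and e: "e > 0"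
  obtains \<delta> :: real where "\<delta> > 0" "cball \<xi>0 \<delta> \<subseteq> U"
    "\<And>\<xi>. norm (\<xi> - \<xi>0) \<le> \<delta> \<Longrightarrow> \<bar>expectation (rem \<xi>) - (1/2) * ((\<xi> - \<xi>0) \<bullet> (V *v (\<xi> - \<xi>0)))\<bar> \<le> e * (norm (\<xi> - \<xi>0))\<^sup>2"
proof -
  obtain \<rho> where \<rho>: "\<rho> > 0" "cball \<xi>0 \<rho> \<subseteq> U" by (rule U_ball)
  obtain \<delta> where \<delta>: "\<delta> > 0" "\<And>\<xi>. norm (\<xi> - \<xi>0) < \<delta> \<Longrightarrow>
    \<bar>(\<integral>z. m \<xi> z \<partial>P) - (\<integral>z. m \<xi>0 z \<partial>P) - 0 \<bullet> (\<xi> - \<xi>0) - (1/2) * ((\<xi> - \<xi>0) \<bullet> (V *v (\<xi> - \<xi>0)))\<bar> \<le> e * (norm (\<xi> - \<xi>0))\<^sup>2"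
    using second_order_taylor_bound[OF taylor e] by metis
  show ?thesis
  proof (rule that)
    show "min \<rho> (\<delta> / 2) > 0" using \<rho> \<delta> by simp
    show "cball \<xi>0 (min \<rho> (\<delta> / 2)) \<subseteq> U" using \<rho> by auto
    fix \<xi> assume n: "norm (\<xi> - \<xi>0) \<le> min \<rho> (\<delta> / 2)"
    then have "\<xi> \<in> U" using \<rho> by (auto simp: subset_iff dist_norm norm_minus_commute)
    then have "expectation (rem \<xi>) = (\<integral>z. m \<xi> z \<partial>P) - (\<integral>z. m \<xi>0 z \<partial>P)"
      unfolding rem_def using m_integrable U mdot_integrable criterion_gradient[OF taylor] by simp
    then show "\<bar>expectation (rem \<xi>) - (1/2) * ((\<xi> - \<xi>0) \<bullet> (V *v (\<xi> - \<xi>0)))\<bar> \<le> e * (norm (\<xi> - \<xi>0))\<^sup>2"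
      using \<delta>(2)[of \<xi>] n \<delta>(1) by simp
  qed
qed

end

section \<open>Rate and linearization\<close>

lemma holds_up_to_mono:
  assumes "holds_up_to M a Q" "a \<le> b" "\<And>\<omega>. \<omega> \<in> space M \<Longrightarrow> Q \<omega> \<Longrightarrow> R \<omega>"
  shows "holds_up_to M b R"
proof -
  from assms(1) obtain B where "B \<in> sets M" "measure M B \<le> a" "\<forall>\<omega>\<in>space M - B. Q \<omega>"
    unfolding holds_up_to_def by blast
  then show ?thesis unfolding holds_up_to_def using assms(2,3) by (intro bexI[of _ B]) auto
qed

context prob_space begin

lemma holds_up_to_conj:
  assumes "holds_up_to M a Q" "holds_up_to M b R"
  shows "holds_up_to M (a + b) (\<lambda>\<omega>. Q \<omega> \<and> R \<omega>)"
proof -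
  from assms obtain A B where "A \<in> sets M" "measure M A \<le> a" "\<forall>\<omega>\<in>space M - A. Q \<omega>"
    "B \<in> sets M" "measure M B \<le> b" "\<forall>\<omega>\<in>space M - B. R \<omega>" unfolding holds_up_to_def by blast
  then show ?thesis unfolding holds_up_to_def
    using measure_Un_le[of A M B] by (intro bexI[of _ "A \<union> B"]) auto
qed

lemma holds_up_to_ball:
  assumes "finite J" "\<And>j. j \<in> J \<Longrightarrow> holds_up_to M (a j) (Q j)"
  shows "holds_up_to M (\<Sum>j\<in>J. a j) (\<lambda>\<omega>. \<forall>j\<in>J. Q j \<omega>)"
  using assms
proof (induction J rule: finite_induct)
  case empty
  then show ?case unfolding holds_up_to_def by (intro bexI[of _ "{}"]) auto
next
  case (insert i J)
  then have "holds_up_to M (a i + (\<Sum>j\<in>J. a j)) (\<lambda>\<omega>. Q i \<omega> \<and> (\<forall>j\<in>J. Q j \<omega>))"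
    by (intro holds_up_to_conj) auto
  with insert.hyps show ?case by simp
qed

lemma holds_up_to_AE:
  assumes "AE \<omega> in M. Q \<omega>" shows "holds_up_to M 0 Q"
proof -
  from assms obtain N where "{\<omega> \<in> space M. \<not> Q \<omega>} \<subseteq> N" "emeasure M N = 0" "N \<in> sets M" by (rule AE_E)
  then show ?thesis unfolding holds_up_to_def by (intro bexI[of _ N]) (auto simp: measure_def)
qed

lemma holds_up_to_measure:
  assumes "{\<omega> \<in> space M. \<not> Q \<omega>} \<in> sets M" "measure M {\<omega> \<in> space M. \<not> Q \<omega>} \<le> a"
  shows "holds_up_to M a Q"
  unfolding holds_up_to_def using assms by (intro bexI[of _ "{\<omega> \<in> space M. \<not> Q \<omega>}"]) auto

lemma measure_le_of_holds_up_to: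
  assumes "holds_up_to M a Q" shows "measure M {\<omega> \<in> space M. \<not> Q \<omega>} \<le> a"
proof -
  from assms obtain B where B: "B \<in> sets M" "measure M B \<le> a" "\<forall>\<omega>\<in>space M - B. Q \<omega>"
    unfolding holds_up_to_def by blast
  have "measure M {\<omega> \<in> space M. \<not> Q \<omega>} \<le> measure M B" using B by (intro finite_measure_mono) auto
  then show ?thesis using B by simp
qed

text \<open>Recasts convergence in probability with two independent tolerances, so that it can be
  intersected with conditions whose measurability is not known.\<close>

lemma converges_in_probability_iff:
  fixes X :: "nat \<Rightarrow> 'a \<Rightarrow> 'b::{metric_space, second_countable_topology}"
  assumes [measurable]: "\<And>n. X n \<in> borel_measurable M"
  shows "converges_in_probability M X l \<longleftrightarrow>
    (\<forall>\<epsilon>>0. \<forall>e>0. \<forall>\<^sub>F n in sequentially. holds_up_to M e (\<lambda>\<omega>. dist (X n \<omega>) l \<le> \<epsilon>))" (is "?L \<longleftrightarrow> ?R")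
proof
  assume L: ?L
  show ?R
  proof (intro allI impI)
    fix \<epsilon> e :: real assume "\<epsilon> > 0" "e > 0"
    then have "\<forall>\<^sub>F n in sequentially. measure M {\<omega> \<in> space M. dist (X n \<omega>) l > \<epsilon>} < e"
      using L by (intro order_tendstoD(2)) (auto simp: converges_in_probability_def)
    then show "\<forall>\<^sub>F n in sequentially. holds_up_to M e (\<lambda>\<omega>. dist (X n \<omega>) l \<le> \<epsilon>)"
      by eventually_elim (rule holds_up_to_measure, auto simp: not_le)
  qed
next
  assume R: ?R
  show ?L unfolding converges_in_probability_def
  proof (intro conjI allI impI assms)
    fix \<epsilon> :: real assume \<epsilon>: "\<epsilon> > 0"
    show "(\<lambda>n. measure M {\<omega> \<in> space M. dist (X n \<omega>) l > \<epsilon>}) \<longlonglongrightarrow> 0"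
    proof (rule tendstoI)
      fix e :: real assume "e > 0"
      then have "\<forall>\<^sub>F n in sequentially. holds_up_to M (e / 2) (\<lambda>\<omega>. dist (X n \<omega>) l \<le> \<epsilon>)" using R \<epsilon> half_gt_zero by blast
      then show "\<forall>\<^sub>F n in sequentially. dist (measure M {\<omega> \<in> space M. dist (X n \<omega>) l > \<epsilon>}) 0 < e"
      proof eventually_elim
        fix n assume "holds_up_to M (e / 2) (\<lambda>\<omega>. dist (X n \<omega>) l \<le> \<epsilon>)"
        from measure_le_of_holds_up_to[OF this] \<open>e > 0\<close>
        show "dist (measure M {\<omega> \<in> space M. dist (X n \<omega>) l > \<epsilon>}) 0 < e" by (simp add: not_le)
      qed
    qed
  qed
qed

end

section \<open>Second moments of the score\<close>

context iid_lipschitz_criterion begin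

definition score :: "nat \<Rightarrow> 'w \<Rightarrow> real^'p" where
  "score n \<omega> = (1 / sqrt (real n)) *\<^sub>R (\<Sum>i<n. mdot (Z i \<omega>))"

lemma score_measurable[measurable]: "score n \<in> borel_measurable \<Omega>"
  unfolding score_def[abs_def] by measurable

lemma integrable_sample: "integrable P f \<Longrightarrow> integrable \<Omega> (\<lambda>\<omega>. f (Z i \<omega>))" for f :: "'z \<Rightarrow> real"
  using integrable_distr[OF Z_measurable, where f = f and i1 = i] by (simp add: Z_distr)

lemma integral_sample: "f \<in> borel_measurable P \<Longrightarrow> (\<integral>\<omega>. f (Z i \<omega>) \<partial>\<Omega>) = (\<integral>z. f z \<partial>P)" for f :: "'z \<Rightarrow> real"
  using integral_distr[OF Z_measurable, of f i] by (simp add: Z_distr)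

lemma mdot_component_measurable[measurable]: "(\<lambda>z. mdot z $ k) \<in> borel_measurable P"
  unfolding cart_eq_inner_axis by measurable

lemma mdot_component_integrable: "integrable P (\<lambda>z. mdot z $ k)"
  by (rule Bochner_Integration.integrable_bound[OF mdot_integrable mdot_component_measurable])
     (auto simp: component_le_norm_cart)

lemma sample_mdot_uncorrelated:
  assumes "(\<integral>z. mdot z \<partial>P) = 0" "i \<noteq> j"
  shows "integrable \<Omega> (\<lambda>\<omega>. mdot (Z i \<omega>) \<bullet> mdot (Z j \<omega>))" "(\<integral>\<omega>. mdot (Z i \<omega>) \<bullet> mdot (Z j \<omega>) \<partial>\<Omega>) = 0"
proof -
  have comp: "(\<integral>z. mdot z $ k \<partial>P) = 0" for k
    using integral_bounded_linear[OF bounded_linear_vec_nth mdot_integrable, of k] assms(1) by simp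
  have ind: "Om.indep_vars (\<lambda>_. borel) (\<lambda>i \<omega>. mdot (Z i \<omega>) $ k) UNIV" for k
    using Om.indep_vars_compose2[OF Z_indep, of "\<lambda>_ z. mdot z $ k" "\<lambda>_. borel"] by simp
  have int: "integrable \<Omega> (\<lambda>\<omega>. mdot (Z l \<omega>) $ k)" for k l
    by (rule integrable_sample[OF mdot_component_integrable])
  have ind2: "Om.indep_vars (\<lambda>_. borel) (\<lambda>i \<omega>. mdot (Z i \<omega>) $ k) {i, j}" for k
    by (rule Om.indep_vars_subset[OF ind]) auto
  have 1: "integrable \<Omega> (\<lambda>\<omega>. mdot (Z i \<omega>) $ k * mdot (Z j \<omega>) $ k)" for k
    using Om.indep_vars_integrable[OF _ ind2] int assms(2) by simp
  have 2: "(\<integral>\<omega>. mdot (Z i \<omega>) $ k * mdot (Z j \<omega>) $ k \<partial>\<Omega>) = 0" for k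
    using Om.indep_vars_lebesgue_integral[OF _ ind2] int assms(2) integral_sample[of "\<lambda>z. mdot z $ k"] comp by simp
  show "integrable \<Omega> (\<lambda>\<omega>. mdot (Z i \<omega>) \<bullet> mdot (Z j \<omega>))"
    using 1 by (simp add: inner_vec_def)
  show "(\<integral>\<omega>. mdot (Z i \<omega>) \<bullet> mdot (Z j \<omega>) \<partial>\<Omega>) = 0"
    using 1 2 by (simp add: inner_vec_def)
qed

text \<open>Independence and centring remove the cross terms, so the second moment grows linearly;
  this is the source of tightness of the normalised score.\<close>

lemma score_second_moment:
  assumes mean: "(\<integral>z. mdot z \<partial>P) = 0"
  shows "integrable \<Omega> (\<lambda>\<omega>. (norm (\<Sum>i<n. mdot (Z i \<omega>)))\<^sup>2) \<and>
     (\<integral>\<omega>. (norm (\<Sum>i<n. mdot (Z i \<omega>)))\<^sup>2 \<partial>\<Omega>) = n * (\<integral>z. (norm (mdot z))\<^sup>2 \<partial>P)"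
proof (induction n)
  case 0
  show ?case by simp
next
  case (Suc n)
  have eq: "(norm (\<Sum>i<Suc n. mdot (Z i \<omega>)))\<^sup>2 = (norm (\<Sum>i<n. mdot (Z i \<omega>)))\<^sup>2
     + 2 * (\<Sum>i<n. mdot (Z i \<omega>) \<bullet> mdot (Z n \<omega>)) + (norm (mdot (Z n \<omega>)))\<^sup>2" for \<omega>
    by (simp add: power2_norm_eq_inner inner_add_left inner_add_right inner_sum_left inner_sum_right inner_commute)
  have i: "integrable \<Omega> (\<lambda>\<omega>. \<Sum>i<n. mdot (Z i \<omega>) \<bullet> mdot (Z n \<omega>))"
    by (intro Bochner_Integration.integrable_sum sample_mdot_uncorrelated mean) auto
  have z: "(\<integral>\<omega>. (\<Sum>i<n. mdot (Z i \<omega>) \<bullet> mdot (Z n \<omega>)) \<partial>\<Omega>) = 0"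
    by (subst Bochner_Integration.integral_sum) (auto intro!: sample_mdot_uncorrelated mean sum.neutral)
  show ?case unfolding eq
    using Suc i z integrable_sample[OF mdot_square, of n] integral_sample[of "\<lambda>z. (norm (mdot z))\<^sup>2" n]
    by (simp add: algebra_simps)
qed

lemma score_bounded_in_probability:
  assumes mean: "(\<integral>z. mdot z \<partial>P) = 0" and e: "e > 0"
  obtains K :: real where "K > 0" "\<And>n. holds_up_to \<Omega> e (\<lambda>\<omega>. norm (score n \<omega>) \<le> K)"
proof -
  define v where "v = (\<integral>z. (norm (mdot z))\<^sup>2 \<partial>P)"
  have v: "v \<ge> 0" unfolding v_def by simp
  \<comment> \<open>Chebyshev's inequality asks for \<open>K\<^sup>2\<close> at least
    \<open>v / e\<close>; the summand 1 keeps \<open>K\<close> positive when \<open>mdot\<close>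
    vanishes almost everywhere.\<close>
  define K where "K = sqrt ((v + 1) / e)"
  have K: "K > 0" "K\<^sup>2 = (v + 1) / e" using v e by (auto simp: K_def)
  have "holds_up_to \<Omega> e (\<lambda>\<omega>. norm (score n \<omega>) \<le> K)" for n
  proof (rule Om.holds_up_to_measure)
    \<comment> \<open>This includes n = 0, where \<open>1 / 0 = 0\<close> and the score is 0, so the
      bound holds for every \<open>n\<close>.\<close>
    have eq: "(norm (score n \<omega>))\<^sup>2 = (1 / n) * (norm (\<Sum>i<n. mdot (Z i \<omega>)))\<^sup>2" for \<omega>
      by (simp add: score_def power_mult_distrib power_divide)
    have i: "integrable \<Omega> (\<lambda>\<omega>. (norm (score n \<omega>))\<^sup>2)" unfolding eq using score_second_moment[OF mean, of n] by simp
    have E: "(\<integral>\<omega>. (norm (score n \<omega>))\<^sup>2 \<partial>\<Omega>) \<le> v" unfolding eq using score_second_moment[OF mean, of n] v by (simp add: v_def)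
    show m: "{\<omega> \<in> space \<Omega>. \<not> norm (score n \<omega>) \<le> K} \<in> sets \<Omega>" by measurable
    have "measure \<Omega> {\<omega> \<in> space \<Omega>. \<not> norm (score n \<omega>) \<le> K} \<le> measure \<Omega> {\<omega> \<in> space \<Omega>. K\<^sup>2 \<le> (norm (score n \<omega>))\<^sup>2}"
      using K(1) by (intro Om.finite_measure_mono) (auto intro: power_mono)
    also have "\<dots> \<le> (\<integral>\<omega>. (norm (score n \<omega>))\<^sup>2 \<partial>\<Omega>) / K\<^sup>2"
      using K(1) by (intro integral_Markov_inequality_measure[OF i, of "{}"]) auto
    also have "\<dots> \<le> (v + 1) / K\<^sup>2" using E by (intro divide_right_mono) auto
    finally show "measure \<Omega> {\<omega> \<in> space \<Omega>. \<not> norm (score n \<omega>) \<le> K} \<le> e" using e v unfolding K by simp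
  qed
  with K(1) show ?thesis by (rule that)
qed

end

text \<open>The assumptions on \<open>L\<close> say that \<open>L *v u\<close> maximises \<open>x \<bullet> V x / 2 + u \<bullet> x\<close> over \<open>T\<close>.\<close>

locale restricted_argmax = iid_lipschitz_criterion P m \<xi>0 mdot \<phi> U \<Omega> Z
  for P :: "'z measure" and m :: "real^'p \<Rightarrow> 'z \<Rightarrow> real" and \<xi>0 mdot \<phi> U and \<Omega> :: "'w measure" and Z +
  fixes V L :: "real^'p^'p" and T X :: "(real^'p) set" and c :: real
    and est :: "nat \<Rightarrow> 'w \<Rightarrow> real^'p" and A :: "nat \<Rightarrow> 'w \<Rightarrow> real"
  assumes taylor: "second_order_taylor (\<lambda>\<xi>. \<integral>z. m \<xi> z \<partial>P) \<xi>0 0 V"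
    and V_sym: "transpose V = V" and c: "c > 0" and V_neg: "\<And>x. x \<bullet> (V *v x) \<le> - c * (norm x)\<^sup>2"
    and T: "subspace T" and L: "\<And>u. L *v u \<in> T" "\<And>u \<tau>. \<tau> \<in> T \<Longrightarrow> \<tau> \<bullet> (V *v (L *v u) + u) = 0"
    and near_tangent: "\<And>\<kappa>. \<kappa> > 0 \<Longrightarrow> \<exists>\<delta>>0. \<forall>\<xi>\<in>X. norm (\<xi> - \<xi>0) < \<delta> \<longrightarrow> (\<exists>\<tau>\<in>T. norm (\<xi> - \<xi>0 - \<tau>) \<le> \<kappa> * norm (\<xi> - \<xi>0))"
    and tangent_near: "\<And>\<kappa>. \<kappa> > 0 \<Longrightarrow> \<exists>\<delta>>0. \<forall>\<tau>\<in>T. norm \<tau> < \<delta> \<longrightarrow> (\<exists>\<xi>\<in>X. norm (\<xi> - \<xi>0 - \<tau>) \<le> \<kappa> * norm \<tau>)"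
    and \<xi>0_X: "\<xi>0 \<in> X"
    and est_X: "\<And>n \<omega>. n \<ge> 1 \<Longrightarrow> \<omega> \<in> space \<Omega> \<Longrightarrow> est n \<omega> \<in> X"
    and est_conv: "converges_in_probability \<Omega> est \<xi>0"
    and A: "small_o_p \<Omega> (\<lambda>n. 1 / real n) A"
    and est_max: "\<And>n. n \<ge> 1 \<Longrightarrow> AE \<omega> in \<Omega>. \<forall>\<xi>\<in>X. (\<Sum>i<n. m \<xi> (Z i \<omega>)) \<le> (\<Sum>i<n. m (est n \<omega>) (Z i \<omega>)) + n * A n \<omega>"
begin

lemma mdot_mean: "(\<integral>z. mdot z \<partial>P) = 0" by (rule criterion_gradient[OF taylor])

lemma est_measurable[measurable]: "est n \<in> borel_measurable \<Omega>"
  using est_conv by (simp add: converges_in_probability_def)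

abbreviation scaled_error :: "nat \<Rightarrow> 'w \<Rightarrow> real^'p" where
  "scaled_error n \<omega> \<equiv> sqrt (real n) *\<^sub>R (est n \<omega> - \<xi>0)"

section \<open>Local quadratic approximation of the criterion\<close>

definition gain :: "nat \<Rightarrow> 'w \<Rightarrow> real^'p \<Rightarrow> real" where
  "gain n \<omega> \<xi> = (\<Sum>i<n. m \<xi> (Z i \<omega>)) - (\<Sum>i<n. m \<xi>0 (Z i \<omega>))"

definition quad :: "real^'p \<Rightarrow> real^'p \<Rightarrow> real" where
  "quad u x = (1/2) * (x \<bullet> (V *v x)) + u \<bullet> x"

lemma gain_eq:
  assumes "n \<ge> 1"
  shows "gain n \<omega> \<xi> = (\<Sum>i<n. rem \<xi> (Z i \<omega>) - expectation (rem \<xi>)) + n * expectation (rem \<xi>)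
    + score n \<omega> \<bullet> (sqrt n *\<^sub>R (\<xi> - \<xi>0))"
proof -
  have "score n \<omega> \<bullet> (sqrt n *\<^sub>R (\<xi> - \<xi>0)) = (\<Sum>i<n. mdot (Z i \<omega>) \<bullet> (\<xi> - \<xi>0))"
    using assms by (simp add: score_def inner_sum_left)
  then show ?thesis by (simp add: gain_def rem_def sum_subtractf)
qed

text \<open>All randomness sits in the premise on \<open>fluct\<close>, so the expansion serves
  every event on which the fluctuation is controlled. The error of the mean part is relative to the
  squared norm: it can be absorbed by the concavity of \<open>quad\<close>, or made small on bounded
  sets.\<close>

lemma gain_expansion:
  assumes "e > 0"
  shows "\<exists>\<delta>>0. \<forall>n \<omega> \<xi> t. n \<ge> 1 \<longrightarrow> norm (\<xi> - \<xi>0) \<le> \<delta> \<longrightarrow> fluct n \<omega> \<xi> \<le> t \<longrightarrow>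
       \<bar>gain n \<omega> \<xi> - quad (score n \<omega>) (sqrt n *\<^sub>R (\<xi> - \<xi>0))\<bar> \<le> t + e * (norm (sqrt n *\<^sub>R (\<xi> - \<xi>0)))\<^sup>2"
proof (rule rem_mean_taylor[OF taylor assms], goal_cases)
  case (1 \<delta>)
  show ?case
  proof (intro exI[of _ \<delta>] conjI allI impI)
    show "\<delta> > 0" by (rule 1)
    fix n \<omega> \<xi> t assume n: "(n::nat) \<ge> 1" and \<xi>: "norm (\<xi> - \<xi>0) \<le> \<delta>" and t: "fluct n \<omega> \<xi> \<le> t"
    let ?d = "\<xi> - \<xi>0"
    have "\<bar>n * expectation (rem \<xi>) - n * ((1/2) * (?d \<bullet> (V *v ?d)))\<bar> \<le> n * (e * (norm ?d)\<^sup>2)"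
      using mult_left_mono[OF 1(3)[OF \<xi>], of n]
      by (simp only: right_diff_distrib[symmetric] abs_mult abs_of_nat of_nat_0_le_iff)
    moreover have "gain n \<omega> \<xi> - quad (score n \<omega>) (sqrt n *\<^sub>R ?d) = (\<Sum>i<n. rem \<xi> (Z i \<omega>) - expectation (rem \<xi>))
       + (n * expectation (rem \<xi>) - n * ((1/2) * (?d \<bullet> (V *v ?d))))"
      by (simp add: gain_eq[OF n] quad_def matrix_vector_mult_scaleR)
    moreover have "e * (norm (sqrt n *\<^sub>R ?d))\<^sup>2 = n * (e * (norm ?d)\<^sup>2)" by (simp add: power_mult_distrib)
    ultimately show "\<bar>gain n \<omega> \<xi> - quad (score n \<omega>) (sqrt n *\<^sub>R ?d)\<bar> \<le> t + e * (norm (sqrt n *\<^sub>R ?d))\<^sup>2"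
      using t unfolding fluct_def by linarith
  qed
qed

lemma slack_small:
  assumes "\<kappa> > 0" "e > 0"
  shows "\<forall>\<^sub>F n in sequentially. holds_up_to \<Omega> e (\<lambda>\<omega>. n * A n \<omega> \<le> \<kappa>)"
proof -
  have "\<And>n. (\<lambda>\<omega>. A n \<omega> /\<^sub>R (1 / real n)) \<in> borel_measurable \<Omega>"
    using A by (simp add: small_o_p_def converges_in_probability_def)
  from Om.converges_in_probability_iff[OF this, where l = 0] A assms
  have "\<forall>\<^sub>F n in sequentially. holds_up_to \<Omega> e (\<lambda>\<omega>. dist (A n \<omega> /\<^sub>R (1 / real n)) 0 \<le> \<kappa>)"
    by (simp add: small_o_p_def)
  then show ?thesis by eventually_elim (erule holds_up_to_mono, auto)
qed

lemma est_consistent: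
  assumes "\<delta> > 0" "e > 0"
  shows "\<forall>\<^sub>F n in sequentially. holds_up_to \<Omega> e (\<lambda>\<omega>. norm (est n \<omega> - \<xi>0) \<le> \<delta>)"
  using Om.converges_in_probability_iff[OF est_measurable, where l = \<xi>0] est_conv assms by (simp add: dist_norm)

lemma est_gain:
  assumes "n \<ge> 1"
  shows "holds_up_to \<Omega> 0 (\<lambda>\<omega>. \<forall>\<xi>\<in>X. gain n \<omega> \<xi> \<le> gain n \<omega> (est n \<omega>) + n * A n \<omega>)"
  using Om.holds_up_to_AE[OF est_max[OF assms]] by (rule holds_up_to_mono) (auto simp: gain_def)

lemma geometric_tail_sum: "(\<Sum>j\<in>{J..<J+k}. (1/2::real) ^ j) \<le> 2 * (1/2) ^ J"
proof -
  have "(\<Sum>j\<in>{J..<J+k}. (1/2::real) ^ j) = 2 * (1/2) ^ J - 2 * (1/2) ^ (J + k)"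
    by (induction k) auto
  then show ?thesis by simp
qed

lemma dyadic_shell:
  assumes "y \<ge> (1::real)" obtains j :: nat where "2 ^ j \<le> y" "y < 2 ^ Suc j"
proof -
  define k where "k = (LEAST k. y < 2 ^ k)"
  have "\<exists>k. y < 2 ^ k" by (rule real_arch_pow) simp
  then have k: "y < 2 ^ k" unfolding k_def by (rule LeastI_ex)
  then have "k \<noteq> 0" using assms by (intro notI) auto
  then obtain j where j: "k = Suc j" by (cases k) auto
  have "\<not> y < 2 ^ j" using not_less_Least[of j "\<lambda>k. y < 2 ^ k"] j by (simp add: k_def)
  then show ?thesis using that[of j] k j by simp
qed

text \<open>The rate follows by peeling: on the shell \<open>2\<^sup>j \<le> \<surd>n |\<xi> - \<xi>0| < 2\<^sup>j\<^sup>+\<^sup>1\<close> the criterion drops by order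
  \<open>4\<^sup>j\<close>, whereas its fluctuation is of order \<open>2\<^sup>j\<close>.\<close>

lemma rate:
  assumes e: "e > 0"
  obtains R :: real where "R > 0" "\<forall>\<^sub>F n in sequentially. holds_up_to \<Omega> e (\<lambda>\<omega>. norm (scaled_error n \<omega>) \<le> R)"
proof -
  have e4: "e / 4 > 0" using e by simp
  obtain K where K: "K > 0" "\<And>n. holds_up_to \<Omega> (e / 4) (\<lambda>\<omega>. norm (score n \<omega>) \<le> K)"
    using score_bounded_in_probability[OF mdot_mean e4] by metis
  \<comment> \<open>Of the curvature \<open>c / 2\<close> the expansion error takes
    \<open>c / 4\<close> and the fluctuation \<open>c / 8\<close>; the remaining
    \<open>c / 8\<close> bounds the norm. The constant \<open>c / 16\<close> makes the fluctuation
    bound on shell \<open>j\<close> fail with probability at most \<open>(1/2) ^ j\<close>.\<close>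
  have c4: "c / 4 > 0" and c16: "c / 16 > 0" using c by auto
  obtain \<delta>1 where \<delta>1: "\<delta>1 > 0"
    "\<And>n \<omega> \<xi> t. n \<ge> 1 \<Longrightarrow> norm (\<xi> - \<xi>0) \<le> \<delta>1 \<Longrightarrow> fluct n \<omega> \<xi> \<le> t \<Longrightarrow>
       \<bar>gain n \<omega> \<xi> - quad (score n \<omega>) (sqrt n *\<^sub>R (\<xi> - \<xi>0))\<bar> \<le> t + c / 4 * (norm (sqrt n *\<^sub>R (\<xi> - \<xi>0)))\<^sup>2"
    using gain_expansion[OF c4] by blast
  obtain \<delta>0 :: real where \<delta>0: "\<delta>0 > 0"
    "\<And>\<delta> n t. 0 < \<delta> \<Longrightarrow> \<delta> \<le> \<delta>0 \<Longrightarrow> t > 0 \<Longrightarrow> holds_up_to \<Omega> (c / 16 * \<delta> * sqrt n / t)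
      (\<lambda>\<omega>. \<forall>\<xi>\<in>cball \<xi>0 \<delta>. fluct n \<omega> \<xi> \<le> t)"
    using uniform_fluct[OF c16] by blast
  obtain J :: nat where J: "2 * (1/2::real) ^ J \<le> e / 4"
    using real_arch_pow_inv[of "e / 8" "1/2"] e by (auto simp: field_simps intro: less_imp_le)
  \<comment> \<open>\<open>2 ^ J\<close> leaves only shells whose failure probabilities sum to at
    most \<open>e / 4\<close>, 1 is where the shells begin, and the last entry contradicts the
    inequality reached at the end.\<close>
  define R where "R = Max {2 ^ J, 1, 8 * (K + 1) / c}"
  have R: "2 ^ J \<le> R" "1 \<le> R" "8 * (K + 1) / c \<le> R" by (simp_all add: R_def)
  define \<delta> where "\<delta> = min \<delta>0 \<delta>1"
  have \<delta>: "\<delta> > 0" "\<delta> \<le> \<delta>0" "\<delta> \<le> \<delta>1" using \<delta>0 \<delta>1 by (auto simp: \<delta>_def)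
  have "\<forall>\<^sub>F n in sequentially. holds_up_to \<Omega> e (\<lambda>\<omega>. norm (scaled_error n \<omega>) \<le> R)"
    using slack_small[OF zero_less_one e4] est_consistent[OF half_gt_zero[OF \<delta>(1)] e4] eventually_ge_at_top[of 1]
  proof eventually_elim
    fix n :: nat
    assume sl: "holds_up_to \<Omega> (e / 4) (\<lambda>\<omega>. n * A n \<omega> \<le> 1)"
      and co: "holds_up_to \<Omega> (e / 4) (\<lambda>\<omega>. norm (est n \<omega> - \<xi>0) \<le> \<delta> / 2)" and n: "1 \<le> n"
    define W where "W j \<omega> \<longleftrightarrow> (\<forall>\<xi>\<in>cball \<xi>0 (2 ^ Suc j / sqrt n). fluct n \<omega> \<xi> \<le> c / 8 * 4 ^ j)" for j \<omega>
    \<comment> \<open>Consistency disposes of the shells that reach beyond \<delta>, so a finite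
      union bound is enough.\<close>
    define Js where "Js = {j. J \<le> j \<and> 2 ^ Suc j / sqrt n \<le> \<delta>}"
    define N where "N = nat \<lceil>\<delta> * sqrt n\<rceil>"
    have Js_sub: "Js \<subseteq> {J..<J + Suc N}"
    proof
      fix j assume j: "j \<in> Js"
      then have "real (2 ^ Suc j) \<le> \<delta> * sqrt n" using n by (simp add: Js_def field_simps)
      moreover have "real j \<le> real (2 ^ Suc j)" using less_exp[of "Suc j"] by (intro of_nat_mono) linarith
      ultimately have "real j \<le> \<delta> * sqrt n" by linarith
      then have "j \<le> N" unfolding N_def by linarith
      then show "j \<in> {J..<J + Suc N}" using j by (auto simp: Js_def)
    qed
    have fin: "finite Js" using Js_sub finite_subset by blast
    have "holds_up_to \<Omega> ((1/2) ^ j) (W j)" if "j \<in> Js" for j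
    proof -
      have "holds_up_to \<Omega> (c / 16 * (2 ^ Suc j / sqrt n) * sqrt n / (c / 8 * 4 ^ j)) (W j)"
        unfolding W_def using that \<delta>(2) n c by (intro \<delta>0(2)) (auto simp: Js_def)
      moreover have "c / 16 * (2 ^ Suc j / sqrt n) * sqrt n / (c / 8 * 4 ^ j) = (1/2) ^ j"
      proof -
        have "(4::real) ^ j = 2 ^ j * 2 ^ j" by (simp flip: power_mult_distrib)
        then show ?thesis using n c by (simp add: power_one_over)
      qed
      ultimately show ?thesis by simp
    qed
    from Om.holds_up_to_ball[OF fin this]
    have "holds_up_to \<Omega> (\<Sum>j\<in>Js. (1/2) ^ j) (\<lambda>\<omega>. \<forall>j\<in>Js. W j \<omega>)" by simp
    moreover have "(\<Sum>j\<in>Js. (1/2::real) ^ j) \<le> e / 4"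
    proof -
      have "(\<Sum>j\<in>Js. (1/2::real) ^ j) \<le> (\<Sum>j\<in>{J..<J + Suc N}. (1/2) ^ j)" using Js_sub by (intro sum_mono2) auto
      then show ?thesis using geometric_tail_sum[of J "Suc N"] J by linarith
    qed
    ultimately have sh: "holds_up_to \<Omega> (e / 4) (\<lambda>\<omega>. \<forall>j\<in>Js. W j \<omega>)" by (rule holds_up_to_mono)
    show "holds_up_to \<Omega> e (\<lambda>\<omega>. norm (scaled_error n \<omega>) \<le> R)"
      using Om.holds_up_to_conj[OF Om.holds_up_to_conj[OF Om.holds_up_to_conj[OF Om.holds_up_to_conj[OF K(2)[of n] sl] co] sh] est_gain[OF n]]
    proof (rule holds_up_to_mono)
      fix \<omega> assume \<omega>: "(((norm (score n \<omega>) \<le> K \<and> n * A n \<omega> \<le> 1) \<and> norm (est n \<omega> - \<xi>0) \<le> \<delta> / 2) \<and> (\<forall>j\<in>Js. W j \<omega>)) \<and>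
        (\<forall>\<xi>\<in>X. gain n \<omega> \<xi> \<le> gain n \<omega> (est n \<omega>) + n * A n \<omega>)"
      show "norm (scaled_error n \<omega>) \<le> R"
      proof (rule ccontr)
        let ?x = "scaled_error n \<omega>"
        assume "\<not> norm ?x \<le> R"
        then have xR: "norm ?x > R" by simp
        then have "norm ?x \<ge> 1" using R by simp
        then obtain j where j: "2 ^ j \<le> norm ?x" "norm ?x < 2 ^ Suc j" by (rule dyadic_shell)
        have nx: "norm ?x = sqrt n * norm (est n \<omega> - \<xi>0)" by simp
        have "(2::real) ^ J < 2 ^ Suc j" using j xR R by linarith
        then have "J < Suc j" by (rule power_less_imp_less_exp[rotated]) simp
        then have "J \<le> j" by simp
        \<comment> \<open>The outer radius of the shell is at most twice the norm of the scaled
          error, which is why the estimator was localised within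
          \<open>\<delta> / 2\<close>.\<close>
        moreover have "2 ^ Suc j / sqrt n \<le> \<delta>"
        proof -
          have "2 * norm ?x \<le> sqrt n * \<delta>" unfolding nx using \<omega> mult_left_mono[of "norm (est n \<omega> - \<xi>0)" "\<delta> / 2" "sqrt n"] by simp
          then have "2 ^ Suc j \<le> sqrt n * \<delta>" using j(1) by simp
          then show ?thesis using n by (simp add: field_simps)
        qed
        ultimately have "W j \<omega>" using \<omega> by (auto simp: Js_def)
        moreover have "norm (est n \<omega> - \<xi>0) \<le> 2 ^ Suc j / sqrt n" using j(2) n nx by (simp add: field_simps)
        ultimately have w: "fluct n \<omega> (est n \<omega>) \<le> c / 8 * 4 ^ j"
          by (simp add: W_def dist_norm norm_minus_commute)
        have "norm (est n \<omega> - \<xi>0) \<le> \<delta>1" using \<omega> \<delta> by linarith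
        from \<delta>1(2)[OF n this w] have "gain n \<omega> (est n \<omega>) \<le> quad (score n \<omega>) ?x + c / 8 * 4 ^ j + c / 4 * (norm ?x)\<^sup>2" by linarith
        \<comment> \<open>The competitor is \<xi>0 itself, whose gain is 0.\<close>
        moreover have "0 \<le> gain n \<omega> (est n \<omega>) + 1" using \<omega> \<xi>0_X by (auto simp: gain_def)
        moreover have "quad (score n \<omega>) ?x \<le> - (c / 2) * (norm ?x)\<^sup>2 + K * norm ?x"
        proof -
          have "score n \<omega> \<bullet> ?x \<le> norm (score n \<omega>) * norm ?x" by (rule norm_cauchy_schwarz)
          also have "\<dots> \<le> K * norm ?x" using \<omega> by (intro mult_right_mono) auto
          finally show ?thesis using V_neg[of ?x] by (simp add: quad_def)
        qed
        moreover have "c / 8 * 4 ^ j \<le> c / 8 * (norm ?x)\<^sup>2"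
        proof -
          have "(4::real) ^ j = (2 ^ j)\<^sup>2" by (simp add: power2_eq_square flip: power_mult_distrib)
          also have "\<dots> \<le> (norm ?x)\<^sup>2" using j(1) by (intro power_mono) auto
          finally show ?thesis using c by simp
        qed
        ultimately have "c / 8 * (norm ?x)\<^sup>2 \<le> K * norm ?x + 1" by linarith
        also have "\<dots> \<le> (K + 1) * norm ?x" using \<open>norm ?x \<ge> 1\<close> by (simp add: algebra_simps)
        finally have "(c / 8 * norm ?x) * norm ?x \<le> (K + 1) * norm ?x" by (simp add: power2_eq_square mult.assoc)
        then have "c / 8 * norm ?x \<le> K + 1" using \<open>norm ?x \<ge> 1\<close> by (simp only: mult_le_cancel_right_pos)
        then have "norm ?x \<le> 8 * (K + 1) / c" using c by (simp add: field_simps)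
        then show False using xR R by linarith
      qed
    qed simp
  qed
  moreover have "R > 0" using R by linarith
  ultimately show ?thesis by (intro that)
qed

text \<open>Once the rate is known, everything happens within distance \<open>2 * R / sqrt n\<close>
  of \<xi>0, and a single tolerance \<kappa> serves for the slack, the fluctuations, the expansion
  error and both tangent approximations.\<close>

theorem linearization:
  "small_o_p \<Omega> (\<lambda>_. 1) (\<lambda>n \<omega>. scaled_error n \<omega> - L *v score n \<omega>)"
proof -
  obtain N where N: "N > 0" "\<And>x. norm (V *v x) \<le> N * norm x"
    using linear_bounded_pos[OF matrix_vector_mul_linear[of V]] by (metis mult.commute)
  obtain NL where NL: "NL > 0" "\<And>x. norm (L *v x) \<le> NL * norm x"
    using linear_bounded_pos[OF matrix_vector_mul_linear[of L]] by (metis mult.commute)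
  have Lm[measurable]: "(\<lambda>\<omega>. L *v score n \<omega>) \<in> borel_measurable \<Omega>" for n
    by (rule measurable_compose[OF score_measurable borel_measurable_continuous_onI])
       (rule bounded_linear.continuous_on[OF matrix_vector_mul_bounded_linear continuous_on_id])
  have main: "\<forall>\<^sub>F n in sequentially. holds_up_to \<Omega> e (\<lambda>\<omega>. norm (scaled_error n \<omega> - L *v score n \<omega>) \<le> \<epsilon>)"
    if \<epsilon>: "\<epsilon> > 0" and e: "e > 0" for \<epsilon> e
  proof -
    have e4: "e / 4 > 0" using e by simp
    obtain R1 where R1: "R1 > 0" "\<And>n. holds_up_to \<Omega> (e / 4) (\<lambda>\<omega>. norm (score n \<omega>) \<le> R1)"
      using score_bounded_in_probability[OF mdot_mean e4] by metis
    obtain R2 where R2: "R2 > 0" "\<forall>\<^sub>F n in sequentially. holds_up_to \<Omega> (e / 4) (\<lambda>\<omega>. norm (scaled_error n \<omega>) \<le> R2)"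
      by (rule rate[OF e4])
    \<comment> \<open>One radius for the score, the scaled error and the tangent maximiser
      \<open>L *v score n \<omega>\<close>.\<close>
    define R where "R = R1 + R2 + NL * R1"
    have R: "R > 0" "R1 \<le> R" "R2 \<le> R" "NL * R1 \<le> R" using R1 R2 NL by (auto simp: R_def add_pos_pos)
    \<comment> \<open>The 3 counts the slack and the two fluctuations; 5 is 4 + 1, from the norm
      bounds \<open>2 * R\<close> for the competitor and \<open>R\<close> for the estimator.\<close>
    define K where "K = 3 + 5 * R\<^sup>2"
    define K1 where "K1 = K + 2 * R * (2 * N * R + R)"
    have K: "K > 0" "K1 > 0" using R N by (auto simp: K_def K1_def intro!: add_pos_pos mult_pos_pos)
    \<comment> \<open>The second entry puts the scaled error within \<open>\<epsilon> / 2\<close> of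
      a tangent vector, the third puts that tangent vector within \<open>\<epsilon> / 2\<close> of
      the maximiser.\<close>
    define \<kappa> where "\<kappa> = Min {1, \<epsilon> / (2 * R), c / 2 * (\<epsilon> / 2)\<^sup>2 / K1}"
    have \<kappa>: "\<kappa> > 0" "\<kappa> \<le> 1" "\<kappa> \<le> \<epsilon> / (2 * R)" "\<kappa> \<le> c / 2 * (\<epsilon> / 2)\<^sup>2 / K1"
      using \<epsilon> R c K by (auto simp: \<kappa>_def)
    have \<kappa>R: "\<kappa> * R \<le> \<epsilon> / 2" using \<kappa>(3) R by (simp add: field_simps)
    have \<kappa>K: "\<kappa> * K1 \<le> c / 2 * (\<epsilon> / 2)\<^sup>2" using \<kappa>(4) K by (simp add: pos_le_divide_eq)
    \<comment> \<open>On radius \<open>2 * R / sqrt n\<close> with threshold \<kappa> the failure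
      probability is \<open>2 * R * \<eta> / \<kappa>\<close>, which this choice makes equal to
      \<open>e / 4\<close>.\<close>
    define \<eta> where "\<eta> = e * \<kappa> / (8 * R)"
    have \<eta>: "\<eta> > 0" using e \<kappa> R by (simp add: \<eta>_def)
    obtain \<delta>1 where \<delta>1: "\<delta>1 > 0"
      "\<And>n \<omega> \<xi> t. n \<ge> 1 \<Longrightarrow> norm (\<xi> - \<xi>0) \<le> \<delta>1 \<Longrightarrow> fluct n \<omega> \<xi> \<le> t \<Longrightarrow>
         \<bar>gain n \<omega> \<xi> - quad (score n \<omega>) (sqrt n *\<^sub>R (\<xi> - \<xi>0))\<bar> \<le> t + \<kappa> * (norm (sqrt n *\<^sub>R (\<xi> - \<xi>0)))\<^sup>2"
      using gain_expansion[OF \<kappa>(1)] by blast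
    obtain \<delta>0 :: real where \<delta>0: "\<delta>0 > 0"
      "\<And>\<delta> n t. 0 < \<delta> \<Longrightarrow> \<delta> \<le> \<delta>0 \<Longrightarrow> t > 0 \<Longrightarrow> holds_up_to \<Omega> (\<eta> * \<delta> * sqrt n / t)
        (\<lambda>\<omega>. \<forall>\<xi>\<in>cball \<xi>0 \<delta>. fluct n \<omega> \<xi> \<le> t)"
      using uniform_fluct[OF \<eta>] by blast
    obtain \<delta>2 where \<delta>2: "\<delta>2 > 0" "\<forall>\<xi>\<in>X. norm (\<xi> - \<xi>0) < \<delta>2 \<longrightarrow> (\<exists>\<tau>\<in>T. norm (\<xi> - \<xi>0 - \<tau>) \<le> \<kappa> * norm (\<xi> - \<xi>0))"
      using near_tangent[OF \<kappa>(1)] by (elim exE conjE)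
    obtain \<delta>3 where \<delta>3: "\<delta>3 > 0" "\<forall>\<tau>\<in>T. norm \<tau> < \<delta>3 \<longrightarrow> (\<exists>\<xi>\<in>X. norm (\<xi> - \<xi>0 - \<tau>) \<le> \<kappa> * norm \<tau>)"
      using tangent_near[OF \<kappa>(1)] by (elim exE conjE)
    define \<delta> where "\<delta> = Min {\<delta>0, \<delta>1, \<delta>2, \<delta>3}"
    have \<delta>: "\<delta> > 0" "\<delta> \<le> \<delta>0" "\<delta> \<le> \<delta>1" "\<delta> \<le> \<delta>2" "\<delta> \<le> \<delta>3" using \<delta>0 \<delta>1 \<delta>2 \<delta>3 by (auto simp: \<delta>_def)
    have large: "\<forall>\<^sub>F n in sequentially. 2 * R / \<delta> \<le> sqrt (real n)"
      using filterlim_compose[OF sqrt_at_top filterlim_real_sequentially] by (simp add: filterlim_at_top)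
    show ?thesis
      using slack_small[OF \<kappa>(1) e4] R2(2) large eventually_ge_at_top[of 1]
    proof eventually_elim
      fix n :: nat
      assume sl: "holds_up_to \<Omega> (e / 4) (\<lambda>\<omega>. n * A n \<omega> \<le> \<kappa>)"
        and er: "holds_up_to \<Omega> (e / 4) (\<lambda>\<omega>. norm (scaled_error n \<omega>) \<le> R2)"
        and nl: "2 * R / \<delta> \<le> sqrt (real n)" and n: "1 \<le> n"
      have sn: "sqrt n > 0" using n by simp
      have rad: "2 * R / sqrt n \<le> \<delta>" using nl \<delta>(1) sn by (simp add: field_simps)
      have R_rad: "R / sqrt n < \<delta>"
      proof -
        have "R / sqrt n < 2 * R / sqrt n" using R sn by (simp add: divide_strict_right_mono)
        then show ?thesis using rad by linarith
      qed
      define W where "W \<omega> \<longleftrightarrow> (\<forall>\<xi>\<in>cball \<xi>0 (2 * R / sqrt n). fluct n \<omega> \<xi> \<le> \<kappa>)" for \<omega>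
      have "holds_up_to \<Omega> (\<eta> * (2 * R / sqrt n) * sqrt n / \<kappa>) W"
        unfolding W_def using rad \<delta>(2) R sn \<kappa> by (intro \<delta>0(2)) auto
      moreover have "\<eta> * (2 * R / sqrt n) * sqrt n / \<kappa> = e / 4" using sn R \<kappa> by (simp add: \<eta>_def)
      ultimately have W: "holds_up_to \<Omega> (e / 4) W" by (simp only:)
      show "holds_up_to \<Omega> e (\<lambda>\<omega>. norm (scaled_error n \<omega> - L *v score n \<omega>) \<le> \<epsilon>)"
        using Om.holds_up_to_conj[OF Om.holds_up_to_conj[OF Om.holds_up_to_conj[OF Om.holds_up_to_conj[OF R1(2)[of n] sl] er] W] est_gain[OF n]]
      proof (rule holds_up_to_mono)
        fix \<omega> assume \<omega>s: "\<omega> \<in> space \<Omega>"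
          and "(((norm (score n \<omega>) \<le> R1 \<and> n * A n \<omega> \<le> \<kappa>) \<and> norm (scaled_error n \<omega>) \<le> R2) \<and> W \<omega>) \<and>
          (\<forall>\<xi>\<in>X. gain n \<omega> \<xi> \<le> gain n \<omega> (est n \<omega>) + n * A n \<omega>)"
        then have \<omega>: "norm (score n \<omega>) \<le> R1" "n * A n \<omega> \<le> \<kappa>" "norm (scaled_error n \<omega>) \<le> R2" "W \<omega>"
          "\<And>\<xi>. \<xi> \<in> X \<Longrightarrow> gain n \<omega> \<xi> \<le> gain n \<omega> (est n \<omega>) + n * A n \<omega>" by auto
        define u where "u = score n \<omega>"
        define x where "x = scaled_error n \<omega>"
        define w where "w = L *v u"
        have u: "norm u \<le> R" using \<omega>(1) R by (simp add: u_def)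
        have x: "norm x \<le> R" using \<omega>(3) R by (simp add: x_def)
        have "norm w \<le> NL * norm u" unfolding w_def by (rule NL)
        also have "\<dots> \<le> NL * R1" using \<omega>(1) NL(1) by (intro mult_left_mono) (auto simp: u_def)
        finally have w: "norm w \<le> R" using R by linarith
        have nx: "norm (est n \<omega> - \<xi>0) = norm x / sqrt n" using sn by (simp add: x_def)
        have estR: "norm (est n \<omega> - \<xi>0) \<le> R / sqrt n" unfolding nx using x sn by (simp add: divide_right_mono)
        have "norm (est n \<omega> - \<xi>0) < \<delta>2" using estR R_rad \<delta> by linarith
        from \<delta>2(2)[rule_format, OF est_X[OF n \<omega>s] this] obtain \<tau>0 where \<tau>0: "\<tau>0 \<in> T" "norm (est n \<omega> - \<xi>0 - \<tau>0) \<le> \<kappa> * norm (est n \<omega> - \<xi>0)" by blast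
        define \<tau> where "\<tau> = sqrt n *\<^sub>R \<tau>0"
        have \<tau>T: "\<tau> \<in> T" using \<tau>0 T by (simp add: \<tau>_def subspace_scale)
        have "x - \<tau> = sqrt n *\<^sub>R (est n \<omega> - \<xi>0 - \<tau>0)" by (simp add: x_def \<tau>_def algebra_simps)
        then have "norm (x - \<tau>) = sqrt n * norm (est n \<omega> - \<xi>0 - \<tau>0)" using sn by simp
        also have "\<dots> \<le> sqrt n * (\<kappa> * (norm x / sqrt n))" using \<tau>0(2) sn unfolding nx by (intro mult_left_mono) auto
        also have "\<dots> = \<kappa> * norm x" using sn by simp
        also have "\<dots> \<le> \<kappa> * R" using x \<kappa> by (intro mult_left_mono) auto
        finally have \<tau>: "norm (x - \<tau>) \<le> \<kappa> * R" .
        \<comment> \<open>The maximiser on the original scale. It is short enough to be approximated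
          by \<xi>0-increments of admissible points, and the point found there is a competitor that
          the estimator must match up to slack.\<close>
        define w0 where "w0 = (1 / sqrt n) *\<^sub>R w"
        have w0T: "w0 \<in> T" using L(1) T by (simp add: w0_def w_def subspace_scale)
        have nw0: "norm w0 = norm w / sqrt n" using sn by (simp add: w0_def)
        have "norm w0 \<le> R / sqrt n" unfolding nw0 using w sn by (simp add: divide_right_mono)
        then have "norm w0 < \<delta>3" using R_rad \<delta> by linarith
        from \<delta>3(2)[rule_format, OF w0T this] obtain \<xi> where \<xi>: "\<xi> \<in> X" "norm (\<xi> - \<xi>0 - w0) \<le> \<kappa> * norm w0" by blast
        define y where "y = sqrt n *\<^sub>R (\<xi> - \<xi>0)"
        have "y - w = sqrt n *\<^sub>R (\<xi> - \<xi>0 - w0)" using sn by (simp add: y_def w0_def algebra_simps)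
        then have "norm (y - w) = sqrt n * norm (\<xi> - \<xi>0 - w0)" using sn by simp
        also have "\<dots> \<le> sqrt n * (\<kappa> * (norm w / sqrt n))" using \<xi>(2) sn unfolding nw0 by (intro mult_left_mono) auto
        also have "\<dots> = \<kappa> * norm w" using sn by simp
        also have "\<dots> \<le> \<kappa> * R" using w \<kappa> by (intro mult_left_mono) auto
        finally have y: "norm (y - w) \<le> \<kappa> * R" .
        have "\<kappa> * R \<le> R" using \<kappa>(2) R mult_right_mono[of \<kappa> 1 R] by simp
        then have ny: "norm y \<le> 2 * R" using norm_triangle_ineq[of "y - w" w] y w by simp
        have n\<xi>: "norm (\<xi> - \<xi>0) = norm y / sqrt n" using sn by (simp add: y_def)
        have \<xi>R: "norm (\<xi> - \<xi>0) \<le> 2 * R / sqrt n" unfolding n\<xi> using ny sn by (simp add: divide_right_mono)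
        have W\<xi>: "fluct n \<omega> \<xi> \<le> \<kappa>"
          using \<omega>(4) \<xi>R by (simp add: W_def dist_norm norm_minus_commute)
        have "norm (est n \<omega> - \<xi>0) \<le> 2 * R / sqrt n" using estR R sn by (auto intro!: order.trans[OF estR] divide_right_mono)
        then have We: "fluct n \<omega> (est n \<omega>) \<le> \<kappa>"
          using \<omega>(4) by (simp add: W_def dist_norm norm_minus_commute)
        have "norm (\<xi> - \<xi>0) \<le> \<delta>1" using \<xi>R rad \<delta> by linarith
        from \<delta>1(2)[OF n this W\<xi>] have g1: "\<bar>gain n \<omega> \<xi> - quad u y\<bar> \<le> \<kappa> + \<kappa> * (norm y)\<^sup>2" by (simp add: u_def y_def)
        have "norm (est n \<omega> - \<xi>0) \<le> \<delta>1" using estR R_rad \<delta> by linarith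
        from \<delta>1(2)[OF n this We] have g2: "\<bar>gain n \<omega> (est n \<omega>) - quad u x\<bar> \<le> \<kappa> + \<kappa> * (norm x)\<^sup>2" by (simp add: u_def x_def)
        have "\<kappa> * (norm y)\<^sup>2 \<le> \<kappa> * (2 * R)\<^sup>2" "\<kappa> * (norm x)\<^sup>2 \<le> \<kappa> * R\<^sup>2"
          using ny x \<kappa>(1) by (intro mult_left_mono power_mono; simp)+
        with g1 g2 \<omega>(5)[OF \<xi>(1)] \<omega>(2) have "quad u y \<le> quad u x + (3 * \<kappa> + \<kappa> * (2 * R)\<^sup>2 + \<kappa> * R\<^sup>2)" by linarith
        also have "3 * \<kappa> + \<kappa> * (2 * R)\<^sup>2 + \<kappa> * R\<^sup>2 = \<kappa> * K" by (simp add: K_def power_mult_distrib algebra_simps)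
        finally have max: "quad u y \<le> quad u x + \<kappa> * K" .
        have "c / 2 * (norm (\<tau> - w))\<^sup>2 \<le> \<kappa> * (K + 2 * R * (2 * N * R + R))"
          using quadratic_argmax_perturbation[OF V_sym V_neg N(2) less_imp_le[OF N(1)] T L(1)[of u] L(2), of R x \<kappa> \<tau> y K]
            u x w \<kappa> \<tau>T \<tau> y max unfolding w_def quad_def by simp
        then have "c / 2 * (norm (\<tau> - w))\<^sup>2 \<le> c / 2 * (\<epsilon> / 2)\<^sup>2" using \<kappa>K by (simp add: K1_def)
        then have "(norm (\<tau> - w))\<^sup>2 \<le> (\<epsilon> / 2)\<^sup>2" using c by simp
        then have "norm (\<tau> - w) \<le> \<epsilon> / 2" using \<epsilon> by (simp add: power2_le_iff_abs_le)
        then have "norm (x - w) \<le> \<epsilon>" using norm_triangle_ineq[of "x - \<tau>" "\<tau> - w"] \<tau> \<kappa>R by simp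
        then show "norm (scaled_error n \<omega> - L *v score n \<omega>) \<le> \<epsilon>" by (simp add: x_def w_def u_def)
      qed simp
    qed
  qed
  have "(\<lambda>\<omega>. (scaled_error n \<omega> - L *v score n \<omega>) /\<^sub>R 1) \<in> borel_measurable \<Omega>" for n by measurable
  from Om.converges_in_probability_iff[OF this, where l = 0] main show ?thesis
    by (simp add: small_o_p_def)
qed

end

section \<open>Multivariate normal laws\<close>

lemma inner_matrix_axis: "axis i 1 \<bullet> (\<Gamma> *v axis j 1) = \<Gamma> $ i $ j" for \<Gamma> :: "real^'p^'p"
  by (simp add: inner_axis' matrix_vector_mult_basis column_def)

text \<open>Gaussian elimination: subtracting \<open>(\<Gamma> e\<^sub>i)(\<Gamma> e\<^sub>i)\<^sup>T / \<Gamma>\<^sub>i\<^sub>i\<close> keeps a matrix positive semidefinite and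
  clears one diagonal entry; a positive semidefinite matrix with zero diagonal vanishes.\<close>

lemma psd_sum_of_squares_aux:
  fixes \<Gamma> :: "real^'p^'p"
  assumes "finite I" "transpose \<Gamma> = \<Gamma>" "\<And>t. t \<bullet> (\<Gamma> *v t) \<ge> 0" "\<And>i. i \<notin> I \<Longrightarrow> \<Gamma> $ i $ i = 0"
  shows "\<exists>v :: 'p \<Rightarrow> real^'p. \<forall>t. t \<bullet> (\<Gamma> *v t) = (\<Sum>i\<in>I. (t \<bullet> v i)\<^sup>2)"
  using assms
proof (induction I arbitrary: \<Gamma> rule: finite_induct)
  case empty
  have "\<Gamma> $ i $ j = 0" for i j
    using psd_cauchy_schwarz(2)[OF empty(1,2), of "axis i 1" "axis j 1"] empty(3) by (simp add: inner_matrix_axis)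
  then have "\<Gamma> = 0" by (simp add: vec_eq_iff)
  then show ?case by simp
next
  case (insert i I)
  let ?g = "\<Gamma> $ i $ i"
  show ?case
  proof (cases "?g = 0")
    case True
    then have "j \<notin> I \<Longrightarrow> \<Gamma> $ j $ j = 0" for j using insert.prems(3)[of j] by (cases "j = i") auto
    with insert.IH[OF insert.prems(1,2)] obtain v where v: "\<forall>t. t \<bullet> (\<Gamma> *v t) = (\<Sum>i\<in>I. (t \<bullet> v i)\<^sup>2)" by blast
    have "(\<Sum>j\<in>I. (t \<bullet> (v(i := 0)) j)\<^sup>2) = (\<Sum>j\<in>I. (t \<bullet> v j)\<^sup>2)" for t
      using insert.hyps by (intro sum.cong) auto
    then show ?thesis using v insert.hyps by (intro exI[of _ "v(i := 0)"]) simp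
  next
    case False
    then have g: "?g > 0" using insert.prems(2)[of "axis i 1"] by (simp add: inner_matrix_axis)
    define w where "w = \<Gamma> *v axis i 1"
    have w: "w $ j = \<Gamma> $ j $ i" for j by (simp add: w_def matrix_vector_mult_basis column_def)
    define \<Gamma>' :: "real^'p^'p" where "\<Gamma>' = (\<chi> a b. \<Gamma> $ a $ b - w $ a * w $ b / ?g)"
    have q: "t \<bullet> (\<Gamma>' *v t) = t \<bullet> (\<Gamma> *v t) - (t \<bullet> w)\<^sup>2 / ?g" for t
    proof -
      have "(\<Gamma>' *v t) $ k = (\<Gamma> *v t) $ k - w $ k * (w \<bullet> t) / ?g" for k
        by (simp add: \<Gamma>'_def matrix_vector_mult_def inner_vec_def left_diff_distrib sum_subtractf
            sum_distrib_left sum_divide_distrib mult.assoc)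
      then have "\<Gamma>' *v t = \<Gamma> *v t - ((w \<bullet> t) / ?g) *\<^sub>R w" by (simp add: vec_eq_iff mult.commute)
      then show ?thesis by (simp add: inner_diff_right power2_eq_square inner_commute)
    qed
    have sym': "transpose \<Gamma>' = \<Gamma>'"
    proof -
      have "\<Gamma> $ a $ b = \<Gamma> $ b $ a" for a b using arg_cong[OF insert.prems(1), of "\<lambda>A. A $ b $ a"] by (simp add: transpose_def)
      then show ?thesis by (simp add: \<Gamma>'_def transpose_def vec_eq_iff mult.commute)
    qed
    have psd': "t \<bullet> (\<Gamma>' *v t) \<ge> 0" for t
      using psd_cauchy_schwarz(1)[OF insert.prems(1,2), of "axis i 1" t] g by (simp add: q inner_matrix_axis w_def)
    \<comment> \<open>Elimination at \<open>i\<close> cannot spoil another index outside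
      \<open>I\<close>: its entry becomes 0 minus a nonnegative term, yet must stay
      nonnegative.\<close>
    have diag': "\<Gamma>' $ j $ j = 0" if "j \<notin> I" for j
    proof (cases "j = i")
      case True then show ?thesis using g w by (simp add: \<Gamma>'_def)
    next
      case False
      then have "\<Gamma> $ j $ j = 0" using that insert.prems(3) by auto
      moreover have "\<Gamma>' $ j $ j \<ge> 0" using psd'[of "axis j 1"] by (simp add: inner_matrix_axis)
      moreover have "w $ j * w $ j / ?g \<ge> 0" using g by simp
      ultimately show ?thesis by (simp add: \<Gamma>'_def)
    qed
    from insert.IH[OF sym' psd' diag'] obtain v where v: "\<forall>t. t \<bullet> (\<Gamma>' *v t) = (\<Sum>i\<in>I. (t \<bullet> v i)\<^sup>2)" by blast
    define u where "u = (1 / sqrt ?g) *\<^sub>R w"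
    have "(t \<bullet> u)\<^sup>2 = (t \<bullet> w)\<^sup>2 / ?g" for t using g by (simp add: u_def power_divide)
    moreover have "(\<Sum>j\<in>I. (t \<bullet> (v(i := u)) j)\<^sup>2) = (\<Sum>j\<in>I. (t \<bullet> v j)\<^sup>2)" for t
      using insert.hyps by (intro sum.cong) auto
    ultimately have "\<forall>t. t \<bullet> (\<Gamma> *v t) = (\<Sum>j\<in>insert i I. (t \<bullet> (v(i := u)) j)\<^sup>2)"
      using v q insert.hyps by (simp add: field_simps)
    then show ?thesis by blast
  qed
qed

lemma std_normal_scaled:
  assumes "s > 0"
  shows "density lborel (normal_density 0 s) = distr std_normal_distribution borel (\<lambda>x. s * x)"
proof -
  interpret prob_space std_normal_distribution using prob_space_normal_density[of 1 0] by simp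
  have "distributed std_normal_distribution lborel (\<lambda>x. x) (normal_density 0 1)"
    by (auto simp: distributed_def distr_id2)
  from normal_density_affine[OF this, of s 0] assms
  have "distributed std_normal_distribution lborel (\<lambda>x. s * x) (normal_density 0 s)" by simp
  then show ?thesis by (simp add: distributed_distr_eq_density[symmetric] cong: distr_cong)
qed

text \<open>The law is the image of independent standard normals under the linear map with columns
  \<open>v i\<close>. The decomposition into squares says exactly that
  \<open>t \<bullet> X y\<close> has variance \<open>t \<bullet> (\<Gamma> *v t)\<close>.\<close>

lemma multivariate_normal_exists:
  fixes \<Gamma> :: "real^'p^'p"
  assumes sym: "transpose \<Gamma> = \<Gamma>" and psd: "\<And>t. t \<bullet> (\<Gamma> *v t) \<ge> 0"
  shows "\<exists>\<mu>. multivariate_normal 0 \<Gamma> \<mu>"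
proof -
  obtain v :: "'p \<Rightarrow> real^'p" where v: "\<And>t. t \<bullet> (\<Gamma> *v t) = (\<Sum>i\<in>UNIV. (t \<bullet> v i)\<^sup>2)"
    using psd_sum_of_squares_aux[OF finite_class.finite_UNIV sym psd] by auto
  have ps: "prob_space std_normal_distribution" using prob_space_normal_density[of 1 0] by simp
  define N where "N = Pi\<^sub>M (UNIV :: 'p set) (\<lambda>_. std_normal_distribution)"
  interpret N: prob_space N unfolding N_def by (intro prob_space_PiM ps)
  have comp[measurable]: "(\<lambda>y. y i) \<in> borel_measurable N" for i
    unfolding N_def using measurable_component_singleton[of i UNIV "\<lambda>_. std_normal_distribution"] by simp
  define X where "X y = (\<Sum>i\<in>UNIV. y i *\<^sub>R v i)" for y :: "'p \<Rightarrow> real"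
  have X[measurable]: "X \<in> borel_measurable N" unfolding X_def[abs_def] by measurable
  define \<mu> where "\<mu> = distr N borel X"
  have indep: "N.indep_vars (\<lambda>_. borel) (\<lambda>i y. y i) UNIV"
  proof (subst N.indep_vars_iff_distr_eq_PiM)
    have eq: "distr N borel (\<lambda>y. y i) = std_normal_distribution" for i
    proof -
      have "distr N std_normal_distribution (\<lambda>y. y i) = std_normal_distribution"
        unfolding N_def by (intro distr_PiM_component ps) auto
      then show ?thesis by (metis distr_cong sets_density sets_lborel)
    qed
    have "sets (Pi\<^sub>M UNIV (\<lambda>_::'p. borel)) = sets N"
      unfolding N_def by (intro sets_PiM_cong) auto
    then have d: "distr N (Pi\<^sub>M UNIV (\<lambda>_::'p. borel :: real measure)) (\<lambda>y. y) = N" by (simp add: distr_id2)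
    show "distr N (Pi\<^sub>M UNIV (\<lambda>_. borel)) (\<lambda>x. \<lambda>i\<in>UNIV. x i) = Pi\<^sub>M UNIV (\<lambda>i. distr N borel (\<lambda>x. x i))"
      unfolding eq restrict_UNIV d by (rule N_def)
  qed auto
  have dist_comp: "distributed N lborel (\<lambda>y. y i) (normal_density 0 1)" for i
  proof -
    have "distr N std_normal_distribution (\<lambda>y. y i) = std_normal_distribution"
      unfolding N_def by (intro distr_PiM_component ps) auto
    then have "distr N lborel (\<lambda>y. y i) = std_normal_distribution" by (metis distr_cong sets_density)
    then show ?thesis by (auto simp: distributed_def)
  qed
  have "distr \<mu> borel (\<lambda>x. t \<bullet> x) =
          (if t \<bullet> (\<Gamma> *v t) = 0 then return borel (t \<bullet> 0)
           else density lborel (normal_density (t \<bullet> 0) (sqrt (t \<bullet> (\<Gamma> *v t)))))" for t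
  proof -
    \<comment> \<open>Terms with coefficient 0 are dropped, since the rule for sums of independent
      normals wants positive deviations. If nothing is left the law is the point mass at 0.\<close>
    define J where "J = {i. t \<bullet> v i \<noteq> 0}"
    have d: "distr \<mu> borel (\<lambda>x. t \<bullet> x) = distr N borel (\<lambda>y. \<Sum>i\<in>J. (t \<bullet> v i) * y i)"
    proof -
      have "distr \<mu> borel (\<lambda>x. t \<bullet> x) = distr N borel (\<lambda>y. t \<bullet> X y)"
        unfolding \<mu>_def by (subst distr_distr) (auto simp: comp_def)
      also have "(\<lambda>y. t \<bullet> X y) = (\<lambda>y. \<Sum>i\<in>J. (t \<bullet> v i) * y i)"
        by (auto simp: X_def inner_sum_right J_def mult.commute fun_eq_iff intro!: sum.mono_neutral_right)
      finally show ?thesis .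
    qed
    have s: "t \<bullet> (\<Gamma> *v t) = (\<Sum>i\<in>J. (t \<bullet> v i)\<^sup>2)"
      unfolding v by (rule sum.mono_neutral_right) (auto simp: J_def)
    show ?thesis
    proof (cases "J = {}")
      case True
      have "distr N borel (\<lambda>y. 0::real) = return borel 0"
        by (rule measure_eqI) (auto simp: emeasure_distr indicator_def N.emeasure_space_1 vimage_def split: if_splits)
      then show ?thesis using True by (simp add: d s)
    next
      case False
      have pos: "t \<bullet> (\<Gamma> *v t) > 0" unfolding s using False by (intro sum_pos) (auto simp: J_def)
      have ind: "N.indep_vars (\<lambda>_. borel) (\<lambda>i y. (t \<bullet> v i) * y i) J"
        using N.indep_vars_compose2[OF N.indep_vars_subset[OF indep, of J], of "\<lambda>i x. (t \<bullet> v i) * x" "\<lambda>_. borel"] by simp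
      have nd: "distributed N lborel (\<lambda>y. (t \<bullet> v i) * y i) (normal_density 0 \<bar>t \<bullet> v i\<bar>)" if "i \<in> J" for i
        using N.normal_density_affine[OF dist_comp[of i], of "t \<bullet> v i" 0] that by (simp add: J_def)
      have "distributed N lborel (\<lambda>y. \<Sum>i\<in>J. (t \<bullet> v i) * y i) (normal_density (\<Sum>i\<in>J. 0) (sqrt (\<Sum>i\<in>J. \<bar>t \<bullet> v i\<bar>\<^sup>2)))"
        by (rule N.sum_indep_normal[OF _ False ind _ nd]) (auto simp: J_def)
      then have "distr N lborel (\<lambda>y. \<Sum>i\<in>J. (t \<bullet> v i) * y i) = density lborel (normal_density 0 (sqrt (t \<bullet> (\<Gamma> *v t))))"
        by (simp add: distributed_distr_eq_density s)
      moreover have "distr N borel (\<lambda>y. \<Sum>i\<in>J. (t \<bullet> v i) * y i) = distr N lborel (\<lambda>y. \<Sum>i\<in>J. (t \<bullet> v i) * y i)"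
        by (rule distr_cong) auto
      ultimately show ?thesis using pos by (simp add: d)
    qed
  qed
  then have "multivariate_normal 0 \<Gamma> \<mu>"
    unfolding multivariate_normal_def using sym psd N.prob_space_distr[OF X] by (simp add: \<mu>_def)
  then show ?thesis by blast
qed

section \<open>Convergence in distribution by trigonometric polynomials\<close>

text \<open>The phase \<open>b\<close> covers sines and \<open>t = 0\<close> covers constants. The
  class is closed under products, and its integrals are determined by the characteristic
  function.\<close>

inductive trig :: "(real^'p \<Rightarrow> real) \<Rightarrow> bool" where
  trig_cos: "trig (\<lambda>x. a * cos (t \<bullet> x + b))"
| trig_add: "trig f \<Longrightarrow> trig g \<Longrightarrow> trig (\<lambda>x. f x + g x)"

lemma trig_mult_cos: "trig f \<Longrightarrow> trig (\<lambda>x. f x * (a * cos (t \<bullet> x + b)))"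
proof (induction rule: trig.induct)
  case (trig_cos a' t' b')
  have prod: "a' * cos w * (a * cos z) = (a' * a / 2) * cos (w - z) + (a' * a / 2) * cos (w + z)" for w z :: real
    by (simp add: cos_diff cos_add algebra_simps)
  have "(\<lambda>x. a' * cos (t' \<bullet> x + b') * (a * cos (t \<bullet> x + b))) =
    (\<lambda>x. (a' * a / 2) * cos ((t' - t) \<bullet> x + (b' - b)) + (a' * a / 2) * cos ((t' + t) \<bullet> x + (b' + b)))"
  proof
    fix x
    have "(t' - t) \<bullet> x + (b' - b) = (t' \<bullet> x + b') - (t \<bullet> x + b)" "(t' + t) \<bullet> x + (b' + b) = (t' \<bullet> x + b') + (t \<bullet> x + b)"
      by (simp_all add: inner_diff_left inner_add_left)
    then show "a' * cos (t' \<bullet> x + b') * (a * cos (t \<bullet> x + b)) =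
      (a' * a / 2) * cos ((t' - t) \<bullet> x + (b' - b)) + (a' * a / 2) * cos ((t' + t) \<bullet> x + (b' + b))"
      by (simp only: prod)
  qed
  then show ?case by (simp only: trig.trig_add trig.trig_cos)
next
  case (trig_add f g)
  then show ?case using trig.trig_add[OF trig_add.IH] by (simp add: distrib_right)
qed

lemma trig_mult: "trig g \<Longrightarrow> trig f \<Longrightarrow> trig (\<lambda>x. f x * g x)"
proof (induction rule: trig.induct)
  case (trig_cos a t b) then show ?case by (rule trig_mult_cos)
next
  case (trig_add g1 g2)
  then show ?case using trig.trig_add[OF trig_add.IH(1,2)] by (simp add: distrib_left)
qed

lemma trig_const: "trig (\<lambda>_. c)"
  using trig_cos[of c 0 0] by simp

lemma trig_bounded_continuous: "trig f \<Longrightarrow> continuous_on UNIV f \<and> (\<exists>C. \<forall>x. \<bar>f x\<bar> \<le> C)"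
proof (induction rule: trig.induct)
  case (trig_cos a t b)
  have "\<bar>a * cos (t \<bullet> x + b)\<bar> \<le> \<bar>a\<bar>" for x using mult_left_mono[OF abs_cos_le_one, of "\<bar>a\<bar>"] by (simp add: abs_mult)
  then show ?case by (auto intro!: continuous_intros)
next
  case (trig_add f g)
  then obtain C D where "\<forall>x. \<bar>f x\<bar> \<le> C" "\<forall>x. \<bar>g x\<bar> \<le> D" by blast
  then have "\<bar>f x + g x\<bar> \<le> C + D" for x using abs_triangle_ineq[of "f x" "g x"] by (meson add_mono order.trans)
  then show ?case using trig_add.IH by (auto intro!: continuous_intros)
qed

text \<open>On the cube of side \<open>2 * L\<close> the map \<open>E\<close> winds every coordinate
  around a circle, and \<open>f\<close> factors through it because \<open>f\<close> vanishes
  wherever \<open>E\<close> glues points together. Stone-Weierstrass on the compact image yields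
  \<open>g\<close>, and periodicity of \<open>g \<circ> E\<close> extends its bound to the whole
  space, as is needed for the tails.\<close>

lemma trig_approximation:
  fixes f :: "real^'p \<Rightarrow> real"
  assumes L: "L > 0" and cont: "continuous_on UNIV f" and bound: "\<And>x. \<bar>f x\<bar> \<le> C"
    and supp: "\<And>x. norm x \<ge> L \<Longrightarrow> f x = 0" and \<epsilon>: "\<epsilon> > 0"
  shows "\<exists>q. trig q \<and> (\<forall>x. norm x \<le> L \<longrightarrow> \<bar>f x - q x\<bar> \<le> \<epsilon>) \<and> (\<forall>x. \<bar>q x\<bar> \<le> C + \<epsilon>)"
proof -
  define k where "k = pi / L"
  have k: "k > 0" "k * L = pi" using L by (auto simp: k_def)
  define E :: "real^'p \<Rightarrow> (real^'p) \<times> (real^'p)" where "E x = ((\<chi> i. cos (k * x $ i)), (\<chi> i. sin (k * x $ i)))" for x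
  define Q :: "(real^'p) set" where "Q = cbox (\<chi> i. - L) (\<chi> i. L)"
  have Q: "x \<in> Q \<longleftrightarrow> (\<forall>i. - L \<le> x $ i \<and> x $ i \<le> L)" for x by (simp add: Q_def mem_box_cart)
  have Ec: "continuous_on A E" for A unfolding E_def
    by (intro continuous_on_Pair continuous_on_vec_lambda continuous_intros)
  define K where "K = E ` Q"
  have K: "compact K" unfolding K_def Q_def by (intro compact_continuous_image Ec compact_cbox)
  \<comment> \<open>A nonzero multiple of the period \<open>2 * L\<close> fits into the cube only
    between opposite faces, and points on the faces have norm at least \<open>L\<close>.\<close>
  have fE: "f x = f y" if x: "x \<in> Q" and y: "y \<in> Q" and eq: "E x = E y" for x y
  proof (cases "x = y")
    case False
    then obtain i where i: "x $ i \<noteq> y $ i" by (auto simp: vec_eq_iff)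
    from eq have "sin (k * x $ i) = sin (k * y $ i) \<and> cos (k * x $ i) = cos (k * y $ i)"
      by (auto simp: E_def vec_eq_iff)
    then obtain n :: int where "k * x $ i = k * y $ i + 2 * pi * n" using sin_cos_eq_iff by blast
    then have "k * x $ i = k * (y $ i + 2 * L * n)" using k(2) by (simp add: algebra_simps)
    then have n: "x $ i = y $ i + 2 * L * n" using k by simp
    have "n \<noteq> 0" using i n by auto
    have ends: "- L \<le> x $ i" "x $ i \<le> L" "- L \<le> y $ i" "y $ i \<le> L" using x y by (auto simp: Q)
    have "\<bar>x $ i\<bar> = L \<and> \<bar>y $ i\<bar> = L"
    proof (cases "n > 0")
      case True
      then have "2 * L * 1 \<le> 2 * L * n" using L by (intro mult_left_mono) auto
      then have "x $ i = L" "y $ i = - L" using n ends by linarith+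
      then show ?thesis using L by simp
    next
      case neg: False
      then have "2 * L * n \<le> 2 * L * (-1)" using \<open>n \<noteq> 0\<close> L by (intro mult_left_mono) auto
      then have "x $ i = - L" "y $ i = L" using n ends by linarith+
      then show ?thesis using L by simp
    qed
    then have "norm x \<ge> L" "norm y \<ge> L" using component_le_norm_cart[of x i] component_le_norm_cart[of y i] by auto
    then show ?thesis using supp by simp
  qed simp
  define F where "F z = f (SOME x. x \<in> Q \<and> E x = z)" for z
  have F: "F (E x) = f x" if "x \<in> Q" for x
    unfolding F_def
  proof (rule someI2[of _ x])
    show "x \<in> Q \<and> E x = E x" using that by simp
    show "f y = f x" if "y \<in> Q \<and> E y = E x" for y using that \<open>x \<in> Q\<close> by (intro fE) auto
  qed
  \<comment> \<open>Preimages of closed sets under \<open>F\<close> are images of compact sets under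
    \<open>E\<close>; the chosen preimage itself need not depend continuously on the point.\<close>
  have Fc: "continuous_on K F"
    unfolding continuous_on_closed_vimage[OF compact_imp_closed[OF K]]
  proof (intro allI impI)
    fix B :: "real set" assume B: "closed B"
    have "F -` B \<inter> K = E ` (Q \<inter> f -` B)" using F by (auto simp: K_def)
    moreover have "closed (f -` B)"
      using continuous_on_closed_vimage[OF closed_UNIV, THEN iffD1, OF cont] B by simp
    then have "compact (Q \<inter> f -` B)" unfolding Q_def by (intro compact_Int_closed compact_cbox)
    then have "closed (E ` (Q \<inter> f -` B))" by (intro compact_imp_closed compact_continuous_image Ec)
    ultimately show "closed (F -` B \<inter> K)" by simp
  qed
  define RR where "RR = {g. continuous_on K g \<and> trig (g \<circ> E)}"
  interpret function_ring_on RR K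
  proof
    show "compact K" by (rule K)
    fix g1 assume "g1 \<in> RR" then show "continuous_on K g1" by (simp add: RR_def)
  next
    fix g1 g2 assume "g1 \<in> RR" "g2 \<in> RR"
    then have g: "continuous_on K g1" "continuous_on K g2" "trig (g1 \<circ> E)" "trig (g2 \<circ> E)" by (auto simp: RR_def)
    have "trig ((\<lambda>x. g1 x + g2 x) \<circ> E)" using trig_add[OF g(3,4)] by (simp add: comp_def)
    then show "(\<lambda>x. g1 x + g2 x) \<in> RR" using continuous_on_add[OF g(1,2)] by (simp add: RR_def)
    have "trig ((\<lambda>x. g1 x * g2 x) \<circ> E)" using trig_mult[OF g(4,3)] by (simp add: comp_def)
    then show "(\<lambda>x. g1 x * g2 x) \<in> RR" using continuous_on_mult[OF g(1,2)] by (simp add: RR_def)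
  next
    fix c show "(\<lambda>_. c) \<in> RR" using trig_const[of c] by (simp add: RR_def comp_def)
  next
    fix z w :: "(real^'p) \<times> (real^'p)" assume "z \<noteq> w"
    then have "(\<exists>i. fst z $ i \<noteq> fst w $ i) \<or> (\<exists>i. snd z $ i \<noteq> snd w $ i)"
      by (auto simp: prod_eq_iff vec_eq_iff)
    then show "\<exists>g\<in>RR. g z \<noteq> g w"
    proof (elim disjE exE)
      fix i assume i: "fst z $ i \<noteq> fst w $ i"
      have "(\<lambda>z :: (real^'p) \<times> (real^'p). fst z $ i) \<circ> E = (\<lambda>x. 1 * cos ((k *\<^sub>R axis i 1) \<bullet> x + 0))"
        by (simp add: E_def fun_eq_iff inner_axis')
      then have "trig ((\<lambda>z. fst z $ i) \<circ> E)" by (simp only: trig.trig_cos)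
      moreover have "continuous_on K (\<lambda>z. fst z $ i)" by (intro continuous_intros)
      ultimately have "(\<lambda>z. fst z $ i) \<in> RR" by (simp add: RR_def)
      then show ?thesis using i by (intro bexI[of _ "\<lambda>z. fst z $ i"])
    next
      fix i assume i: "snd z $ i \<noteq> snd w $ i"
      have "(\<lambda>z :: (real^'p) \<times> (real^'p). snd z $ i) \<circ> E = (\<lambda>x. 1 * cos ((k *\<^sub>R axis i 1) \<bullet> x + (- pi / 2)))"
        by (simp add: E_def fun_eq_iff inner_axis' cos_diff)
      then have "trig ((\<lambda>z. snd z $ i) \<circ> E)" by (simp only: trig.trig_cos)
      moreover have "continuous_on K (\<lambda>z. snd z $ i)" by (intro continuous_intros)
      ultimately have "(\<lambda>z. snd z $ i) \<in> RR" by (simp add: RR_def)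
      then show ?thesis using i by (intro bexI[of _ "\<lambda>z. snd z $ i"])
    qed
  qed
  obtain g where g: "g \<in> RR" "\<And>z. z \<in> K \<Longrightarrow> \<bar>F z - g z\<bar> < \<epsilon>"
    using Stone_Weierstrass_basic[OF Fc \<epsilon>] by blast
  \<comment> \<open>Reduction modulo the period \<open>2 * L\<close>, by which the bound on
    \<open>g\<close> reaches every point.\<close>
  have red: "\<exists>y\<in>Q. E x = E y" for x
  proof
    define n where "n i = \<lfloor>(x $ i + L) / (2 * L)\<rfloor>" for i
    let ?y = "(\<chi> i. x $ i - 2 * L * n i) :: real^'p"
    have "0 \<le> (x $ i + L) / (2 * L) - n i" "(x $ i + L) / (2 * L) - n i \<le> 1" for i unfolding n_def by linarith+
    then show "?y \<in> Q" using L by (simp add: Q field_simps)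
    have "cos (k * ?y $ i) = cos (k * x $ i) \<and> sin (k * ?y $ i) = sin (k * x $ i)" for i
    proof -
      have "k * x $ i = k * ?y $ i + 2 * pi * n i" using k(2) by (simp add: algebra_simps)
      then have "sin (k * x $ i) = sin (k * ?y $ i) \<and> cos (k * x $ i) = cos (k * ?y $ i)"
        unfolding sin_cos_eq_iff by blast
      then show ?thesis by simp
    qed
    then show "E x = E ?y" by (simp add: E_def vec_eq_iff)
  qed
  show ?thesis
  proof (intro exI[of _ "g \<circ> E"] conjI allI impI)
    show "trig (g \<circ> E)" using g by (simp add: RR_def)
    show "\<bar>f x - (g \<circ> E) x\<bar> \<le> \<epsilon>" if "norm x \<le> L" for x
    proof -
      have "\<bar>x $ i\<bar> \<le> L" for i using that component_le_norm_cart[of x i] by linarith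
      then have "x \<in> Q" unfolding Q by (meson abs_le_D1 abs_le_D2 minus_le_iff)
      then show ?thesis using g(2)[of "E x"] F by (simp add: K_def)
    qed
    show "\<bar>(g \<circ> E) x\<bar> \<le> C + \<epsilon>" for x
    proof -
      obtain y where y: "y \<in> Q" "E x = E y" using red by blast
      have "\<bar>f y - g (E y)\<bar> < \<epsilon>" using g(2)[of "E y"] y F by (simp add: K_def)
      then show ?thesis using bound[of y] y by simp
    qed
  qed
qed

lemma (in prob_space) integral_diff_le_holds_up_to:
  fixes f g :: "'a \<Rightarrow> real"
  assumes "integrable M f" "integrable M g" and Q: "holds_up_to M e Q"
    and close: "\<And>\<omega>. \<omega> \<in> space M \<Longrightarrow> Q \<omega> \<Longrightarrow> \<bar>f \<omega> - g \<omega>\<bar> \<le> \<epsilon>"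
    and bound: "\<And>\<omega>. \<omega> \<in> space M \<Longrightarrow> \<bar>f \<omega> - g \<omega>\<bar> \<le> D" and "\<epsilon> \<ge> 0" "D \<ge> 0"
  shows "\<bar>(\<integral>\<omega>. f \<omega> \<partial>M) - (\<integral>\<omega>. g \<omega> \<partial>M)\<bar> \<le> \<epsilon> + D * e"
proof -
  from Q obtain B where B: "B \<in> sets M" "measure M B \<le> e" "\<forall>\<omega>\<in>space M - B. Q \<omega>"
    unfolding holds_up_to_def by blast
  have "\<bar>(\<integral>\<omega>. f \<omega> \<partial>M) - (\<integral>\<omega>. g \<omega> \<partial>M)\<bar> = \<bar>\<integral>\<omega>. f \<omega> - g \<omega> \<partial>M\<bar>" using assms(1,2) by simp
  also have "\<dots> \<le> (\<integral>\<omega>. \<bar>f \<omega> - g \<omega>\<bar> \<partial>M)" by (rule integral_abs_bound)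
  also have "\<dots> \<le> (\<integral>\<omega>. \<epsilon> + D * indicator B \<omega> \<partial>M)"
  proof (rule integral_mono)
    show "integrable M (\<lambda>\<omega>. \<bar>f \<omega> - g \<omega>\<bar>)" using assms(1,2) by simp
    show "integrable M (\<lambda>\<omega>. \<epsilon> + D * indicator B \<omega>)" using B(1) by (simp add: emeasure_eq_measure)
    fix \<omega> assume \<omega>: "\<omega> \<in> space M"
    show "\<bar>f \<omega> - g \<omega>\<bar> \<le> \<epsilon> + D * indicator B \<omega>"
    proof (cases "\<omega> \<in> B")
      case True then show ?thesis using bound[OF \<omega>] \<open>\<epsilon> \<ge> 0\<close> by simp
    next
      case False then show ?thesis using close[OF \<omega>] B(3) \<omega> by simp
    qed
  qed
  also have "\<dots> = \<epsilon> + D * measure M B" using B(1) by (simp add: prob_space emeasure_eq_measure)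
  also have "\<dots> \<le> \<epsilon> + D * e" using B(2) \<open>D \<ge> 0\<close> by (simp add: mult_left_mono)
  finally show ?thesis .
qed

lemma (in prob_space) integrable_bounded_continuous:
  fixes f :: "'b::{second_countable_topology, metric_space} \<Rightarrow> real"
  assumes "continuous_on UNIV f" "\<And>x. \<bar>f x\<bar> \<le> C" "Y \<in> borel_measurable M"
  shows "integrable M (\<lambda>\<omega>. f (Y \<omega>))"
  using assms by (intro integrable_const_bound[of _ C]) (auto intro: measurable_compose borel_measurable_continuous_onI)

lemma (in prob_space) holds_up_to_norm_bound:
  fixes Y :: "'a \<Rightarrow> 'b::{real_normed_vector, second_countable_topology}"
  assumes [measurable]: "Y \<in> borel_measurable M" and e: "e > 0"
  shows "\<exists>R. holds_up_to M e (\<lambda>\<omega>. norm (Y \<omega>) \<le> R)"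
proof -
  define B where "B n = {\<omega> \<in> space M. \<not> norm (Y \<omega>) \<le> real n}" for n :: nat
  have B: "B n \<in> sets M" for n unfolding B_def by measurable
  have "decseq B" by (auto simp: decseq_def B_def not_le)
  then have "(\<lambda>n. measure M (B n)) \<longlonglongrightarrow> measure M (\<Inter>n. B n)" using B by (intro finite_Lim_measure_decseq) auto
  moreover have "(\<Inter>n. B n) = {}"
  proof -
    have "\<omega> \<notin> (\<Inter>n. B n)" for \<omega> using real_arch_simple[of "norm (Y \<omega>)"] by (auto simp: B_def)
    then show ?thesis by blast
  qed
  ultimately have "\<forall>\<^sub>F n in sequentially. measure M (B n) < e" using e by (simp add: order_tendstoD(2))
  then obtain n where "measure M (B n) < e" by (auto dest: eventually_happens)
  then have "holds_up_to M e (\<lambda>\<omega>. norm (Y \<omega>) \<le> real n)" using B[of n] unfolding B_def by (intro holds_up_to_measure) auto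
  then show ?thesis by blast
qed

text \<open>A bounded continuous \<open>f\<close> is in general not a uniform limit of trigonometric
  polynomials. Tightness confines \<open>X n\<close> and the limit law to a ball up to small
  probability; the approximation takes place there, after a cutoff, and outside only the global
  bound on the approximant is used.\<close>

theorem converges_in_distribution_trig:
  fixes X :: "nat \<Rightarrow> 'w \<Rightarrow> real^'p"
  assumes Om: "prob_space \<Omega>" and X[measurable]: "\<And>n. X n \<in> borel_measurable \<Omega>"
    and mu: "prob_space \<mu>" "sets \<mu> = sets borel"
    and lim: "\<And>t b. (\<lambda>n. \<integral>\<omega>. cos (t \<bullet> X n \<omega> + b) \<partial>\<Omega>) \<longlonglongrightarrow> (\<integral>x. cos (t \<bullet> x + b) \<partial>\<mu>)"
    and tight: "\<And>e. e > 0 \<Longrightarrow> \<exists>R. \<forall>\<^sub>F n in sequentially. holds_up_to \<Omega> e (\<lambda>\<omega>. norm (X n \<omega>) \<le> R)"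
  shows "converges_in_distribution \<Omega> X \<mu>"
  unfolding converges_in_distribution_def
proof (intro conjI allI impI X)
  interpret Om: prob_space \<Omega> by (rule Om)
  interpret mu: prob_space \<mu> by (rule mu)
  have id[measurable]: "(\<lambda>x. x) \<in> borel_measurable \<mu>" using mu(2) by (simp add: measurable_ident_sets)
  have trig_int: "integrable \<Omega> (\<lambda>\<omega>. q (X n \<omega>))" "integrable \<mu> (\<lambda>x. q x)" if "trig q" for q n
    using trig_bounded_continuous[OF that] Om.integrable_bounded_continuous[of q _ "X n"]
      mu.integrable_bounded_continuous[of q _ "\<lambda>x. x"] X id by auto
  have trig_lim: "(\<lambda>n. \<integral>\<omega>. q (X n \<omega>) \<partial>\<Omega>) \<longlonglongrightarrow> (\<integral>x. q x \<partial>\<mu>)" if "trig q" for q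
    using that
  proof (induction rule: trig.induct)
    case (trig_cos a t b)
    show ?case using tendsto_mult_left[OF lim[of t b], of a] by simp
  next
    case (trig_add f g)
    then show ?case using tendsto_add[OF trig_add.IH] trig_int[OF trig_add.hyps(1)] trig_int[OF trig_add.hyps(2)] by simp
  qed
  fix f :: "real^'p \<Rightarrow> real" assume f: "continuous_on UNIV f" and "bounded (range f)"
  then obtain C where C: "C > 0" "\<And>x. \<bar>f x\<bar> \<le> C" unfolding bounded_pos by auto
  have f_int: "integrable \<Omega> (\<lambda>\<omega>. f (X n \<omega>))" "integrable \<mu> (\<lambda>x. f x)" for n
    using Om.integrable_bounded_continuous[OF f C(2)] mu.integrable_bounded_continuous[OF f C(2)] X id by auto
  show "(\<lambda>n. \<integral>\<omega>. f (X n \<omega>) \<partial>\<Omega>) \<longlonglongrightarrow> (\<integral>x. f x \<partial>\<mu>)"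
  proof (rule LIMSEQ_I)
    fix r :: real assume r: "r > 0"
    \<comment> \<open>Error budget: each of the two replacements of \<open>f\<close> by
      \<open>q\<close> costs at most \<open>\<epsilon> + r / 8\<close>, the convergence for
      \<open>q\<close> costs \<open>r / 8\<close>, in total at most
      \<open>5 * r / 8\<close>.\<close>
    define \<epsilon> where "\<epsilon> = min 1 (r / 8)"
    have \<epsilon>: "\<epsilon> > 0" "\<epsilon> \<le> 1" "\<epsilon> \<le> r / 8" using r by (auto simp: \<epsilon>_def)
    define e where "e = r / (8 * (2 * C + 1))"
    have e: "e > 0" using r C by (simp add: e_def)
    obtain R1 where R1: "\<forall>\<^sub>F n in sequentially. holds_up_to \<Omega> e (\<lambda>\<omega>. norm (X n \<omega>) \<le> R1)" using tight[OF e] by blast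
    obtain R2 where R2: "holds_up_to \<mu> e (\<lambda>x. norm x \<le> R2)" using mu.holds_up_to_norm_bound[OF id e] by blast
    define R where "R = max 0 (max R1 R2)"
    have R: "R \<ge> 0" "R1 \<le> R" "R2 \<le> R" by (auto simp: R_def)
    define cutoff where "cutoff x = max 0 (min 1 (R + 1 - norm x))" for x :: "real^'p"
    have cutoff: "0 \<le> cutoff x" "cutoff x \<le> 1" for x by (auto simp: cutoff_def)
    have 1: "R + 1 > 0" using R by simp
    have 2: "continuous_on UNIV (\<lambda>x. f x * cutoff x)" unfolding cutoff_def by (intro continuous_intros f)
    have 3: "\<bar>f x * cutoff x\<bar> \<le> C" for x
      using mult_mono[OF C(2)[of x] cutoff(2)[of x]] C(1) cutoff(1)[of x] by (simp add: abs_mult)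
    have 4: "f x * cutoff x = 0" if "norm x \<ge> R + 1" for x using that by (simp add: cutoff_def)
    obtain q where q: "trig q" "\<And>x. norm x \<le> R + 1 \<Longrightarrow> \<bar>f x * cutoff x - q x\<bar> \<le> \<epsilon>" "\<And>x. \<bar>q x\<bar> \<le> C + \<epsilon>"
      using trig_approximation[OF 1 2 3 4 \<epsilon>(1)] by blast
    have close: "\<bar>f x - q x\<bar> \<le> \<epsilon>" if "norm x \<le> R" for x using q(2)[of x] that by (simp add: cutoff_def)
    have far: "\<bar>f x - q x\<bar> \<le> 2 * C + 1" for x using C(2)[of x] q(3)[of x] \<epsilon> by linarith
    have D: "2 * C + 1 \<ge> 0" "(2 * C + 1) * e = r / 8" using C(1) by (auto simp: e_def divide_simps)
    have \<mu>q: "\<bar>(\<integral>x. f x \<partial>\<mu>) - (\<integral>x. q x \<partial>\<mu>)\<bar> \<le> \<epsilon> + (2 * C + 1) * e"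
      using R close far \<epsilon> D by (intro mu.integral_diff_le_holds_up_to[OF f_int(2) trig_int(2)[OF q(1)] R2]) auto
    have "\<forall>\<^sub>F n in sequentially. \<bar>(\<integral>\<omega>. q (X n \<omega>) \<partial>\<Omega>) - (\<integral>x. q x \<partial>\<mu>)\<bar> < r / 8"
      using tendstoD[OF trig_lim[OF q(1)], of "r / 8"] r by (simp add: dist_real_def)
    with R1 have "\<forall>\<^sub>F n in sequentially. norm ((\<integral>\<omega>. f (X n \<omega>) \<partial>\<Omega>) - (\<integral>x. f x \<partial>\<mu>)) < r"
    proof eventually_elim
      case (elim n)
      have "\<bar>(\<integral>\<omega>. f (X n \<omega>) \<partial>\<Omega>) - (\<integral>\<omega>. q (X n \<omega>) \<partial>\<Omega>)\<bar> \<le> \<epsilon> + (2 * C + 1) * e"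
        using R close far \<epsilon> D by (intro Om.integral_diff_le_holds_up_to[OF f_int(1) trig_int(1)[OF q(1)] elim(1)]) auto
      then show ?case using \<mu>q elim(2) \<epsilon>(3) D(2) r unfolding real_norm_def by linarith
    qed
    then show "\<exists>N. \<forall>n\<ge>N. norm ((\<integral>\<omega>. f (X n \<omega>) \<partial>\<Omega>) - (\<integral>x. f x \<partial>\<mu>)) < r" by (simp add: eventually_sequentially)
  qed
qed

text \<open>Scaling a standard normal by the deviation covers the degenerate case as well, scale 0
  being the point mass. It is also the form in which the central limit theorem produces the
  limit.\<close>

lemma multivariate_normal_trig:
  assumes \<mu>: "multivariate_normal 0 \<Gamma> \<mu>"
  shows "(\<integral>x. cos (t \<bullet> x + b) \<partial>\<mu>) = (\<integral>y. cos (sqrt (t \<bullet> (\<Gamma> *v t)) * y + b) \<partial>std_normal_distribution)"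
proof -
  interpret \<mu>: prob_space \<mu> using \<mu> by (simp add: multivariate_normal_def)
  interpret N: prob_space std_normal_distribution using prob_space_normal_density[of 1 0] by simp
  have N1: "measure std_normal_distribution UNIV = 1" using N.prob_space by simp
  have [measurable]: "(\<lambda>x. t \<bullet> x) \<in> borel_measurable \<mu>"
    using \<mu> by (simp add: multivariate_normal_def cong: measurable_cong_sets)
  have "(\<integral>x. cos (t \<bullet> x + b) \<partial>\<mu>) = (\<integral>y. cos (y + b) \<partial>(distr \<mu> borel (\<lambda>x. t \<bullet> x)))"
    by (subst integral_distr) auto
  also have "\<dots> = (\<integral>y. cos (sqrt (t \<bullet> (\<Gamma> *v t)) * y + b) \<partial>std_normal_distribution)"
  proof (cases "t \<bullet> (\<Gamma> *v t) = 0")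
    case True
    then have "distr \<mu> borel (\<lambda>x. t \<bullet> x) = return borel 0" using \<mu> by (simp add: multivariate_normal_def)
    then show ?thesis using True by (simp add: integral_return N1)
  next
    case False
    define s where "s = sqrt (t \<bullet> (\<Gamma> *v t))"
    have s: "s > 0" using False \<mu> by (simp add: s_def multivariate_normal_def order.not_eq_order_implies_strict)
    have "distr \<mu> borel (\<lambda>x. t \<bullet> x) = distr std_normal_distribution borel (\<lambda>x. s * x)"
      using \<mu> False std_normal_scaled[OF s] by (simp add: multivariate_normal_def s_def)
    then show ?thesis by (simp add: integral_distr s_def)
  qed
  finally show ?thesis .
qed

section \<open>Covariance and limit law of the score\<close>

context iid_lipschitz_criterion begin

definition score_covariance :: "real^'p^'p" where
  "score_covariance = (\<integral>z. outer_square (mdot z) \<partial>P)"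

lemma mdot_product_integrable: "integrable P (\<lambda>z. mdot z $ i * mdot z $ j)"
proof (rule Bochner_Integration.integrable_bound[OF mdot_square])
  have "\<bar>mdot z $ i\<bar> * \<bar>mdot z $ j\<bar> \<le> norm (mdot z) * norm (mdot z)" for z
    by (intro mult_mono component_le_norm_cart) auto
  then show "AE z in P. norm (mdot z $ i * mdot z $ j) \<le> norm ((norm (mdot z))\<^sup>2)"
    by (simp add: abs_mult power2_eq_square)
qed measurable

text \<open>Expansion in elementary matrices reduces integrability of the matrix to that of its
  entries.\<close>

lemma outer_square_integrable: "integrable P (\<lambda>z. outer_square (mdot z))"
proof -
  have "outer_square x = (\<Sum>i\<in>UNIV. \<Sum>j\<in>UNIV. (x $ i * x $ j) *\<^sub>R axis i (axis j 1))" for x :: "real^'p"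
  proof -
    have "(\<Sum>j\<in>UNIV. ((x $ i * x $ j) *\<^sub>R axis i (axis j 1)) $ k $ l) = (if k = i then x $ i * x $ l else 0)" for i k l :: 'p
      by (cases "k = i") (auto simp: axis_def if_distrib[of "\<lambda>v. _ * v"] cong: if_cong)
    then show ?thesis by (simp add: outer_square_def vec_eq_iff)
  qed
  then show ?thesis
    by (simp only:) (intro Bochner_Integration.integrable_sum integrable_scaleR_left mdot_product_integrable)
qed

lemma score_covariance_quadratic: "a \<bullet> (score_covariance *v a) = (\<integral>z. (a \<bullet> mdot z)\<^sup>2 \<partial>P)"
proof -
  have "linear (\<lambda>B :: real^'p^'p. a \<bullet> (B *v a))"
    by (intro linearI) (simp_all add: matrix_vector_mult_add_rdistrib inner_add_right scaleR_matrix_vector_assoc[symmetric])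
  then have bl: "bounded_linear (\<lambda>B :: real^'p^'p. a \<bullet> (B *v a))" by (simp add: linear_conv_bounded_linear)
  have "a \<bullet> (outer_square x *v a) = (a \<bullet> x)\<^sup>2" for x :: "real^'p"
  proof -
    have "outer_square x *v a = (x \<bullet> a) *\<^sub>R x"
      by (simp add: vec_eq_iff outer_square_def matrix_vector_mult_def inner_vec_def sum_distrib_left mult_ac)
    then show ?thesis by (simp add: power2_eq_square inner_commute)
  qed
  then show ?thesis
    using integral_bounded_linear[OF bl outer_square_integrable] by (simp add: score_covariance_def)
qed

lemma score_covariance_symmetric: "transpose score_covariance = score_covariance"
proof -
  have "linear (transpose :: real^'p^'p \<Rightarrow> real^'p^'p)"
    by (intro linearI) (simp_all add: transpose_def vec_eq_iff)
  then have bl: "bounded_linear (transpose :: real^'p^'p \<Rightarrow> real^'p^'p)" by (simp add: linear_conv_bounded_linear)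
  have "transpose (outer_square x) = outer_square x" for x :: "real^'p"
    by (simp add: outer_square_def transpose_def mult.commute)
  then show ?thesis
    using integral_bounded_linear[OF bl outer_square_integrable] by (simp add: score_covariance_def)
qed

text \<open>For fixed \<open>a\<close> the variables \<open>a \<bullet> mdot (Z i \<omega>)\<close>
  are i.i.d. and centred with finite variance, so the one-dimensional central limit theorem settles
  every cosine moment of the score.\<close>

lemma score_trig_limit:
  assumes mean: "(\<integral>z. mdot z \<partial>P) = 0"
  shows "(\<lambda>n. \<integral>\<omega>. cos (a \<bullet> score n \<omega> + b) \<partial>\<Omega>) \<longlonglongrightarrow>
    (\<integral>y. cos (sqrt (a \<bullet> (score_covariance *v a)) * y + b) \<partial>std_normal_distribution)"
proof -
  define X where "X i \<omega> = a \<bullet> mdot (Z i \<omega>)" for i \<omega>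
  define \<sigma> where "\<sigma> = sqrt (a \<bullet> (score_covariance *v a))"
  have v: "a \<bullet> (score_covariance *v a) \<ge> 0" unfolding score_covariance_quadratic by simp
  have \<sigma>2: "\<sigma>\<^sup>2 = (\<integral>z. (a \<bullet> mdot z)\<^sup>2 \<partial>P)" using v by (simp add: \<sigma>_def score_covariance_quadratic)
  have Xm[measurable]: "X i \<in> borel_measurable \<Omega>" for i unfolding X_def by measurable
  have sq: "integrable P (\<lambda>z. (a \<bullet> mdot z)\<^sup>2)"
  proof (rule Bochner_Integration.integrable_bound[OF integrable_mult_right[OF mdot_square, of "(norm a)\<^sup>2"]])
    have "\<bar>a \<bullet> mdot z\<bar>\<^sup>2 \<le> (norm a * norm (mdot z))\<^sup>2" for z by (intro power_mono Cauchy_Schwarz_ineq2) auto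
    then show "AE z in P. norm ((a \<bullet> mdot z)\<^sup>2) \<le> norm ((norm a)\<^sup>2 * (norm (mdot z))\<^sup>2)"
      by (simp add: power_mult_distrib)
  qed measurable
  have Xsq: "integrable \<Omega> (\<lambda>\<omega>. (X i \<omega>)\<^sup>2)" for i using integrable_sample[OF sq] by (simp add: X_def)
  have EXsq: "(\<integral>\<omega>. (X i \<omega>)\<^sup>2 \<partial>\<Omega>) = \<sigma>\<^sup>2" for i using integral_sample[of "\<lambda>z. (a \<bullet> mdot z)\<^sup>2"] by (simp add: X_def \<sigma>2)
  have EX: "(\<integral>\<omega>. X i \<omega> \<partial>\<Omega>) = 0" for i
    using integral_sample[of "\<lambda>z. a \<bullet> mdot z"] mean mdot_integrable by (simp add: X_def)
  have sc: "a \<bullet> score n \<omega> = (\<Sum>i<n. X i \<omega>) / sqrt n" for n \<omega> by (simp add: score_def X_def inner_sum_right)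
  interpret N: prob_space std_normal_distribution using prob_space_normal_density[of 1 0] by simp
  have N1: "measure std_normal_distribution UNIV = 1" using N.prob_space by simp
  show ?thesis
  proof (cases "\<sigma> = 0")
    \<comment> \<open>The central limit theorem asks for positive variance. At variance 0 the
      summands vanish almost surely and the integrals do not depend on \<open>n\<close>.\<close>
    case True
    have "AE \<omega> in \<Omega>. (X i \<omega>)\<^sup>2 = 0" for i
      using integral_nonneg_eq_0_iff_AE[OF Xsq[of i]] EXsq[of i] True by simp
    then have "AE \<omega> in \<Omega>. \<forall>i. X i \<omega> = 0" by (simp add: AE_all_countable)
    then have "(\<integral>\<omega>. cos (a \<bullet> score n \<omega> + b) \<partial>\<Omega>) = (\<integral>\<omega>. cos b \<partial>\<Omega>)" for n
      by (intro integral_cong_AE) (auto simp: sc)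
    then show ?thesis using True by (simp add: \<sigma>_def[symmetric] Om.prob_space N1)
  next
    case False
    then have \<sigma>: "\<sigma> > 0" using v by (simp add: \<sigma>_def order.not_eq_order_implies_strict)
    have indep: "Om.indep_vars (\<lambda>i. borel) X UNIV"
      using Om.indep_vars_compose2[OF Z_indep, of "\<lambda>_ z. a \<bullet> mdot z" "\<lambda>_. borel"] by (simp add: X_def[abs_def])
    have dist: "distr \<Omega> borel (X n) = distr P borel (\<lambda>z. a \<bullet> mdot z)" for n
    proof -
      have "distr P borel (\<lambda>z. a \<bullet> mdot z) = distr (distr \<Omega> P (Z n)) borel (\<lambda>z. a \<bullet> mdot z)" by (simp add: Z_distr)
      also have "\<dots> = distr \<Omega> borel (X n)" by (subst distr_distr) (auto simp: comp_def X_def[abs_def])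
      finally show ?thesis by simp
    qed
    have "weak_conv_m (\<lambda>n. distr \<Omega> borel (\<lambda>x. (\<Sum>i<n. X i x) / sqrt (n * \<sigma>\<^sup>2))) std_normal_distribution"
      by (rule Om.central_limit_theorem_zero_mean[OF indep EX \<sigma> Xsq _ dist]) (simp add: EX EXsq)
    from weak_conv_imp_integral_bdd_continuous_conv[OF _ real_dist_normal_dist this, where f = "\<lambda>y. cos (\<sigma> * y + b)" and B = 1]
    have "(\<lambda>n. \<integral>y. cos (\<sigma> * y + b) \<partial>(distr \<Omega> borel (\<lambda>x. (\<Sum>i<n. X i x) / sqrt (n * \<sigma>\<^sup>2)))) \<longlonglongrightarrow> (\<integral>y. cos (\<sigma> * y + b) \<partial>std_normal_distribution)"
      by (auto intro!: Om.real_distribution_distr)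
    moreover have "(\<integral>y. cos (\<sigma> * y + b) \<partial>(distr \<Omega> borel (\<lambda>x. (\<Sum>i<n. X i x) / sqrt (n * \<sigma>\<^sup>2)))) = (\<integral>\<omega>. cos (a \<bullet> score n \<omega> + b) \<partial>\<Omega>)" for n
    proof -
      have "\<sigma> * (S / sqrt (n * \<sigma>\<^sup>2)) = S / sqrt n" for S :: real using \<sigma> by (simp add: real_sqrt_mult)
      then show ?thesis by (simp add: integral_distr sc)
    qed
    ultimately show ?thesis by (simp add: \<sigma>_def)
  qed
qed

end

context restricted_argmax begin

text \<open>Slutsky's argument on cosine moments: the linear part has the right limits by moving
  \<open>L\<close> to the other side of the inner product, and the Lipschitz property of cosine
  transfers them to the scaled error. Tightness is the content of \<open>rate\<close>.\<close>

theorem asymptotic_normality: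
  "asymptotically_normal \<Omega> scaled_error 0 (L ** score_covariance ** transpose L)"
proof -
  let ?\<Gamma> = "L ** score_covariance ** transpose L"
  have quad: "t \<bullet> (?\<Gamma> *v t) = (transpose L *v t) \<bullet> (score_covariance *v (transpose L *v t))" for t
    by (simp only: transpose_transpose matrix_vector_mul_assoc[symmetric] inner_matrix_vector_transpose[of "transpose L"])
  have sym: "transpose ?\<Gamma> = ?\<Gamma>" by (simp add: matrix_transpose_mul score_covariance_symmetric matrix_mul_assoc)
  have "t \<bullet> (?\<Gamma> *v t) \<ge> 0" for t unfolding quad score_covariance_quadratic by simp
  from multivariate_normal_exists[OF sym this] obtain \<mu> where \<mu>: "multivariate_normal 0 ?\<Gamma> \<mu>" by blast
  have err[measurable]: "scaled_error n \<in> borel_measurable \<Omega>" for n by measurable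
  have Lm[measurable]: "(\<lambda>\<omega>. L *v score n \<omega>) \<in> borel_measurable \<Omega>" for n
    by (rule measurable_compose[OF score_measurable borel_measurable_continuous_onI])
       (rule bounded_linear.continuous_on[OF matrix_vector_mul_bounded_linear continuous_on_id])
  have "(\<lambda>\<omega>. (scaled_error n \<omega> - L *v score n \<omega>) /\<^sub>R 1) \<in> borel_measurable \<Omega>" for n by measurable
  from Om.converges_in_probability_iff[OF this, where l = 0] linearization
  have lin: "\<forall>\<^sub>F n in sequentially. holds_up_to \<Omega> e (\<lambda>\<omega>. norm (scaled_error n \<omega> - L *v score n \<omega>) \<le> \<epsilon>)"
    if "\<epsilon> > 0" "e > 0" for \<epsilon> e using that by (simp add: small_o_p_def)
  have "converges_in_distribution \<Omega> scaled_error \<mu>"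
  proof (rule converges_in_distribution_trig)
    show "prob_space \<Omega>" by (rule Om.prob_space_axioms)
    show "prob_space \<mu>" "sets \<mu> = sets borel" using \<mu> by (auto simp: multivariate_normal_def)
    show "\<exists>R. \<forall>\<^sub>F n in sequentially. holds_up_to \<Omega> e (\<lambda>\<omega>. norm (scaled_error n \<omega>) \<le> R)" if "e > 0" for e
      by (rule rate[OF that]) blast
    fix t b
    have "t \<bullet> (L *v x) = (transpose L *v t) \<bullet> x" for x
      using inner_matrix_vector_transpose[of L x t] by (simp add: inner_commute)
    then have lim: "(\<lambda>n. \<integral>\<omega>. cos (t \<bullet> (L *v score n \<omega>) + b) \<partial>\<Omega>) \<longlonglongrightarrow> (\<integral>x. cos (t \<bullet> x + b) \<partial>\<mu>)"
      using score_trig_limit[OF mdot_mean, of "transpose L *v t" b] by (simp add: multivariate_normal_trig[OF \<mu>] quad)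
    have int: "integrable \<Omega> (\<lambda>\<omega>. cos (t \<bullet> Y \<omega> + b))" if "Y \<in> borel_measurable \<Omega>" for Y :: "'w \<Rightarrow> real^'p"
      by (rule Om.integrable_bounded_continuous[of "\<lambda>x. cos (t \<bullet> x + b)" 1]) (auto intro!: continuous_intros that)
    have diff: "(\<lambda>n. (\<integral>\<omega>. cos (t \<bullet> scaled_error n \<omega> + b) \<partial>\<Omega>) - (\<integral>\<omega>. cos (t \<bullet> (L *v score n \<omega>) + b) \<partial>\<Omega>)) \<longlonglongrightarrow> 0"
    proof (rule tendstoI)
      fix r :: real assume r: "r > 0"
      \<comment> \<open>The summand 1 keeps the quotient defining \<epsilon> meaningful for
        \<open>t = 0\<close>.\<close>
      define k where "k = norm t + 1"
      have k: "k > 0" "norm t \<le> k" by (auto simp: k_def add_nonneg_pos)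
      define \<epsilon> where "\<epsilon> = r / (4 * k)"
      have "\<epsilon> > 0" using r k by (simp add: \<epsilon>_def)
      moreover have "k * \<epsilon> = r / 4" using k by (simp add: \<epsilon>_def)
      ultimately have \<epsilon>: "\<epsilon> > 0" "norm t * \<epsilon> \<le> r / 4" using mult_right_mono[OF k(2), of \<epsilon>] by auto
      have r8: "r / 8 > 0" using r by simp
      show "\<forall>\<^sub>F n in sequentially. dist ((\<integral>\<omega>. cos (t \<bullet> scaled_error n \<omega> + b) \<partial>\<Omega>) - (\<integral>\<omega>. cos (t \<bullet> (L *v score n \<omega>) + b) \<partial>\<Omega>)) 0 < r"
        using lin[OF \<epsilon>(1) r8]
      proof eventually_elim
        case (elim n)
        have "\<bar>(\<integral>\<omega>. cos (t \<bullet> scaled_error n \<omega> + b) \<partial>\<Omega>) - (\<integral>\<omega>. cos (t \<bullet> (L *v score n \<omega>) + b) \<partial>\<Omega>)\<bar> \<le> norm t * \<epsilon> + 2 * (r / 8)"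
        proof (rule Om.integral_diff_le_holds_up_to[OF int[OF err] int[OF Lm] elim])
          fix \<omega>
          have cos_lip: "\<bar>cos x - cos y\<bar> \<le> \<bar>x - y\<bar>" for x y :: real
          proof -
            have "\<bar>sin ((x + y) / 2)\<bar> * \<bar>sin ((y - x) / 2)\<bar> \<le> 1 * \<bar>(y - x) / 2\<bar>"
              by (intro mult_mono abs_sin_le_one abs_sin_x_le_abs_x) auto
            then show ?thesis by (simp add: cos_diff_cos abs_mult)
          qed
          have "\<bar>cos (t \<bullet> scaled_error n \<omega> + b) - cos (t \<bullet> (L *v score n \<omega>) + b)\<bar> \<le> \<bar>t \<bullet> (scaled_error n \<omega> - L *v score n \<omega>)\<bar>"
            using cos_lip[of "t \<bullet> scaled_error n \<omega> + b" "t \<bullet> (L *v score n \<omega>) + b"] by (simp add: inner_diff_right)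
          also have "\<dots> \<le> norm t * norm (scaled_error n \<omega> - L *v score n \<omega>)" by (rule Cauchy_Schwarz_ineq2)
          finally show "\<bar>cos (t \<bullet> scaled_error n \<omega> + b) - cos (t \<bullet> (L *v score n \<omega>) + b)\<bar> \<le> norm t * \<epsilon>"
            if "norm (scaled_error n \<omega> - L *v score n \<omega>) \<le> \<epsilon>"
            using that by (meson mult_left_mono norm_ge_zero order.trans)
          show "\<bar>cos (t \<bullet> scaled_error n \<omega> + b) - cos (t \<bullet> (L *v score n \<omega>) + b)\<bar> \<le> 2"
            using abs_cos_le_one[of "t \<bullet> scaled_error n \<omega> + b"] abs_cos_le_one[of "t \<bullet> (L *v score n \<omega>) + b"] by linarith
        qed (use \<epsilon> in auto)
        then show ?case using \<epsilon>(2) r unfolding dist_real_def by linarith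
      qed
    qed
    show "(\<lambda>n. \<integral>\<omega>. cos (t \<bullet> scaled_error n \<omega> + b) \<partial>\<Omega>) \<longlonglongrightarrow> (\<integral>x. cos (t \<bullet> x + b) \<partial>\<mu>)"
      using tendsto_add[OF diff lim] by simp
  qed measurable
  then show ?thesis unfolding asymptotically_normal_def using \<mu> by blast
qed

end

section \<open>Restricted M-estimation\<close>

lemma matrix_uminus_mult: "(- A) ** B = - (A ** B)" "A ** (- B) = - (A ** B)"
  for A :: "real^'n^'m" and B :: "real^'l^'n"
  by (simp_all add: vec_eq_iff matrix_matrix_mult_def sum_negf)

lemma transpose_uminus: "transpose (- A) = - transpose A" for A :: "real^'n^'m"
  by (simp add: transpose_def vec_eq_iff)

lemma matrix_inv_both: "invertible A \<Longrightarrow> A ** matrix_inv A = mat 1 \<and> matrix_inv A ** A = mat 1"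
  unfolding invertible_def matrix_inv_def by (rule someI_ex)

lemma transpose_matrix_inv:
  fixes A :: "real^'n^'n"
  assumes "invertible A" "transpose A = A" shows "transpose (matrix_inv A) = matrix_inv A"
proof -
  have "transpose (A ** matrix_inv A) = transpose (mat 1)" using matrix_inv_both[OF assms(1)] by simp
  then have "transpose (matrix_inv A) ** A = mat 1" using assms(2) by (simp add: matrix_transpose_mul)
  then have "transpose (matrix_inv A) ** (A ** matrix_inv A) = matrix_inv A" by (simp add: matrix_mul_assoc)
  then show ?thesis using matrix_inv_both[OF assms(1)] by simp
qed

text \<open>\<open>projection_wrt\<close> is a definite description, so it must be shown to denote.
  Full column rank makes the Gram matrix \<open>transpose H ** \<Sigma> ** H\<close> invertible, and
  its inverse is in particular a generalised inverse.\<close>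

lemma is_projection_wrt_projection:
  fixes H :: "real^'s^'p"
  assumes S: "positive_definite \<Sigma>" and H: "rank H = CARD('s)"
  shows "is_projection_wrt \<Sigma> (column_space H) (projection_wrt \<Sigma> (column_space H))"
proof -
  let ?B = "transpose H ** \<Sigma> ** H"
  have "x = 0" if "?B *v x = 0" for x
  proof -
    have "(H *v x) \<bullet> (\<Sigma> *v (H *v x)) = x \<bullet> (?B *v x)"
      by (simp add: inner_matrix_vector_transpose matrix_vector_mul_assoc matrix_mul_assoc)
    then have "H *v x = 0" using that positive_definite_eq_0[OF S] by simp
    then show ?thesis using H matrix_nonfull_linear_equations_eq by blast
  qed
  then have "invertible ?B" using invertible_left_inverse matrix_left_invertible_ker by blast
  then have "?B ** matrix_inv ?B ** ?B = ?B" by (simp add: matrix_inv_both)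
  from projection_wrt_generalised_inverse[OF S this] show ?thesis by simp
qed

text \<open>Since \<open>A n \<omega>\<close> is a real number, the inequality with the extended
  supremum passes to each competitor separately; multiplication by \<open>n\<close> turns averages
  into sums.\<close>

lemma strong_M_estimator_gain:
  fixes \<Omega> :: "'w measure"
  assumes "strong_M_estimator \<Omega> P Z m X est"
  shows "\<exists>A :: nat \<Rightarrow> 'w \<Rightarrow> real. small_o_p \<Omega> (\<lambda>n. 1 / real n) A \<and> (\<forall>n\<ge>1. AE \<omega> in \<Omega>. \<forall>\<xi>\<in>X.
    (\<Sum>i<n. m \<xi> (Z i \<omega>)) \<le> (\<Sum>i<n. m (estimate est Z n \<omega>) (Z i \<omega>)) + real n * A n \<omega>)"
proof -
  from assms obtain A where A: "small_o_p \<Omega> (\<lambda>n. 1 / real n) A"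
    "\<And>n. n \<ge> 1 \<Longrightarrow> AE \<omega> in \<Omega>. ereal (empirical_criterion m Z n \<omega> (estimate est Z n \<omega>))
             \<ge> (SUP \<xi>\<in>X. ereal (empirical_criterion m Z n \<omega> \<xi>)) - ereal (A n \<omega>)"
    unfolding strong_M_estimator_def by blast
  have "AE \<omega> in \<Omega>. \<forall>\<xi>\<in>X. (\<Sum>i<n. m \<xi> (Z i \<omega>)) \<le> (\<Sum>i<n. m (estimate est Z n \<omega>) (Z i \<omega>)) + n * A n \<omega>"
    if n: "n \<ge> 1" for n
    using A(2)[OF n]
  proof eventually_elim
    fix \<omega> assume le: "(SUP \<xi>\<in>X. ereal (empirical_criterion m Z n \<omega> \<xi>)) - ereal (A n \<omega>)
      \<le> ereal (empirical_criterion m Z n \<omega> (estimate est Z n \<omega>))"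
    show "\<forall>\<xi>\<in>X. (\<Sum>i<n. m \<xi> (Z i \<omega>)) \<le> (\<Sum>i<n. m (estimate est Z n \<omega>) (Z i \<omega>)) + n * A n \<omega>"
    proof
      fix \<xi> assume "\<xi> \<in> X"
      then have "ereal (empirical_criterion m Z n \<omega> \<xi>) - ereal (A n \<omega>) \<le> (SUP \<xi>\<in>X. ereal (empirical_criterion m Z n \<omega> \<xi>)) - ereal (A n \<omega>)"
        by (intro ereal_minus_mono SUP_upper) auto
      also note le
      finally have "empirical_criterion m Z n \<omega> \<xi> - A n \<omega> \<le> empirical_criterion m Z n \<omega> (estimate est Z n \<omega>)" by simp
      from mult_left_mono[OF this, of "real n"] n
      show "(\<Sum>i<n. m \<xi> (Z i \<omega>)) \<le> (\<Sum>i<n. m (estimate est Z n \<omega>) (Z i \<omega>)) + n * A n \<omega>"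
        by (simp add: empirical_criterion_def right_diff_distrib)
    qed
  qed
  with A(1) show ?thesis by blast
qed

theorem proposition2p7:
  fixes \<Omega> :: "'w measure" and P :: "'z measure" and Z :: "nat \<Rightarrow> 'w \<Rightarrow> 'z"
    and \<Xi> :: "(real^'p) set" and m :: "real^'p \<Rightarrow> 'z \<Rightarrow> real" and \<xi>0 :: "real^'p"
    and \<Theta> :: "(real^'q) set" and g :: "real^'q \<Rightarrow> real^'p"
    and \<M> :: "(real^'p) set" and S :: "(real^'s) set" and h :: "real^'s \<Rightarrow> real^'p" and s0 :: "real^'s"
    and mdot :: "'z \<Rightarrow> real^'p" and V :: "real^'p^'p"
    and est :: "nat \<Rightarrow> (nat \<Rightarrow> 'z) \<Rightarrow> real^'p"
  assumes
    \<comment> \<open>i.i.d. sample\<close>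
    "prob_space \<Omega>" and "prob_space P"
    and "\<And>i. Z i \<in> measurable \<Omega> P" and "\<And>i. distr \<Omega> P (Z i) = P"
    and "prob_space.indep_vars \<Omega> (\<lambda>_. P) Z UNIV"
    \<comment> \<open>\<open>\<xi>0\<close> is the unique maximiser of \<open>\<xi> \<mapsto> P m\<^sub>\<xi>\<close> over the open set \<open>\<Xi>\<close>\<close>
    and "open \<Xi>" and "\<And>\<xi>. \<xi> \<in> \<Xi> \<Longrightarrow> integrable P (m \<xi>)"
    and "\<xi>0 \<in> \<Xi>"
    and "\<And>\<xi>. \<xi> \<in> \<Xi> \<Longrightarrow> \<xi> \<noteq> \<xi>0 \<Longrightarrow> (\<integral>z. m \<xi> z \<partial>P) < (\<integral>z. m \<xi>0 z \<partial>P)"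
    \<comment> \<open>(C1)\<close>
    and "open \<Theta>" and "g ` \<Theta> \<subseteq> \<Xi>" and "\<xi>0 \<in> g ` \<Theta>"
    \<comment> \<open>(C2)\<close>
    and "openin (top_of_set (g ` \<Theta>)) \<M>" and "\<xi>0 \<in> \<M>"
    and "open S" and "CARD('s) \<le> CARD('q)"
    and "bij_betw h S \<M>" and "continuous_on S h" and "continuous_on \<M> (inv_into S h)"
    and "twice_continuously_differentiable_on h S"
    and "s0 \<in> S" and "h s0 = \<xi>0"
    and "rank (jacobian h (at s0)) = CARD('s)"
    \<comment> \<open>(C3)\<close>
    and "\<And>\<theta>0. \<theta>0 \<in> \<Theta> \<Longrightarrow> g \<theta>0 = \<xi>0 \<Longrightarrow> g differentiable (at \<theta>0) \<and>
           column_space (jacobian g (at \<theta>0)) = column_space (jacobian h (at s0))"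
    \<comment> \<open>(A)\<close>
    and "\<And>\<xi>. \<xi> \<in> \<Xi> \<Longrightarrow> m \<xi> \<in> borel_measurable P"
    and "mdot \<in> borel_measurable P"
    and "AE z in P. ((\<lambda>\<xi>. m \<xi> z) has_derivative (\<lambda>v. mdot z \<bullet> v)) (at \<xi>0)"
    \<comment> \<open>(B)\<close>
    and "\<exists>\<phi> U. \<phi> \<in> borel_measurable P \<and> integrable P (\<lambda>z. (\<phi> z)\<^sup>2) \<and>
           open U \<and> \<xi>0 \<in> U \<and> U \<subseteq> \<Xi> \<and>
           (\<forall>\<xi>1\<in>U. \<forall>\<xi>2\<in>U. \<forall>z\<in>space P. \<bar>m \<xi>1 z - m \<xi>2 z\<bar> \<le> \<phi> z * norm (\<xi>1 - \<xi>2))"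
    \<comment> \<open>(C)\<close>
    and "\<exists>b. second_order_taylor (\<lambda>\<xi>. \<integral>z. m \<xi> z \<partial>P) \<xi>0 b V"
    and "transpose V = V" and "invertible V"
    \<comment> \<open>a consistent strong M-estimator over the restricted set \<open>g ` \<Theta>\<close>\<close>
    and "strong_M_estimator \<Omega> P Z m (g ` \<Theta>) est"
    and "converges_in_probability \<Omega> (estimate est Z) \<xi>0"
  shows "small_o_p \<Omega> (\<lambda>_. 1)
           (\<lambda>n \<omega>. sqrt (real n) *\<^sub>R (estimate est Z n \<omega> - \<xi>0)
                  - (1 / sqrt (real n)) *\<^sub>R
                      (\<Sum>i<n. projection_wrt (- V) (column_space (jacobian h (at s0)))
                                *v influence_function V mdot (Z i \<omega>)))
         \<and> asymptotically_normal \<Omega>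
           (\<lambda>n \<omega>. sqrt (real n) *\<^sub>R (estimate est Z n \<omega> - \<xi>0))
           0
           (projection_wrt (- V) (column_space (jacobian h (at s0)))
              ** matrix_inv V ** (\<integral>z. outer_square (mdot z) \<partial>P) ** matrix_inv V
              ** transpose (projection_wrt (- V) (column_space (jacobian h (at s0)))))"
proof -
  let ?F = "\<lambda>\<xi>. \<integral>z. m \<xi> z \<partial>P"
  let ?H = "jacobian h (at s0)"
  let ?T = "column_space ?H"
  let ?\<Pi> = "projection_wrt (- V) ?T"
  \<comment> \<open>The unrestricted maximiser of the quadratic for score \<open>u\<close> is
    \<open>- (matrix_inv V *v u)\<close>, and \<open>L\<close> sends \<open>u\<close> to its
    projection in the inner product of \<open>- V\<close>.\<close>
  define L where "L = - (?\<Pi> ** matrix_inv V)"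
  note iid = assms(1-5) and Xi = assms(6-9) and c2 = assms(13-23) and reg = assms(25-27) and V = assms(30,31)
  obtain \<phi> U where \<phi>: "\<phi> \<in> borel_measurable P" "integrable P (\<lambda>z. (\<phi> z)\<^sup>2)" "open U" "\<xi>0 \<in> U" "U \<subseteq> \<Xi>"
    "\<forall>\<xi>1\<in>U. \<forall>\<xi>2\<in>U. \<forall>z\<in>space P. \<bar>m \<xi>1 z - m \<xi>2 z\<bar> \<le> \<phi> z * norm (\<xi>1 - \<xi>2)"
    using assms(28) by blast
  obtain b where b: "second_order_taylor ?F \<xi>0 b V" using assms(29) by blast
  have max: "?F \<xi> \<le> ?F \<xi>0" if "\<xi> \<in> \<Xi>" for \<xi> using Xi(4)[OF that] by (cases "\<xi> = \<xi>0") auto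
  have taylor: "second_order_taylor ?F \<xi>0 0 V"
    using b second_order_taylor_max(1)[OF b Xi(1,3) max V] by simp
  obtain c where c: "c > 0" "\<And>x. x \<bullet> (V *v x) \<le> - c * (norm x)\<^sup>2"
    using second_order_taylor_max(2)[OF b Xi(1,3) max V] by blast
  have "x \<bullet> (- V *v x) > 0" if "x \<noteq> 0" for x
  proof -
    have "- c * (norm x)\<^sup>2 < 0" using c(1) that by simp
    then show ?thesis using c(2)[of x] by (simp add: matrix_uminus_vector_mult)
  qed
  moreover have "transpose (- V) = - V" using V(1) by (simp add: transpose_uminus)
  ultimately have pd: "positive_definite (- V)" by (simp add: positive_definite_def)
  from is_projection_wrt_projection[OF pd c2(11)] have proj: "is_projection_wrt (- V) ?T ?\<Pi>" .
  have L_eq: "L *v u = ?\<Pi> *v (- (matrix_inv V *v u))" for u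
    by (simp add: L_def matrix_uminus_vector_mult matrix_vector_mul_assoc[symmetric])
       (simp add: vec_eq_iff matrix_vector_mult_def sum_negf)
  have L_T: "L *v u \<in> ?T" for u using proj unfolding L_eq is_projection_wrt_def by blast
  \<comment> \<open>With \<open>V *v w = - u\<close>, orthogonality of the projection residual of
    \<open>w\<close> in the inner product of \<open>- V\<close> is exactly the first order condition
    for the maximum over the tangent space.\<close>
  have L_orth: "\<tau> \<bullet> (V *v (L *v u) + u) = 0" if "\<tau> \<in> ?T" for u \<tau>
  proof -
    define w where "w = - (matrix_inv V *v u)"
    have "V *v w = - (V *v (matrix_inv V *v u))" by (simp add: w_def vec_eq_iff matrix_vector_mult_def sum_negf)
    then have Vw: "V *v w = - u" using matrix_inv_both[OF V(2)] by (simp add: matrix_vector_mul_assoc)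
    have "\<tau> \<bullet> (- V *v (w - ?\<Pi> *v w)) = 0" using proj that unfolding is_projection_wrt_def by blast
    then show ?thesis using Vw by (simp add: L_eq w_def[symmetric] matrix_uminus_vector_mult matrix_vector_mult_diff_distrib inner_diff_right inner_add_right)
  qed
  have "h differentiable (at s0)"
  proof -
    from c2(8) obtain h' :: "real^'s \<Rightarrow> (real^'s) \<Rightarrow>\<^sub>L (real^'p)"
      where "\<forall>x\<in>S. (h has_derivative blinfun_apply (h' x)) (at x)"
      unfolding twice_continuously_differentiable_on_def by (elim exE conjE)
    then show ?thesis using c2(9) by (auto intro: differentiableI)
  qed
  then have deriv: "(h has_derivative (*v) ?H) (at s0)" by (simp add: jacobian_works)
  \<comment> \<open>The image of the chart is relatively open, so near \<xi>0 the chart accounts for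
    every point of the restricted set.\<close>
  note tangent = tangent_space_approximation[OF c2(3,9,1,5,10,7) deriv c2(11)]
  obtain A where A: "small_o_p \<Omega> (\<lambda>n. 1 / real n) A"
    "\<forall>n\<ge>1. AE \<omega> in \<Omega>. \<forall>\<xi>\<in>g ` \<Theta>. (\<Sum>i<n. m \<xi> (Z i \<omega>)) \<le> (\<Sum>i<n. m (estimate est Z n \<omega>) (Z i \<omega>)) + real n * A n \<omega>"
    using strong_M_estimator_gain[OF assms(32)] by (elim exE conjE)
  have est_X: "estimate est Z n \<omega> \<in> g ` \<Theta>" if "n \<ge> 1" "\<omega> \<in> space \<Omega>" for n \<omega>
  proof -
    have "(\<lambda>i\<in>{..<n}. Z i \<omega>) \<in> space (Pi\<^sub>M {..<n} (\<lambda>_. P))"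
      using measurable_space[OF iid(3) that(2)] by (simp add: space_PiM)
    then show ?thesis using assms(32) that(1) unfolding strong_M_estimator_def estimate_def by blast
  qed
  interpret P: prob_space P by (rule iid(2))
  interpret Om: prob_space \<Omega> by (rule iid(1))
  interpret restricted_argmax P m \<xi>0 mdot \<phi> U \<Omega> Z V L ?T "g ` \<Theta>" c "estimate est Z" A
  proof unfold_locales
    show "open U" "\<xi>0 \<in> U" by (rule \<phi>)+
    show "integrable P (m \<xi>)" if "\<xi> \<in> U" for \<xi> using that \<phi>(5) Xi(2) by blast
    show "mdot \<in> borel_measurable P" "AE z in P. ((\<lambda>\<xi>. m \<xi> z) has_derivative (\<bullet>) (mdot z)) (at \<xi>0)" by (rule reg)+
    show "\<phi> \<in> borel_measurable P" "integrable P (\<lambda>z. (\<phi> z)\<^sup>2)" by (rule \<phi>)+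
    show "\<bar>m \<xi>1 z - m \<xi>2 z\<bar> \<le> \<phi> z * norm (\<xi>1 - \<xi>2)" if "\<xi>1 \<in> U" "\<xi>2 \<in> U" "z \<in> space P" for \<xi>1 \<xi>2 z
      using that \<phi>(6) by blast
    show "Z i \<in> measurable \<Omega> P" "distr \<Omega> P (Z i) = P" for i by (rule iid)+
    show "Om.indep_vars (\<lambda>_. P) Z UNIV" by (rule iid)
    show "second_order_taylor ?F \<xi>0 0 V" by (rule taylor)
    show "transpose V = V" by (rule V)
    show "c > 0" "x \<bullet> (V *v x) \<le> - c * (norm x)\<^sup>2" for x by (rule c)+
    show "subspace ?T" by (simp add: column_space_def)
    show "L *v u \<in> ?T" for u by (rule L_T)
    show "\<tau> \<bullet> (V *v (L *v u) + u) = 0" if "\<tau> \<in> ?T" for u \<tau> by (rule L_orth[OF that])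
    show "\<exists>\<delta>>0. \<forall>\<xi>\<in>g ` \<Theta>. norm (\<xi> - \<xi>0) < \<delta> \<longrightarrow> (\<exists>\<tau>\<in>?T. norm (\<xi> - \<xi>0 - \<tau>) \<le> \<kappa> * norm (\<xi> - \<xi>0))"
      if "\<kappa> > 0" for \<kappa> by (rule tangent(1)[OF that])
    show "\<exists>\<delta>>0. \<forall>\<tau>\<in>?T. norm \<tau> < \<delta> \<longrightarrow> (\<exists>\<xi>\<in>g ` \<Theta>. norm (\<xi> - \<xi>0 - \<tau>) \<le> \<kappa> * norm \<tau>)"
      if "\<kappa> > 0" for \<kappa> by (rule tangent(2)[OF that])
    show "\<xi>0 \<in> g ` \<Theta>" by (rule assms(12))
    show "estimate est Z n \<omega> \<in> g ` \<Theta>" if "n \<ge> 1" "\<omega> \<in> space \<Omega>" for n \<omega> by (rule est_X[OF that])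
    show "converges_in_probability \<Omega> (estimate est Z) \<xi>0" by (rule assms(33))
    show "small_o_p \<Omega> (\<lambda>n. 1 / real n) A" by (rule A(1))
    show "AE \<omega> in \<Omega>. \<forall>\<xi>\<in>g ` \<Theta>. (\<Sum>i<n. m \<xi> (Z i \<omega>)) \<le> (\<Sum>i<n. m (estimate est Z n \<omega>) (Z i \<omega>)) + n * A n \<omega>"
      if "n \<ge> 1" for n by (rule A(2)[rule_format, OF that])
  qed
  have score_eq: "L *v score n \<omega> = (1 / sqrt (real n)) *\<^sub>R (\<Sum>i<n. ?\<Pi> *v influence_function V mdot (Z i \<omega>))" for n \<omega>
  proof -
    have "L *v (\<Sum>i<n. mdot (Z i \<omega>)) = (\<Sum>i<n. L *v mdot (Z i \<omega>))"
      by (rule linear_sum[OF matrix_vector_mul_linear])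
    then show ?thesis by (simp only: score_def matrix_vector_mult_scaleR influence_function_def L_eq)
  qed
  \<comment> \<open>The minus signs of \<open>L\<close> and its transpose cancel, and the inverse of
    the symmetric \<open>V\<close> is symmetric, which gives the sandwich form of the
    variance.\<close>
  have "transpose L = - (matrix_inv V ** transpose ?\<Pi>)"
    by (simp only: L_def transpose_uminus matrix_transpose_mul transpose_matrix_inv[OF V(2,1)])
  then have cov: "L ** score_covariance ** transpose L
      = ?\<Pi> ** matrix_inv V ** (\<integral>z. outer_square (mdot z) \<partial>P) ** matrix_inv V ** transpose ?\<Pi>"
    by (simp only: L_def matrix_uminus_mult score_covariance_def matrix_mul_assoc minus_minus)
  show ?thesis
    using linearization[unfolded score_eq] asymptotic_normality[unfolded cov] by (rule conjI)
qed

end
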